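(* Let $F$ be a field. For every integer $n\ge 1$, the Hilbert series of the algebras $Q_n$ and $Q_{n-1}$ over $F$ satisfy $$\frac{1}{H(Q_n,t)}=(2-t)\,\frac{1}{H(Q_{n-1},t)}-1 .$$
   Context: Definition of $Q_n$ (for any $n\ge0$). Let $V$ be the $F$-vector space with basis $\{v(A): \emptyset\neq A\subseteq\{1,\dots,n\}\}$, and put $v(\emptyset)=0$. For $A\subseteq\{1,\dots,n\}$ and distinct $i,j\in A$ put $$\mathcal V(A:\{i,j\})=v(A)\bigl(v(A\setminus\{i\})-v(A\setminus\{j\})\bigr)+\bigl(v(A\setminus\{i\})-v(A\setminus\{j\})\bigr)v(A\setminus\{i,j\})-v(A\setminus\{i\})^2+v(A\setminus\{j\})^2 .$$ $Q_n$ is the quotient of the tensor algebra $T(V)$ by the two-sided ideal generated by all these elements; it is graded with the images of the $v(A)$ in degree $1$; $Q_0=F$. For a graded vector space $W=\sum_{i\ge 0}W_i$ with all $W_i$ finite dimensional, $H(W,t)=\sum_{i\ge0}(\dim W_i)t^i$. *)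

theory Defs
  imports "HOL-Algebra.Algebra" "HOL-Computational_Algebra.Formal_Power_Series"
begin

text \<open>
  The tensor algebra \<open>T(V)\<close> of the vector space \<open>V\<close> with basis \<open>B\<close>, as the free associative
  algebra on \<open>B\<close>: its elements are the finitely supported coefficient functions on words over \<open>B\<close>,
  the word \<open>[x\<^sub>1, \<dots>, x\<^sub>k]\<close> standing for the tensor \<open>x\<^sub>1 \<otimes> \<dots> \<otimes> x\<^sub>k\<close> and \<open>[]\<close> for the unit.
\<close>

definition tensor_algebra :: "'x set \<Rightarrow> ('x list \<Rightarrow> 'f::field) ring" where
  "tensor_algebra B =
    \<lparr>carrier = {p. finite {w. p w \<noteq> 0} \<and> (\<forall>w. p w \<noteq> 0 \<longrightarrow> set w \<subseteq> B)},
     monoid.mult = (\<lambda>p q w. \<Sum>(u, v) | u @ v = w. p u * q v),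
     one = (\<lambda>w. if w = [] then 1 else 0),
     ring.zero = (\<lambda>w. 0),
     ring.add = (\<lambda>p q w. p w + q w)\<rparr>"

definition scalar :: "'f::field \<Rightarrow> 'x list \<Rightarrow> 'f" where
  "scalar c = (\<lambda>w. if w = [] then c else 0)"

definition homogeneous :: "'x set \<Rightarrow> nat \<Rightarrow> ('x list \<Rightarrow> 'f::field) set" where
  "homogeneous B i = {p \<in> carrier (tensor_algebra B). \<forall>w. p w \<noteq> 0 \<longrightarrow> length w = i}"

definition generators :: "nat \<Rightarrow> nat set set" where
  "generators n = {A. A \<noteq> {} \<and> A \<subseteq> {1..n}}"

text \<open>
  \<open>basis_vec A\<close> is \<open>v(A)\<close>, with the convention \<open>v({}) = 0\<close>; \<open>relator F n A i j\<close> below is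
  \<open>\<V>(A : {i, j})\<close>, which only changes sign when \<open>i\<close> and \<open>j\<close> are exchanged.
\<close>

definition basis_vec :: "nat set \<Rightarrow> nat set list \<Rightarrow> 'f::field" where
  "basis_vec A = (if A = {} then (\<lambda>w. 0) else (\<lambda>w. if w = [A] then 1 else 0))"

definition free_T :: "'f::field itself \<Rightarrow> nat \<Rightarrow> (nat set list \<Rightarrow> 'f) ring" where
  "free_T _ n = tensor_algebra (generators n)"

definition relator ::
    "'f::field itself \<Rightarrow> nat \<Rightarrow> nat set \<Rightarrow> nat \<Rightarrow> nat \<Rightarrow> nat set list \<Rightarrow> 'f" where
  "relator F n A i j = (let R = free_T F n in
     basis_vec A \<otimes>\<^bsub>R\<^esub> (basis_vec (A - {i}) \<ominus>\<^bsub>R\<^esub> basis_vec (A - {j}))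
     \<oplus>\<^bsub>R\<^esub> (basis_vec (A - {i}) \<ominus>\<^bsub>R\<^esub> basis_vec (A - {j})) \<otimes>\<^bsub>R\<^esub> basis_vec (A - {i, j})
     \<ominus>\<^bsub>R\<^esub> basis_vec (A - {i}) [^]\<^bsub>R\<^esub> (2::nat)
     \<oplus>\<^bsub>R\<^esub> basis_vec (A - {j}) [^]\<^bsub>R\<^esub> (2::nat))"

definition relators :: "'f::field itself \<Rightarrow> nat \<Rightarrow> (nat set list \<Rightarrow> 'f) set" where
  "relators F n = {relator F n A i j | A i j. A \<subseteq> {1..n} \<and> i \<in> A \<and> j \<in> A \<and> i \<noteq> j}"

definition relation_ideal :: "'f::field itself \<Rightarrow> nat \<Rightarrow> (nat set list \<Rightarrow> 'f) set" where
  "relation_ideal F n = Idl\<^bsub>free_T F n\<^esub> (relators F n)"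

definition Q_alg :: "'f::field itself \<Rightarrow> nat \<Rightarrow> (nat set list \<Rightarrow> 'f) set ring" where
  "Q_alg F n = free_T F n Quot relation_ideal F n"

definition to_Q ::
    "'f::field itself \<Rightarrow> nat \<Rightarrow> (nat set list \<Rightarrow> 'f) \<Rightarrow> (nat set list \<Rightarrow> 'f) set" where
  "to_Q F n p = relation_ideal F n +>\<^bsub>free_T F n\<^esub> p"

definition Q_scalars :: "'f::field itself \<Rightarrow> nat \<Rightarrow> (nat set list \<Rightarrow> 'f) set set" where
  "Q_scalars F n = to_Q F n ` range scalar"

definition Q_component :: "'f::field itself \<Rightarrow> nat \<Rightarrow> nat \<Rightarrow> (nat set list \<Rightarrow> 'f) set set" where
  "Q_component F n i = to_Q F n ` homogeneous (generators n) i"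

text \<open>
  Dimension over \<open>F\<close> is \<^const>\<open>ring.dim\<close> over the copy \<^const>\<open>Q_scalars\<close> of \<open>F\<close> in \<^const>\<open>Q_alg\<close>.
  It is meaningful because \<^const>\<open>Q_scalars\<close> is a subfield isomorphic to \<open>F\<close> and all components
  are finite dimensional, as shown below. Coefficients are taken in \<open>rat\<close> so that the series,
  whose constant term is 1, can be inverted by the field-based division of formal power series.
\<close>

definition hilbert_Q :: "'f::field itself \<Rightarrow> nat \<Rightarrow> rat fps" where
  "hilbert_Q F n = Abs_fps (\<lambda>i. of_nat (ring.dim (Q_alg F n) (Q_scalars F n) (Q_component F n i)))"

subsection \<open>Well-definedness\<close>

lemma finite_splits: "finite {(u, v). u @ v = w}"
proof -
  have "{(u, v). u @ v = w} \<subseteq> (\<lambda>k. (take k w, drop k w)) ` {..length w}"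
  proof clarify
    fix u v assume "w = u @ v"
    then show "(u, v) \<in> (\<lambda>k. (take k (u @ v), drop k (u @ v))) ` {..length (u @ v)}"
      by (intro image_eqI[of _ _ "length u"]) auto
  qed
  then show ?thesis by (rule finite_subset) simp
qed

lemma conv_assoc:
  fixes p q r :: "'x list \<Rightarrow> 'f::field"
  shows "(\<Sum>(u, v) | u @ v = w. (\<Sum>(a, b) | a @ b = u. p a * q b) * r v)
       = (\<Sum>(u, v) | u @ v = w. p u * (\<Sum>(a, b) | a @ b = v. q a * r b))"
proof -
  have "(\<Sum>(u, v) | u @ v = w. (\<Sum>(a, b) | a @ b = u. p a * q b) * r v)
      = (\<Sum>x\<in>{(u, v). u @ v = w}. \<Sum>y\<in>{(a, b). a @ b = fst x}. p (fst y) * q (snd y) * r (snd x))"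
    by (intro sum.cong) (auto simp: sum_distrib_right case_prod_beta)
  also have "\<dots> = (\<Sum>(x, y)\<in>Sigma {(u, v). u @ v = w} (\<lambda>x. {(a, b). a @ b = fst x}).
                    p (fst y) * q (snd y) * r (snd x))"
    by (rule sum.Sigma) (auto simp: finite_splits)
  also have "\<dots> = (\<Sum>(x, y)\<in>Sigma {(u, v). u @ v = w} (\<lambda>x. {(a, b). a @ b = snd x}).
                    p (fst x) * (q (fst y) * r (snd y)))"
    by (rule sum.reindex_bij_witness
        [where i = "\<lambda>((a, bc), (b, c)). ((a @ b, c), (a, b))"
           and j = "\<lambda>((ab, c), (a, b)). ((a, b @ c), (b, c))"]) (auto simp: mult.assoc)
  also have "\<dots> = (\<Sum>x\<in>{(u, v). u @ v = w}. \<Sum>y\<in>{(a, b). a @ b = snd x}. p (fst x) * (q (fst y) * r (snd y)))"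
    by (rule sum.Sigma[symmetric]) (auto simp: finite_splits)
  also have "\<dots> = (\<Sum>(u, v) | u @ v = w. p u * (\<Sum>(a, b) | a @ b = v. q a * r b))"
    by (intro sum.cong) (auto simp: sum_distrib_left case_prod_beta)
  finally show ?thesis .
qed

lemma conv_nonzeroE:
  fixes p q :: "'x list \<Rightarrow> 'f::field"
  assumes "(\<Sum>(u, v) | u @ v = w. p u * q v) \<noteq> 0"
  obtains u v where "w = u @ v" "p u \<noteq> 0" "q v \<noteq> 0"
proof -
  from assms obtain x where "x \<in> {(u, v). u @ v = w}" "(case x of (u, v) \<Rightarrow> p u * q v) \<noteq> 0"
    by (rule sum.not_neutral_contains_not_neutral)
  then show ?thesis using that[of "fst x" "snd x"] by (auto simp: case_prod_beta)
qed

lemma conv_scalar_left: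
  fixes q :: "'x list \<Rightarrow> 'f::field"
  shows "(\<Sum>(u, v) | u @ v = w. (if u = [] then c else 0) * q v) = c * q w"
proof -
  have "(\<Sum>(u, v) | u @ v = w. (if u = [] then c else 0) * q v)
      = (\<Sum>(u, v)\<in>{([] :: 'x list, w)}. (if u = [] then c else 0) * q v)"
    by (rule sum.mono_neutral_right) (auto simp: finite_splits split: if_splits)
  then show ?thesis by simp
qed

lemma conv_scalar_right:
  fixes q :: "'x list \<Rightarrow> 'f::field"
  shows "(\<Sum>(u, v) | u @ v = w. q u * (if v = [] then c else 0)) = q w * c"
proof -
  have "(\<Sum>(u, v) | u @ v = w. q u * (if v = [] then c else 0))
      = (\<Sum>(u, v)\<in>{(w, [] :: 'x list)}. q u * (if v = [] then c else 0))"
    by (rule sum.mono_neutral_right) (auto simp: finite_splits split: if_splits)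
  then show ?thesis by simp
qed

lemma tensor_algebra_mult_closed:
  assumes "p \<in> carrier (tensor_algebra B)" "q \<in> carrier (tensor_algebra B)"
  shows "p \<otimes>\<^bsub>tensor_algebra B\<^esub> q \<in> carrier (tensor_algebra B)"
proof -
  have "{w. (\<Sum>(u, v) | u @ v = w. p u * q v) \<noteq> 0}
      \<subseteq> (\<lambda>(u, v). u @ v) ` ({w. p w \<noteq> 0} \<times> {w. q w \<noteq> 0})"
    by (auto elim!: conv_nonzeroE)
  moreover have "finite \<dots>" using assms by (auto simp: tensor_algebra_def)
  ultimately have "finite {w. (\<Sum>(u, v) | u @ v = w. p u * q v) \<noteq> 0}" by (rule finite_subset)
  moreover have "set w \<subseteq> B" if "(\<Sum>(u, v) | u @ v = w. p u * q v) \<noteq> 0" for w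
    using that assms by (elim conv_nonzeroE) (fastforce simp: tensor_algebra_def)
  ultimately show ?thesis by (auto simp: tensor_algebra_def)
qed

lemma tensor_algebra_add_closed:
  assumes "p \<in> carrier (tensor_algebra B)" "q \<in> carrier (tensor_algebra B)"
  shows "p \<oplus>\<^bsub>tensor_algebra B\<^esub> q \<in> carrier (tensor_algebra B)"
proof -
  have "{w. p w + q w \<noteq> 0} \<subseteq> {w. p w \<noteq> 0} \<union> {w. q w \<noteq> 0}" by auto
  moreover have "finite \<dots>" using assms by (auto simp: tensor_algebra_def)
  ultimately have "finite {w. p w + q w \<noteq> 0}" by (rule finite_subset)
  moreover have "set w \<subseteq> B" if "p w + q w \<noteq> 0" for w
  proof -
    from that have "p w \<noteq> 0 \<or> q w \<noteq> 0" by auto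
    then show ?thesis using assms by (auto simp: tensor_algebra_def)
  qed
  ultimately show ?thesis by (auto simp: tensor_algebra_def)
qed

lemma tensor_algebra_uminus_closed:
  "p \<in> carrier (tensor_algebra B) \<Longrightarrow> (\<lambda>w. - p w) \<in> carrier (tensor_algebra B)"
  by (simp add: tensor_algebra_def)

lemma ring_tensor_algebra: "ring (tensor_algebra B :: ('x list \<Rightarrow> 'f::field) ring)"
proof (rule ringI)
  show "abelian_group (tensor_algebra B :: ('x list \<Rightarrow> 'f::field) ring)"
  proof (rule abelian_groupI)
    fix p :: "'x list \<Rightarrow> 'f" assume "p \<in> carrier (tensor_algebra B)"
    then show "\<exists>q\<in>carrier (tensor_algebra B). q \<oplus>\<^bsub>tensor_algebra B\<^esub> p = \<zero>\<^bsub>tensor_algebra B\<^esub>"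
      by (intro bexI[OF _ tensor_algebra_uminus_closed]) (auto simp: tensor_algebra_def)
  qed (rule tensor_algebra_add_closed, auto simp: tensor_algebra_def algebra_simps)
  show "Group.monoid (tensor_algebra B :: ('x list \<Rightarrow> 'f::field) ring)"
    by (rule monoidI, rule tensor_algebra_mult_closed)
      (auto simp: tensor_algebra_def conv_assoc conv_scalar_left conv_scalar_right)
qed (auto simp: tensor_algebra_def algebra_simps sum.distrib case_prod_beta)

lemma ring_free_T: "ring (free_T F n)"
  by (simp add: free_T_def ring_tensor_algebra)

lemma basis_vec_closed: "A \<subseteq> {1..n} \<Longrightarrow> basis_vec A \<in> carrier (free_T F n)"
  by (auto simp: basis_vec_def free_T_def tensor_algebra_def generators_def)

lemma relators_closed: "relators F n \<subseteq> carrier (free_T F n)"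
proof -
  interpret ring "free_T F n" by (rule ring_free_T)
  show ?thesis
  proof (clarsimp simp: relators_def)
    fix A i j assume "A \<subseteq> {Suc 0..n}"
    then have *: "basis_vec A \<in> carrier (free_T F n)" "basis_vec (A - B) \<in> carrier (free_T F n)" for B
      by (auto intro!: basis_vec_closed)
    show "relator F n A i j \<in> carrier (free_T F n)"
      unfolding relator_def Let_def using * by simp
  qed
qed

lemma relation_ideal_ideal: "ideal (relation_ideal F n) (free_T F n)"
  unfolding relation_ideal_def by (intro ring.genideal_ideal ring_free_T relators_closed)

lemma ring_Q_alg: "ring (Q_alg F n)"
  unfolding Q_alg_def by (rule ideal.quotient_is_ring[OF relation_ideal_ideal])


lemma scalar_closed: "scalar c \<in> carrier (tensor_algebra B)"
  by (simp add: scalar_def tensor_algebra_def)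

lemma tensor_algebra_one: "\<one>\<^bsub>tensor_algebra B\<^esub> = scalar 1"
  by (simp add: scalar_def tensor_algebra_def)

lemma tensor_algebra_zero: "\<zero>\<^bsub>tensor_algebra B\<^esub> = scalar 0"
  by (simp add: scalar_def tensor_algebra_def)

lemma scalar_mult: "scalar c \<otimes>\<^bsub>tensor_algebra B\<^esub> p = (\<lambda>w. c * p w)"
  by (simp add: scalar_def tensor_algebra_def conv_scalar_left)

lemma tensor_algebra_add: "p \<oplus>\<^bsub>tensor_algebra B\<^esub> q = (\<lambda>w. p w + q w)"
  by (simp add: tensor_algebra_def)

lemma tensor_algebra_uminus:
  fixes p :: "'x list \<Rightarrow> 'f::field"
  assumes p: "p \<in> carrier (tensor_algebra B)"
  shows "\<ominus>\<^bsub>tensor_algebra B\<^esub> p = (\<lambda>w. - p w)"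
proof -
  interpret ring "tensor_algebra B :: ('x list \<Rightarrow> 'f) ring" by (rule ring_tensor_algebra)
  have "(\<lambda>w. - p w) \<oplus>\<^bsub>tensor_algebra B\<^esub> p = \<zero>\<^bsub>tensor_algebra B\<^esub>"
    by (simp add: tensor_algebra_def)
  then show ?thesis
    using minus_equality p tensor_algebra_uminus_closed by blast
qed

lemma subfield_scalar: "subfield (range scalar) (tensor_algebra B :: ('x list \<Rightarrow> 'f::field) ring)"
proof -
  let ?T = "tensor_algebra B :: ('x list \<Rightarrow> 'f) ring"
  interpret ring ?T by (rule ring_tensor_algebra)
  have mult: "scalar c \<otimes>\<^bsub>?T\<^esub> scalar d = scalar (c * d)" for c d
    unfolding scalar_mult by (auto simp: scalar_def)
  show ?thesis
  proof (rule subfieldI)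
    show "subcring (range scalar) ?T"
    proof (rule subcringI[OF subringI])
      fix h :: "'x list \<Rightarrow> 'f" assume "h \<in> range scalar"
      then obtain c where "h = scalar c" by auto
      then have "\<ominus>\<^bsub>?T\<^esub> h = scalar (- c)"
        by (simp add: tensor_algebra_uminus scalar_closed) (auto simp: scalar_def)
      then show "\<ominus>\<^bsub>?T\<^esub> h \<in> range scalar" by simp
    next
      fix g h :: "'x list \<Rightarrow> 'f" assume "g \<in> range scalar" "h \<in> range scalar"
      then obtain c d where "g = scalar c" "h = scalar d" by auto
      then have "g \<oplus>\<^bsub>?T\<^esub> h = scalar (c + d)"
        by (auto simp: tensor_algebra_add scalar_def)
      then show "g \<oplus>\<^bsub>?T\<^esub> h \<in> range scalar" by simp
    qed (auto simp: scalar_closed tensor_algebra_one mult mult.commute)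
    show "Units (?T\<lparr>carrier := range scalar\<rparr>) = range scalar - {\<zero>\<^bsub>?T\<^esub>}"
    proof (intro equalityI subsetI)
      fix x assume "x \<in> Units (?T\<lparr>carrier := range scalar\<rparr>)"
      then obtain c d where x: "x = scalar c" and "scalar c \<otimes>\<^bsub>?T\<^esub> scalar d = \<one>\<^bsub>?T\<^esub>"
        by (auto simp: Units_def)
      then have "scalar (c * d) = (scalar 1 :: 'x list \<Rightarrow> 'f)"
        by (simp add: mult tensor_algebra_one)
      from fun_cong[OF this, of "[]"] have "c \<noteq> 0" by (auto simp: scalar_def)
      with x have "x [] \<noteq> scalar 0 []" by (simp add: scalar_def)
      with x show "x \<in> range scalar - {\<zero>\<^bsub>?T\<^esub>}"
        by (auto simp: tensor_algebra_zero)
    next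
      fix x assume "x \<in> range scalar - {\<zero>\<^bsub>?T\<^esub>}"
      then obtain c where c: "x = scalar c" "c \<noteq> 0" by (auto simp: tensor_algebra_zero)
      then have "scalar (inverse c) \<otimes>\<^bsub>?T\<^esub> x = \<one>\<^bsub>?T\<^esub>" "x \<otimes>\<^bsub>?T\<^esub> scalar (inverse c) = \<one>\<^bsub>?T\<^esub>"
        by (auto simp: mult tensor_algebra_one)
      then show "x \<in> Units (?T\<lparr>carrier := range scalar\<rparr>)"
        using c by (auto simp: Units_def)
    qed
  qed
qed

lemma Span_words:
  fixes B :: "'x set"
  assumes "\<And>u. u \<in> set ws \<Longrightarrow> set u \<subseteq> B"
  shows "ring.Span (tensor_algebra B) (range scalar)
      (map (\<lambda>u w. if w = u then 1 else 0) ws)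
    = {p :: 'x list \<Rightarrow> 'f::field. \<forall>w. p w \<noteq> 0 \<longrightarrow> w \<in> set ws}"
proof -
  let ?T = "tensor_algebra B :: ('x list \<Rightarrow> 'f) ring"
  interpret ring ?T by (rule ring_tensor_algebra)
  show ?thesis using assms
  proof (induction ws)
    case Nil
    show ?case by (auto simp: tensor_algebra_zero scalar_def)
  next
    case (Cons u us)
    let ?S = "\<lambda>ws. {p :: 'x list \<Rightarrow> 'f. \<forall>w. p w \<noteq> 0 \<longrightarrow> w \<in> set ws}"
    let ?m = "\<lambda>w. if w = u then 1 else (0::'f)"
    have "line_extension (range scalar) ?m (?S us) = ?S (u # us)"
    proof (intro equalityI subsetI)
      fix p assume "p \<in> line_extension (range scalar) ?m (?S us)"
      then obtain c q where "q \<in> ?S us" "p = (\<lambda>w. c * ?m w + q w)"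
        by (auto simp: line_extension_mem_iff scalar_mult tensor_algebra_add)
      then show "p \<in> ?S (u # us)" by auto
    next
      fix p assume p: "p \<in> ?S (u # us)"
      then have "p(u := 0) \<in> ?S us" by auto
      moreover have "p = scalar (p u) \<otimes>\<^bsub>?T\<^esub> ?m \<oplus>\<^bsub>?T\<^esub> p(u := 0)"
        by (auto simp: scalar_mult tensor_algebra_add)
      ultimately show "p \<in> line_extension (range scalar) ?m (?S us)"
        unfolding line_extension_mem_iff by blast
    qed
    then show ?case using Cons by simp
  qed
qed

lemma augmentation_ideal:
  "ideal {p \<in> carrier (tensor_algebra B). p [] = 0} (tensor_algebra B :: ('x list \<Rightarrow> 'f::field) ring)"
  (is "ideal ?J ?T")
proof -
  interpret ring ?T by (rule ring_tensor_algebra)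
  have splits: "{(u, v). u = ([] :: 'x list) \<and> v = []} = {([], [])}" by auto
  have mult: "(p \<otimes>\<^bsub>?T\<^esub> q) [] = p [] * q []" for p q :: "'x list \<Rightarrow> 'f"
    by (simp add: tensor_algebra_def splits)
  show ?thesis
  proof (rule idealI[OF ring_axioms])
    show "subgroup ?J (add_monoid ?T)"
    proof (rule add.subgroupI)
      show "?J \<noteq> {}" using zero_closed by (force simp: tensor_algebra_zero scalar_def)
    next
      fix p assume "p \<in> ?J"
      then show "\<ominus>\<^bsub>?T\<^esub> p \<in> ?J"
        by (simp add: tensor_algebra_uminus tensor_algebra_uminus_closed)
    next
      fix p q assume "p \<in> ?J" "q \<in> ?J"
      then show "p \<oplus>\<^bsub>?T\<^esub> q \<in> ?J"
        using tensor_algebra_add_closed[of p B q] by (simp add: tensor_algebra_add)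
    qed blast
  qed (auto simp: mult)
qed

lemma relation_ideal_augmentation:
  assumes "p \<in> relation_ideal (F :: 'f::field itself) n"
  shows "p [] = 0"
proof -
  let ?T = "free_T F n"
  define J where "J = {p \<in> carrier ?T. p [] = 0}"
  interpret ring ?T by (rule ring_free_T)
  interpret J: ideal J ?T unfolding free_T_def J_def by (rule augmentation_ideal)
  have "relator F n A i j \<in> J" if "A \<subseteq> {1..n}" for A i j
  proof -
    have *: "basis_vec A \<in> J" "basis_vec (A - B) \<in> J" for B
    proof -
      have "basis_vec C [] = (0::'f)" for C by (simp add: basis_vec_def)
      moreover have "basis_vec A \<in> carrier ?T" "basis_vec (A - B) \<in> carrier ?T"
        using that by (blast intro: basis_vec_closed)+
      ultimately show "basis_vec A \<in> J" "basis_vec (A - B) \<in> J"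
        unfolding J_def by blast+
    qed
    have minus: "p \<ominus>\<^bsub>?T\<^esub> q \<in> J" if "p \<in> J" "q \<in> J" for p q
      unfolding a_minus_def using that by (intro J.a_closed J.a_inv_closed)
    have mult: "p \<otimes>\<^bsub>?T\<^esub> q \<in> J" if "p \<in> J" "q \<in> J" for p q
      using that J.Icarr by (intro J.I_l_closed)
    have square: "p [^]\<^bsub>?T\<^esub> (2::nat) \<in> J" if "p \<in> J" for p
      using mult[OF that that] J.Icarr[OF that] by (simp add: numeral_2_eq_2)
    show ?thesis
      unfolding relator_def Let_def by (intro J.a_closed minus mult square *)
  qed
  then have "relation_ideal F n \<subseteq> J"
    unfolding relation_ideal_def
    by (intro genideal_minimal J.ideal_axioms) (auto simp: relators_def)
  with assms have "p \<in> J" by blast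
  then show ?thesis unfolding J_def by blast
qed

lemma ring_hom_to_Q: "ring_hom_ring (free_T F n) (Q_alg F n) (to_Q F n)"
  using ideal.rcos_ring_hom_ring[OF relation_ideal_ideal]
  by (simp add: Q_alg_def to_Q_def[abs_def])

lemma Q_alg_nontrivial: "\<one>\<^bsub>Q_alg F n\<^esub> \<noteq> \<zero>\<^bsub>Q_alg F n\<^esub>"
proof
  interpret I: ideal "relation_ideal F n" "free_T F n" by (rule relation_ideal_ideal)
  assume "\<one>\<^bsub>Q_alg F n\<^esub> = \<zero>\<^bsub>Q_alg F n\<^esub>"
  then have "\<one>\<^bsub>free_T F n\<^esub> \<in> relation_ideal F n"
    by (intro I.rcos_const_imp_mem) (auto simp: Q_alg_def FactRing_def)
  then have "\<one>\<^bsub>free_T F n\<^esub> [] = 0" by (rule relation_ideal_augmentation)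
  then show False by (simp add: free_T_def tensor_algebra_one scalar_def)
qed

lemma subfield_Q_scalars: "subfield (Q_scalars F n) (Q_alg F n)"
  and inj_to_Q_scalars: "inj_on (to_Q F n) (range scalar)"
  unfolding Q_scalars_def
  using ring_hom_ring.img_is_subfield[OF ring_hom_to_Q _ Q_alg_nontrivial] subfield_scalar
  by (metis free_T_def)+

lemma finite_dimension_Q_component:
  "ring.finite_dimension (Q_alg F n) (Q_scalars F n) (Q_component F n i)"
proof -
  interpret h: ring_hom_ring "free_T F n" "Q_alg F n" "to_Q F n" by (rule ring_hom_to_Q)
  have fin: "finite {w. set w \<subseteq> generators n \<and> length w = i}"
    by (rule finite_lists_length_eq) (simp add: generators_def)
  obtain ws where ws: "set ws = {w. set w \<subseteq> generators n \<and> length w = i}"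
    using finite_list[OF fin] by (elim exE)
  let ?us = "map (\<lambda>u w. if w = u then 1 else 0) ws"
  have us: "set ?us \<subseteq> carrier (free_T F n)"
    using ws by (auto simp: free_T_def tensor_algebra_def split: if_splits)
  have "homogeneous (generators n) i = ring.Span (free_T F n) (range scalar) ?us"
    unfolding free_T_def using ws fin
    by (subst Span_words) (auto simp: homogeneous_def tensor_algebra_def intro: rev_finite_subset)
  then have "Q_component F n i = h.S.Span (Q_scalars F n) (map (to_Q F n) ?us)"
    unfolding Q_component_def Q_scalars_def
    by (simp only:) (rule h.Span_hom[OF _ us, symmetric], auto simp: free_T_def scalar_closed)
  moreover have "set (map (to_Q F n) ?us) \<subseteq> carrier (Q_alg F n)"
    using us by auto
  ultimately show ?thesis
    using h.S.Span_finite_dimension[OF subfield_Q_scalars] by metis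
qed

end

theory Submission
  imports Defs "HOL-Library.Function_Algebras"
begin

text \<open>
  Put \<open>x A j = v A - v (A - {j})\<close>. The relations of \<open>Q\<^sub>n\<close> say exactly that
  \<open>x A i * x (A - {i}) j = x A j * x (A - {j}) i\<close>, so they determine a graded left module \<open>M\<^sub>n\<close>,
  which is constructed by induction on \<open>n\<close> with a basis of words and turns out to be free of rank one.

  With \<open>N = n + 1\<close> and \<open>d A = x (A \<union> {N}) N\<close>, the relations involving \<open>N\<close> reduce to
  \<open>d A * y A j = y A j * d (A - {j})\<close>, where \<open>y A j = x A j - d (A - {j})\<close>. Given an action of \<open>Q\<^sub>n\<close>,
  the operator \<open>d A\<close> is thus prescribed on the sum of the images of the \<open>y A j\<close> and free on a
  complement. The prescription is consistent because all syzygies of the \<open>y A j\<close> come from the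
  commutation relations: this regularity holds for the \<open>x A j\<close> on \<open>M\<^sub>n\<close>, and it survives the perturbation
  from \<open>x\<close> to \<open>y\<close>, since \<open>d\<close> raises a filtration (the number of letters containing \<open>N\<close>) that is bounded in
  each degree. Sending the free complement to new words gives
  \<open>M\<^sub>N = M\<^sub>n \<otimes> T(\<Oplus>\<^sub>A M\<^sub>n / \<Sum>\<^sub>j x A j M\<^sub>n)\<close>. By regularity each quotient has Hilbert series
  \<open>(1 - t)^|A| H\<^sub>n\<close>, so \<open>1 / H\<^sub>N = 1 / H\<^sub>n - t (2 - t)^n\<close>, and hence
  \<open>H\<^sub>n (1 - t (2 - t)^n) = 1 - t\<close>.
\<close>

text \<open>A presentation by itself bounds dimensions only from above. The module gives the lower
  bound: the relation ideal acts as zero, while the products attached to basis words send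
  \<open>[]\<close> to distinct words. Freeness, in the form of a universal property for evaluation
  at arbitrary vectors, gives the upper bound. Regularity is what each extension step consumes, so
  it belongs to the induction hypothesis and has to be proved again for the new module. There a
  second perturbation of \<open>x\<close> appears,
  \<open>x (A \<union> {N}) j = x A j + d A - d (A - {j})\<close>. Syzygies involving
  \<open>N\<close>, which comes last in the order, are controlled because the free part of
  \<open>d A\<close> produces words beginning with the letter \<open>A \<union> {N}\<close>, and
  these cannot be leading terms of the other images. Since \<open>y A j\<close> involves
  \<open>d\<close> only at \<open>A - {j}\<close>, the operators \<open>d A\<close> can be built by
  induction on the size of \<open>A\<close>. The factor \<open>(2 - t)^n\<close> is the sum of
  \<open>(1 - t)^|A|\<close> over all subsets \<open>A\<close> of \<open>{1..n}\<close>, that is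
  \<open>(1 + (1 - t))^n\<close>.\<close>

type_synonym 'f word_fun = "nat set list \<Rightarrow> 'f"

text \<open>The cut-off \<open>k\<close> orders the operators \<open>Y A j\<close> by
  \<open>j\<close>, so that regularity can be expressed one operator at a time, as for a regular
  sequence, and used by induction on \<open>k\<close>.\<close>

definition edge_sum ::
  "(nat set \<Rightarrow> nat \<Rightarrow> 'v \<Rightarrow> 'v) \<Rightarrow> nat set \<Rightarrow> nat \<Rightarrow> (nat \<Rightarrow> 'v) \<Rightarrow> 'v::ab_group_add" where
  "edge_sum Y A k m = (\<Sum>j\<in>A \<inter> {..<k}. Y A j (m j))"

lemma edge_sum_0 [simp]: "edge_sum Y A 0 m = 0"
  by (simp add: edge_sum_def)

lemma edge_sum_Suc:
  "edge_sum Y A (Suc k) m = (if k \<in> A then Y A k (m k) + edge_sum Y A k m else edge_sum Y A k m)"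
proof (cases "k \<in> A")
  case True
  have "A \<inter> {..<Suc k} = insert k (A \<inter> {..<k})" using True by (auto simp: less_Suc_eq)
  then show ?thesis using True by (simp add: edge_sum_def)
next
  case False
  then have "A \<inter> {..<Suc k} = A \<inter> {..<k}" by (auto simp: less_Suc_eq)
  then show ?thesis using False by (simp add: edge_sum_def)
qed

lemma edge_sum_cong:
  "(\<And>j. j \<in> A \<Longrightarrow> j < k \<Longrightarrow> Y A j (m j) = Y' A j (m' j)) \<Longrightarrow> edge_sum Y A k m = edge_sum Y' A k m'"
  unfolding edge_sum_def by (rule sum.cong) auto

subsection \<open>Regularity of filtered families of operators\<close>

text \<open>
  \<open>G D p\<close> is the part of degree \<open>D\<close> and filtration at least \<open>p\<close>. The last assumption says that on the
  associated graded space the syzygies of \<open>Y A j, j \<le> k,\<close> have last component in the span of the images of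
  \<open>Y (A - {k}) j\<close> with \<open>j < k\<close>.
\<close>

locale filtered_edges =
  fixes G :: "nat \<Rightarrow> nat \<Rightarrow> 'v::ab_group_add set"
    and Y :: "nat set \<Rightarrow> nat \<Rightarrow> 'v \<Rightarrow> 'v" and U :: "nat set set"
  assumes G_zero [simp, intro]: "0 \<in> G D p"
    and G_diff: "\<And>f g. f \<in> G D p \<Longrightarrow> g \<in> G D p \<Longrightarrow> f - g \<in> G D p"
    and G_Suc: "G D (Suc p) \<subseteq> G D p"
    and G_bound: "G D D \<subseteq> {0}"
    and U_down: "\<And>A j. A \<in> U \<Longrightarrow> j \<in> A \<Longrightarrow> A - {j} \<in> U"
    and Y_diff: "\<And>A j f g D. A \<in> U \<Longrightarrow> j \<in> A \<Longrightarrow> f \<in> G D 0 \<Longrightarrow> g \<in> G D 0 \<Longrightarrow> Y A j (f - g) = Y A j f - Y A j g"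
    and Y_closed: "\<And>A j f D p. A \<in> U \<Longrightarrow> j \<in> A \<Longrightarrow> f \<in> G D p \<Longrightarrow> Y A j f \<in> G (Suc D) p"
    and Y_comm: "\<And>A i j f D. A \<in> U \<Longrightarrow> i \<in> A \<Longrightarrow> j \<in> A \<Longrightarrow> i \<noteq> j \<Longrightarrow> f \<in> G D 0 \<Longrightarrow>
        Y A i (Y (A - {i}) j f) = Y A j (Y (A - {j}) i f)"
    and graded_regular: "\<And>A k D p m. A \<in> U \<Longrightarrow> k \<in> A \<Longrightarrow> (\<And>j. m j \<in> G (Suc D) p) \<Longrightarrow>
        edge_sum Y A (Suc k) m \<in> G (Suc (Suc D)) (Suc p) \<Longrightarrow>
        \<exists>u. (\<forall>j. u j \<in> G D p) \<and> m k - edge_sum Y (A - {k}) k u \<in> G (Suc D) (Suc p)"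
begin

lemma G_uminus: "f \<in> G D p \<Longrightarrow> - f \<in> G D p"
  using G_diff[of 0 D p f] by simp

lemma G_add: "f \<in> G D p \<Longrightarrow> g \<in> G D p \<Longrightarrow> f + g \<in> G D p"
  using G_diff[of f D p "- g"] G_uminus by simp

lemma G_antimono: "p \<le> q \<Longrightarrow> G D q \<subseteq> G D p"
  by (rule lift_Suc_antimono_le[of "\<lambda>p. G D p"]) (use G_Suc in auto)

lemma G_0: "f \<in> G D p \<Longrightarrow> f \<in> G D 0"
  using G_antimono by blast

lemma G_large: "D \<le> p \<Longrightarrow> f \<in> G D p \<Longrightarrow> f = 0"
  using G_antimono G_bound by blast

lemma G_sum: "(\<And>i. i \<in> S \<Longrightarrow> f i \<in> G D p) \<Longrightarrow> (\<Sum>i\<in>S. f i) \<in> G D p"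
  by (induction S rule: infinite_finite_induct) (auto intro: G_add)

lemma Y_zero: "A \<in> U \<Longrightarrow> j \<in> A \<Longrightarrow> Y A j 0 = 0"
  using Y_diff[of A j 0 0 0] by simp

lemma Y_add: "A \<in> U \<Longrightarrow> j \<in> A \<Longrightarrow> f \<in> G D 0 \<Longrightarrow> g \<in> G D 0 \<Longrightarrow> Y A j (f + g) = Y A j f + Y A j g"
  using Y_diff[of A j f D "- g"] Y_diff[of A j 0 D g] G_uminus[of g] by (simp add: Y_zero)

lemma Y_sum: "A \<in> U \<Longrightarrow> j \<in> A \<Longrightarrow> (\<And>i. i \<in> S \<Longrightarrow> f i \<in> G D 0) \<Longrightarrow> Y A j (\<Sum>i\<in>S. f i) = (\<Sum>i\<in>S. Y A j (f i))"
proof (induction S rule: infinite_finite_induct)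
  case (insert x F)
  then show ?case using Y_add[of A j "f x" D "sum f F"] G_sum[of F f D 0] by simp
qed (simp_all add: Y_zero)

lemma edge_sum_closed: "A \<in> U \<Longrightarrow> (\<And>j. m j \<in> G D p) \<Longrightarrow> edge_sum Y A k m \<in> G (Suc D) p"
  unfolding edge_sum_def by (intro G_sum Y_closed) auto

lemma edge_sum_zero: "A \<in> U \<Longrightarrow> edge_sum Y A k (\<lambda>_. 0) = 0"
  unfolding edge_sum_def by (rule sum.neutral) (auto simp: Y_zero)

lemma edge_sum_add:
  "A \<in> U \<Longrightarrow> (\<And>j. m j \<in> G D 0) \<Longrightarrow> (\<And>j. n j \<in> G D 0) \<Longrightarrow>
   edge_sum Y A k (\<lambda>j. m j + n j) = edge_sum Y A k m + edge_sum Y A k n"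
  unfolding edge_sum_def by (simp add: Y_add[of A _ _ D] sum.distrib)

lemma edge_sum_diff:
  "A \<in> U \<Longrightarrow> (\<And>j. m j \<in> G D 0) \<Longrightarrow> (\<And>j. n j \<in> G D 0) \<Longrightarrow>
   edge_sum Y A k (\<lambda>j. m j - n j) = edge_sum Y A k m - edge_sum Y A k n"
  unfolding edge_sum_def by (simp add: Y_diff[of A _ _ D] sum_subtractf)

text \<open>These are the Koszul relations: commutation moves \<open>Y A k\<close> past each
  summand, and \<open>A - {k}\<close> and \<open>A\<close> have the same elements below
  \<open>k\<close>. A combination of the \<open>Y (A - {k}) j\<close> thus yields a syzygy of the
  \<open>Y A j\<close> with \<open>j \<le> k\<close>.\<close>

lemma edge_sum_swap:
  assumes "A \<in> U" "k \<in> A" "\<And>j. u j \<in> G D 0"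
  shows "Y A k (edge_sum Y (A - {k}) k u) = edge_sum Y A k (\<lambda>j. Y (A - {j}) k (u j))"
proof -
  have *: "(A - {k}) \<inter> {..<k} = A \<inter> {..<k}" by auto
  have "Y A k (edge_sum Y (A - {k}) k u) = (\<Sum>j\<in>A \<inter> {..<k}. Y A k (Y (A - {k}) j (u j)))"
    unfolding edge_sum_def * using assms
    by (intro Y_sum[of _ _ _ _ "Suc D"] Y_closed U_down) auto
  also have "\<dots> = edge_sum Y A k (\<lambda>j. Y (A - {j}) k (u j))"
    unfolding edge_sum_def using assms by (intro sum.cong refl Y_comm[of _ _ _ _ D]) auto
  finally show ?thesis .
qed

lemma swap_closed:
  assumes "A \<in> U" "k \<in> A" "u j \<in> G D p" "j \<in> A" "j < k"
  shows "Y (A - {j}) k (u j) \<in> G (Suc D) p"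
  using assms by (intro Y_closed U_down) auto

text \<open>The swapped components make sense only for indices in \<open>A\<close> below
  \<open>k\<close>; extending them by zero gives a total family in one level, ready to be used as
  \<open>m\<close> again.\<close>

lemma edge_sum_swap':
  assumes A: "A \<in> U" "k \<in> A" and u: "\<And>j. u j \<in> G D p"
  shows "\<exists>u'. (\<forall>j. u' j \<in> G (Suc D) p) \<and> (\<forall>j\<in>A. j < k \<longrightarrow> u' j = Y (A - {j}) k (u j)) \<and>
    Y A k (edge_sum Y (A - {k}) k u) = edge_sum Y A k u'"
proof (intro exI conjI allI ballI impI)
  let ?u = "\<lambda>j. if j \<in> A \<and> j < k then Y (A - {j}) k (u j) else 0"
  show "Y A k (edge_sum Y (A - {k}) k u) = edge_sum Y A k ?u"
    unfolding edge_sum_swap[OF A G_0[OF u]] by (rule edge_sum_cong) simp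
  show "?u j \<in> G (Suc D) p" for j using swap_closed[OF A u] by auto
qed auto

text \<open>
  Regularity on the graded space lets one replace a representation whose leading terms cancel by one
  that lies a step deeper in the filtration.
\<close>

lemma strict_step:
  assumes A: "A \<in> U" and m: "\<And>j. m j \<in> G D p" and s: "edge_sum Y A k m \<in> G (Suc D) (Suc p)"
  shows "\<exists>m'. (\<forall>j. m' j \<in> G D (Suc p)) \<and> edge_sum Y A k m' = edge_sum Y A k m"
proof (cases D)
  case 0
  then have "m j = 0" for j using m[of j] G_large[of D p] by simp
  then show ?thesis by (intro exI[of _ m]) simp
next
  case D: (Suc D')
  from m s show ?thesis
  proof (induction k arbitrary: m)
    case 0
    then show ?case by (intro exI[of _ "\<lambda>_. 0"]) simp
  next
    case (Suc k)
    show ?case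
    proof (cases "k \<in> A")
      case False
      then have "edge_sum Y A (Suc k) m' = edge_sum Y A k m'" for m' by (simp add: edge_sum_Suc)
      then show ?thesis using Suc by simp
    next
      case k: True
      from graded_regular[OF A k, of m D' p] Suc.prems D
      obtain u where u: "\<And>j. u j \<in> G D' p" and r: "m k - edge_sum Y (A - {k}) k u \<in> G D (Suc p)"
        by auto
      have u0: "\<And>j. u j \<in> G D' 0" using u G_0 by blast
      obtain u' where u': "\<And>j. u' j \<in> G D p"
        and eq: "Y A k (edge_sum Y (A - {k}) k u) = edge_sum Y A k u'"
        using edge_sum_swap'[of A k u D' p, OF A k u] unfolding D by blast
      \<comment> \<open>The Koszul syzygy of \<open>u\<close> is subtracted: component
        \<open>k\<close> becomes \<open>?r\<close>, which lies one step deeper, and the components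
        below \<open>k\<close> absorb \<open>u'\<close>. The total is unchanged, so the induction
        applies to the components below \<open>k\<close>.\<close>
      let ?n = "\<lambda>j. m j + u' j" and ?r = "m k - edge_sum Y (A - {k}) k u"
      have m0: "\<And>j. m j \<in> G D 0" and u0': "\<And>j. u' j \<in> G D 0" using Suc.prems(1) u' G_0 by blast+
      have e0: "edge_sum Y (A - {k}) k u \<in> G D 0"
        using edge_sum_closed[OF U_down[OF A k], of u D' 0] u0 D by simp
      have tot: "Y A k ?r + edge_sum Y A k ?n = edge_sum Y A (Suc k) m"
        using Y_diff[OF A k m0 e0] edge_sum_add[OF A m0 u0'] eq k by (simp add: edge_sum_Suc)
      have "edge_sum Y A k ?n = edge_sum Y A (Suc k) m - Y A k ?r" using tot by (simp add: algebra_simps)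
      also have "\<dots> \<in> G (Suc D) (Suc p)"
        using Suc.prems(2) Y_closed[OF A k r] by (rule G_diff)
      finally obtain m' where m': "\<And>j. m' j \<in> G D (Suc p)" "edge_sum Y A k m' = edge_sum Y A k ?n"
        using Suc.IH[of ?n] G_add[OF Suc.prems(1) u'] by auto
      have "edge_sum Y A k (m'(k := ?r)) = edge_sum Y A k m'" by (rule edge_sum_cong) simp
      with tot k m'(2) have "edge_sum Y A (Suc k) (m'(k := ?r)) = edge_sum Y A (Suc k) m"
        by (simp add: edge_sum_Suc del: fun_upd_apply) simp
      moreover have "(m'(k := ?r)) j \<in> G D (Suc p)" for j using m'(1) r by simp
      ultimately show ?thesis by blast
    qed
  qed
qed

text \<open>Iterating \<open>strict_step\<close> shows that the sum map is strict: an element of its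
  image that lies deep in the filtration comes from components that are equally deep.\<close>

lemma strict:
  assumes A: "A \<in> U" and m: "\<And>j. m j \<in> G D 0" and s: "edge_sum Y A k m \<in> G (Suc D) p"
  shows "\<exists>m'. (\<forall>j. m' j \<in> G D p) \<and> edge_sum Y A k m' = edge_sum Y A k m"
  using s
proof (induction p)
  case 0 then show ?case using m by blast
next
  case (Suc p)
  then obtain m' where "\<And>j. m' j \<in> G D p" "edge_sum Y A k m' = edge_sum Y A k m"
    using G_Suc by blast
  with strict_step[OF A, of m' D p k] Suc.prems show ?case by auto
qed

text \<open>This lifts the regular-sequence condition from the associated graded space. By
  \<open>strict\<close> the right side can be taken as deep as \<open>f\<close>; graded regularity
  then strips the leading part off \<open>f\<close>, and the corresponding Koszul terms go into
  \<open>m\<close>. The descent ends because the filtration is bounded in each degree.\<close>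

lemma colon:
  assumes A: "A \<in> U" and k: "k \<in> A" and f: "f \<in> G (Suc D) p"
    and m: "\<And>j. m j \<in> G (Suc D) 0" and eq: "Y A k f = edge_sum Y A k m"
  shows "\<exists>u. (\<forall>j. u j \<in> G D 0) \<and> f = edge_sum Y (A - {k}) k u"
  using f m eq
proof (induction "Suc D - p" arbitrary: p f m)
  case 0
  then have "f = 0" using G_large[of "Suc D" p f] by simp
  then show ?case using edge_sum_zero[OF U_down[OF A k]] by (intro exI[of _ "\<lambda>_. 0"]) simp
next
  case (Suc q)
  note f = Suc.prems(1) and m = Suc.prems(2) and eq = Suc.prems(3)
  have "edge_sum Y A k m \<in> G (Suc (Suc D)) p" using Y_closed[OF A k f] eq by simp
  then obtain m' where m': "\<And>j. m' j \<in> G (Suc D) p" "edge_sum Y A k m' = edge_sum Y A k m"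
    using strict[of A m "Suc D" k p, OF A m] by blast
  let ?n = "(\<lambda>j. 0 - m' j)(k := f)"
  have m0': "\<And>j. m' j \<in> G (Suc D) 0" using m'(1) G_0 by blast
  have n: "\<And>j. ?n j \<in> G (Suc D) p" using f m'(1) G_diff[OF G_zero] by (simp add: G_uminus)
  have "edge_sum Y A k ?n = edge_sum Y A k (\<lambda>j. 0 - m' j)" by (rule edge_sum_cong) simp
  also have "\<dots> = - edge_sum Y A k m'"
    using edge_sum_diff[OF A, of "\<lambda>_. 0" "Suc D" m' k] m0' edge_sum_zero[OF A] by simp
  finally have "edge_sum Y A (Suc k) ?n = 0"
    using k eq m'(2) by (simp add: edge_sum_Suc)
  then obtain u where u: "\<And>j. u j \<in> G D p" and r: "f - edge_sum Y (A - {k}) k u \<in> G (Suc D) (Suc p)"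
    using graded_regular[of A k ?n D p, OF A k n] by auto
  have u0: "\<And>j. u j \<in> G D 0" using u G_0 by blast
  obtain u' where u': "\<And>j. u' j \<in> G (Suc D) p"
    and eq': "Y A k (edge_sum Y (A - {k}) k u) = edge_sum Y A k u'"
    using edge_sum_swap'[of A k u D p, OF A k u] by blast
  have u0': "\<And>j. u' j \<in> G (Suc D) 0" using u' G_0 by blast
  have e0: "edge_sum Y (A - {k}) k u \<in> G (Suc D) 0"
    using edge_sum_closed[OF U_down[OF A k]] u0 .
  have "Y A k (f - edge_sum Y (A - {k}) k u) = edge_sum Y A k (\<lambda>j. m j - u' j)"
    using Y_diff[OF A k G_0[OF f] e0] edge_sum_diff[OF A m u0'] eq eq' by simp
  moreover have "q = Suc D - Suc p" using Suc.hyps(2) by simp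
  ultimately obtain v where v: "\<And>j. v j \<in> G D 0" "f - edge_sum Y (A - {k}) k u = edge_sum Y (A - {k}) k v"
    using Suc.hyps(1)[of "Suc p", OF _ r, of "\<lambda>j. m j - u' j"] G_diff[OF m u0'] by auto
  have "f = edge_sum Y (A - {k}) k (\<lambda>j. u j + v j)"
    using edge_sum_add[OF U_down[OF A k] u0 v(1)] v(2) by (simp add: algebra_simps)
  moreover have "u j + v j \<in> G D 0" for j using G_add[OF u0 v(1)] .
  ultimately show ?case by (intro exI[of _ "\<lambda>j. u j + v j"]) simp
qed

lemma regular:
  assumes A: "A \<in> U" and k: "k \<in> A" and m: "\<And>j. m j \<in> G (Suc D) 0" and eq: "edge_sum Y A (Suc k) m = 0"
  shows "\<exists>u. (\<forall>j. u j \<in> G D 0) \<and> m k = edge_sum Y (A - {k}) k u"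
proof (rule colon[OF A k m])
  show "0 - m j \<in> G (Suc D) 0" for j using G_diff[OF G_zero m] .
  show "Y A k (m k) = edge_sum Y A k (\<lambda>j. 0 - m j)"
    using eq k edge_sum_diff[OF A, of "\<lambda>_. 0" "Suc D" m k] m edge_sum_zero[OF A]
    by (simp add: edge_sum_Suc add_eq_0_iff2)
qed

text \<open>This is the consistency of the prescription \<open>Y A j f\<close> to
  \<open>Y A j (E (A - {j}) f)\<close>. By \<open>regular\<close>, a syzygy differs from a Koszul
  syzygy by one with fewer operators, so induction on \<open>k\<close> reduces the claim to Koszul
  syzygies.\<close>

lemma intertwine_syzygy:
  assumes A: "A \<in> U"
    and E_diff: "\<And>j f g D. j \<in> A \<Longrightarrow> f \<in> G D 0 \<Longrightarrow> g \<in> G D 0 \<Longrightarrow> E (A - {j}) (f - g) = E (A - {j}) f - E (A - {j}) g"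
    and E_closed: "\<And>B f D. B \<subseteq> A \<Longrightarrow> B \<noteq> A \<Longrightarrow> f \<in> G D 0 \<Longrightarrow> E B f \<in> G (Suc D) 0"
    and E_Y: "\<And>j k f D. j \<in> A \<Longrightarrow> k \<in> A \<Longrightarrow> k \<noteq> j \<Longrightarrow> f \<in> G D 0 \<Longrightarrow>
        E (A - {j}) (Y (A - {j}) k f) = Y (A - {j}) k (E (A - {j} - {k}) f)"
    and m: "\<And>j. m j \<in> G D 0" and eq: "edge_sum Y A k m = 0"
  shows "edge_sum Y A k (\<lambda>j. E (A - {j}) (m j)) = 0"
proof -
  have E0: "E (A - {j}) 0 = 0" if "j \<in> A" for j using E_diff[OF that, of 0 0 0] by simp
  show ?thesis
  proof (cases D)
    case 0
    then have "m j = 0" for j using m[of j] G_large[of D 0] by simp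
    then show ?thesis unfolding edge_sum_def using E0 by (intro sum.neutral) (auto simp: Y_zero[OF A])
  next
    case D: (Suc D')
    from m eq show ?thesis
    proof (induction k arbitrary: m)
      case (Suc k)
      show ?case
      proof (cases "k \<in> A")
        case False
        then have "edge_sum Y A (Suc k) m' = edge_sum Y A k m'" for m' by (simp add: edge_sum_Suc)
        then show ?thesis using Suc by simp
      next
        case k: True
        obtain u where u: "\<And>j. u j \<in> G D' 0" and mk: "m k = edge_sum Y (A - {k}) k u"
          using regular[of A k m D', OF A k] Suc.prems D by auto
        obtain u' where u': "\<And>j. u' j \<in> G D 0"
          and ueq: "\<And>j. j \<in> A \<Longrightarrow> j < k \<Longrightarrow> u' j = Y (A - {j}) k (u j)"
          and eq: "Y A k (edge_sum Y (A - {k}) k u) = edge_sum Y A k u'"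
          using edge_sum_swap'[of A k u D' 0, OF A k u] unfolding D by blast
        \<comment> \<open>Removing the Koszul syzygy of \<open>u\<close> leaves a syzygy of the
          operators below \<open>k\<close>. The sum \<open>m j + u' j\<close> is written with
          differences, the form to which \<open>G_diff\<close> and \<open>E_diff\<close>
          apply.\<close>
        have n: "edge_sum Y A k (\<lambda>j. m j - (0 - u' j)) = 0"
          using Suc.prems(2) k eq edge_sum_add[OF A Suc.prems(1) u'] by (simp add: edge_sum_Suc mk add.commute)
        have "edge_sum Y A k (\<lambda>j. E (A - {j}) (m j - (0 - u' j))) = 0"
          by (rule Suc.IH[OF _ n]) (intro G_diff Suc.prems(1) u' G_zero)
        also have "edge_sum Y A k (\<lambda>j. E (A - {j}) (m j - (0 - u' j)))
          = edge_sum Y A k (\<lambda>j. E (A - {j}) (m j)) + edge_sum Y A k (\<lambda>j. E (A - {j}) (u' j))"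
        proof -
          have "E (A - {j}) (m j - (0 - u' j)) = E (A - {j}) (m j) + E (A - {j}) (u' j)" if "j \<in> A" for j
            using E_diff[OF that Suc.prems(1)[of j] G_diff[OF G_zero u'[of j]]]
              E_diff[OF that G_zero u'[of j]] E0[OF that] by simp
          moreover have "E (A - {j}) (m j) \<in> G (Suc D) 0" "E (A - {j}) (u' j) \<in> G (Suc D) 0" if "j \<in> A" for j
            using that Suc.prems(1) u' by (auto intro!: E_closed)
          ultimately show ?thesis unfolding edge_sum_def sum.distrib[symmetric]
            by (intro sum.cong refl) (auto simp: Y_add[OF A, of _ _ "Suc D"])
        qed
        \<comment> \<open>On the Koszul syzygy itself the claim is a computation: \<open>E\<close>
          passes through \<open>Y\<close> on either side by \<open>E_Y\<close>, and the indices
          \<open>j\<close> and \<open>k\<close> are exchanged by commutation.\<close>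
        also have "edge_sum Y A k (\<lambda>j. E (A - {j}) (u' j)) = Y A k (E (A - {k}) (m k))"
        proof -
          define v where "v = (\<lambda>j. if j \<in> A \<and> j < k then E (A - {k} - {j}) (u j) else 0)"
          have v: "\<And>j. v j \<in> G D 0"
            using D k by (auto simp: v_def intro!: E_closed u)
          have sets: "(A - {k}) \<inter> {..<k} = A \<inter> {..<k}" by auto
          have Es: "E (A - {k}) (\<Sum>i\<in>S. f i) = (\<Sum>i\<in>S. E (A - {k}) (f i))"
            if "\<And>i. i \<in> S \<Longrightarrow> f i \<in> G D 0" for S :: "nat set" and f
            using that
          proof (induction S rule: infinite_finite_induct)
            case (insert x F)
            then have "f x \<in> G D 0" and F: "sum f F \<in> G D 0" by (auto intro: G_sum)
            then show ?case
              using insert E_diff[OF k, of "f x" D "0 - sum f F"] E_diff[OF k, of 0 D "sum f F"] G_uminus[OF F] E0[OF k]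
              by simp
          qed (simp_all add: E0[OF k])
          have "E (A - {k}) (m k) = (\<Sum>j\<in>A \<inter> {..<k}. E (A - {k}) (Y (A - {k}) j (u j)))"
            unfolding mk edge_sum_def sets using u D
            by (intro Es) (auto intro!: Y_closed U_down A k)
          also have "\<dots> = edge_sum Y (A - {k}) k v"
            unfolding edge_sum_def sets using u by (intro sum.cong) (auto simp: v_def E_Y[OF k, of _ _ D'])
          finally have "Y A k (E (A - {k}) (m k)) = edge_sum Y A k (\<lambda>j. Y (A - {j}) k (v j))"
            using edge_sum_swap[OF A k v] by simp
          also have "\<dots> = edge_sum Y A k (\<lambda>j. E (A - {j}) (u' j))"
          proof (rule edge_sum_cong)
            fix j assume j: "j \<in> A" "j < k"
            have "E (A - {j}) (u' j) = Y (A - {j}) k (E (A - {j} - {k}) (u j))"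
              using j k u by (simp add: ueq E_Y[of _ _ _ D'])
            moreover have "A - {j} - {k} = A - {k} - {j}" by auto
            ultimately show "Y A j (Y (A - {j}) k (v j)) = Y A j (E (A - {j}) (u' j))"
              using j by (simp add: v_def)
          qed
          finally show ?thesis by simp
        qed
        finally show ?thesis using k by (simp add: edge_sum_Suc add.commute)
      qed
    qed simp
  qed
qed

end

section \<open>Extending an intertwining operator from the images to a complement\<close>

text \<open>
  \<open>E B\<close> for \<open>B \<subset> A\<close> are operators already constructed. An operator for \<open>A\<close> is sought that intertwines
  \<open>Y A j\<close> with \<open>E (A - {j})\<close> and equals \<open>S\<close> on the complement \<open>C\<close> of the images of the \<open>Y A j\<close>.
\<close>

locale filtered_complement = filtered_edges G Y U
  for G :: "nat \<Rightarrow> nat \<Rightarrow> 'v::ab_group_add set" and Y U +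
  fixes K :: nat and scl :: "'s \<Rightarrow> 'v \<Rightarrow> 'v" and A :: "nat set" and C :: "nat \<Rightarrow> 'v set"
    and S :: "'v \<Rightarrow> 'v" and E :: "nat set \<Rightarrow> 'v \<Rightarrow> 'v"
  assumes A: "A \<in> U"
    and level_unique: "\<And>f D D'. f \<in> G D 0 \<Longrightarrow> f \<in> G D' 0 \<Longrightarrow> f \<noteq> 0 \<Longrightarrow> D = D'"
    and scl_add: "\<And>a f g. scl a (f + g) = scl a f + scl a g"
    and scl_G: "\<And>a f D p. f \<in> G D p \<Longrightarrow> scl a f \<in> G D p"
    and scl_Y: "\<And>j a f D. j \<in> A \<Longrightarrow> f \<in> G D 0 \<Longrightarrow> Y A j (scl a f) = scl a (Y A j f)"
    and C_zero: "0 \<in> C D"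
    and C_diff: "\<And>f g D. f \<in> C D \<Longrightarrow> g \<in> C D \<Longrightarrow> f - g \<in> C D"
    and C_G: "C D \<subseteq> G D 0"
    and scl_C: "\<And>a f D. f \<in> C D \<Longrightarrow> scl a f \<in> C D"
    and graded_span: "\<And>f D p. f \<in> G (Suc D) p \<Longrightarrow> \<exists>m c. (\<forall>j. m j \<in> G D p) \<and> c \<in> C (Suc D) \<and>
        c \<in> G (Suc D) p \<and> f - (edge_sum Y A K m + c) \<in> G (Suc D) (Suc p)"
    and graded_direct: "\<And>m c D p. (\<And>j. m j \<in> G D p) \<Longrightarrow> c \<in> C (Suc D) \<Longrightarrow> c \<in> G (Suc D) p \<Longrightarrow>
        edge_sum Y A K m + c \<in> G (Suc D) (Suc p) \<Longrightarrow> c \<in> G (Suc D) (Suc p)"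
    and S_diff: "\<And>f g. S (f - g) = S f - S g"
    and S_scl: "\<And>a f. S (scl a f) = scl a (S f)"
    and S_closed: "\<And>f D p. f \<in> C D \<Longrightarrow> f \<in> G D p \<Longrightarrow> S f \<in> G (Suc D) (Suc p)"
    and E_diff: "\<And>j f g D. j \<in> A \<Longrightarrow> f \<in> G D 0 \<Longrightarrow> g \<in> G D 0 \<Longrightarrow> E (A - {j}) (f - g) = E (A - {j}) f - E (A - {j}) g"
    and E_scl: "\<And>j a f D. j \<in> A \<Longrightarrow> f \<in> G D 0 \<Longrightarrow> E (A - {j}) (scl a f) = scl a (E (A - {j}) f)"
    and E_closed: "\<And>B f D p. B \<subseteq> A \<Longrightarrow> B \<noteq> A \<Longrightarrow> f \<in> G D p \<Longrightarrow> E B f \<in> G (Suc D) (Suc p)"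
    and E_Y: "\<And>j k f D. j \<in> A \<Longrightarrow> k \<in> A \<Longrightarrow> k \<noteq> j \<Longrightarrow> f \<in> G D 0 \<Longrightarrow>
        E (A - {j}) (Y (A - {j}) k f) = Y (A - {j}) k (E (A - {j} - {k}) f)"
    and K: "A \<subseteq> {..<K}"
begin

lemma C_add: "f \<in> C D \<Longrightarrow> g \<in> C D \<Longrightarrow> f + g \<in> C D"
  using C_diff[of f D "0 - g"] C_diff[of 0 D g] C_zero by simp

text \<open>Successive approximation: the error left by the graded decomposition lies one step
  deeper, and in degree \<open>Suc D\<close> it vanishes from depth \<open>Suc D\<close> on.\<close>

lemma span:
  assumes "f \<in> G (Suc D) p"
  shows "\<exists>m c. (\<forall>j. m j \<in> G D p) \<and> c \<in> C (Suc D) \<and> c \<in> G (Suc D) p \<and> f = edge_sum Y A K m + c"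
  using assms
proof (induction "Suc D - p" arbitrary: f p)
  case 0
  then have "f = 0" using G_large[of "Suc D" p f] by simp
  then show ?case using edge_sum_zero[OF A] C_zero by (intro exI[of _ "\<lambda>_. 0"] exI[of _ 0]) simp
next
  case (Suc q)
  obtain m c where m: "\<And>j. m j \<in> G D p" and c: "c \<in> C (Suc D)" "c \<in> G (Suc D) p"
    and r: "f - (edge_sum Y A K m + c) \<in> G (Suc D) (Suc p)"
    using graded_span[OF Suc.prems] by blast
  have "q = Suc D - Suc p" using Suc.hyps(2) by simp
  then obtain m' c' where m': "\<And>j. m' j \<in> G D (Suc p)" and c': "c' \<in> C (Suc D)" "c' \<in> G (Suc D) (Suc p)"
    and eq: "f - (edge_sum Y A K m + c) = edge_sum Y A K m' + c'"
    using Suc.hyps(1)[OF _ r] by blast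
  have 0: "m j \<in> G D 0" "m' j \<in> G D 0" "m' j \<in> G D p" for j
    using G_0[OF m] G_0[OF m'] m' G_Suc[of D p] by auto
  have "f = edge_sum Y A K (\<lambda>j. m j + m' j) + (c + c')"
    using eq edge_sum_add[OF A 0(1,2)] by (simp add: algebra_simps)
  moreover have "m j + m' j \<in> G D p" for j using G_add[OF m 0(3)] .
  moreover have "c + c' \<in> C (Suc D)" "c + c' \<in> G (Suc D) p"
    using c c' C_add G_add G_Suc by blast+
  ultimately show ?case by (intro exI[of _ "\<lambda>j. m j + m' j"] exI[of _ "c + c'"]) simp
qed

text \<open>If \<open>c\<close> has depth \<open>p\<close>, so has the sum, and
  \<open>strict\<close> replaces \<open>m\<close> by components of depth \<open>p\<close>; then
  directness on the graded space pushes \<open>c\<close> one step further.\<close>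

lemma direct_filtered:
  assumes m: "\<And>j. m j \<in> G D 0" and c: "c \<in> C (Suc D)" and eq: "edge_sum Y A K m + c = 0"
  shows "c \<in> G (Suc D) p"
proof (induction p)
  case 0
  then show ?case using c C_G by blast
next
  case (Suc p)
  have "edge_sum Y A K m = 0 - c" using eq by (simp add: add_eq_0_iff2)
  then have "edge_sum Y A K m \<in> G (Suc D) p" using G_diff[OF G_zero Suc] by simp
  then obtain m' where m': "\<And>j. m' j \<in> G D p" "edge_sum Y A K m' = edge_sum Y A K m"
    using strict[of A m D K p, OF A m] by blast
  show ?case by (rule graded_direct[of m' D p c, OF m'(1) c Suc]) (simp add: m'(2) eq)
qed

lemma direct:
  assumes "\<And>j. m j \<in> G D 0" "c \<in> C (Suc D)" "edge_sum Y A K m + c = 0"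
  shows "c = 0"
  using direct_filtered[OF assms, of "Suc D"] G_bound by blast

text \<open>The operator sought is first a relation, because \<open>m\<close> is determined by
  \<open>f\<close> only up to syzygies. The index \<open>D\<close> is the degree of the components;
  \<open>f\<close> has degree \<open>Suc D\<close>.\<close>

definition graph :: "nat \<Rightarrow> 'v \<Rightarrow> 'v \<Rightarrow> bool" where
  "graph D f h \<longleftrightarrow> (\<exists>m c. (\<forall>j. m j \<in> G D 0) \<and> c \<in> C (Suc D) \<and> f = edge_sum Y A K m + c \<and>
     h = edge_sum Y A K (\<lambda>j. E (A - {j}) (m j)) + S c)"

lemma graphI: "(\<And>j. m j \<in> G D 0) \<Longrightarrow> c \<in> C (Suc D) \<Longrightarrow>
   graph D (edge_sum Y A K m + c) (edge_sum Y A K (\<lambda>j. E (A - {j}) (m j)) + S c)"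
  unfolding graph_def by blast

lemma E_closed0: "j \<in> A \<Longrightarrow> f \<in> G D p \<Longrightarrow> E (A - {j}) f \<in> G (Suc D) 0"
  using E_closed[of "A - {j}" f D p] G_0 by blast

lemma E0: "j \<in> A \<Longrightarrow> E (A - {j}) 0 = 0"
  using E_diff[of j 0 0 0] by simp

lemma S0: "S 0 = 0"
  using S_diff[of 0 0] by simp

lemma scl0: "scl a 0 = 0"
  using scl_add[of a 0 0] by simp

text \<open>By linearity this gives single-valuedness: directness removes \<open>c\<close>, and what
  remains is a syzygy, on which \<open>intertwine_syzygy\<close> yields zero.\<close>

lemma graph_zero: "graph D 0 h \<Longrightarrow> h = 0"
  unfolding graph_def
proof (elim exE conjE)
  fix m c assume m: "\<forall>j. m j \<in> G D 0" and c: "c \<in> C (Suc D)" and eq: "0 = edge_sum Y A K m + c"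
    and h: "h = edge_sum Y A K (\<lambda>j. E (A - {j}) (m j)) + S c"
  have "c = 0" using direct[of m D c] m c eq by simp
  moreover have "edge_sum Y A K (\<lambda>j. E (A - {j}) (m j)) = 0"
  proof (rule intertwine_syzygy[where E = E and D = D and m = m, OF A])
    show "m j \<in> G D 0" for j using m by blast
    show "edge_sum Y A K m = 0" using eq \<open>c = 0\<close> by simp
    show "E B f \<in> G (Suc D) 0" if "B \<subseteq> A" "B \<noteq> A" "f \<in> G D 0" for B f D
      using E_closed[OF that] G_0 by blast
  qed (use E_Y E_diff in auto)
  ultimately show "h = 0" using h S0 by simp
qed

lemma graph_diff:
  assumes "graph D f h" "graph D f' h'"
  shows "graph D (f - f') (h - h')"
proof -
  obtain m c where m: "\<And>j. m j \<in> G D 0" and c: "c \<in> C (Suc D)" and f: "f = edge_sum Y A K m + c"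
    and h: "h = edge_sum Y A K (\<lambda>j. E (A - {j}) (m j)) + S c"
    using assms(1) unfolding graph_def by blast
  obtain m' c' where m': "\<And>j. m' j \<in> G D 0" and c': "c' \<in> C (Suc D)" and f': "f' = edge_sum Y A K m' + c'"
    and h': "h' = edge_sum Y A K (\<lambda>j. E (A - {j}) (m' j)) + S c'"
    using assms(2) unfolding graph_def by blast
  have "edge_sum Y A K (\<lambda>j. E (A - {j}) (m j - m' j))
      = edge_sum Y A K (\<lambda>j. E (A - {j}) (m j)) - edge_sum Y A K (\<lambda>j. E (A - {j}) (m' j))"
    unfolding edge_sum_def sum_subtractf[symmetric] using m m'
    by (intro sum.cong refl)
      (auto simp: E_diff[of _ _ D] Y_diff[OF A, of _ _ "Suc D"] E_closed0[of _ _ D 0])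
  moreover have "m j - m' j \<in> G D 0" for j using G_diff[OF m m'] .
  moreover have "edge_sum Y A K (\<lambda>j. m j - m' j) = edge_sum Y A K m - edge_sum Y A K m'"
    by (rule edge_sum_diff[OF A m m'])
  ultimately have "graph D ((edge_sum Y A K m - edge_sum Y A K m') + (c - c'))
    ((edge_sum Y A K (\<lambda>j. E (A - {j}) (m j)) - edge_sum Y A K (\<lambda>j. E (A - {j}) (m' j))) + (S c - S c'))"
    using graphI[of "\<lambda>j. m j - m' j" D "c - c'"] C_diff[OF c c'] by (simp add: S_diff)
  then show ?thesis unfolding f f' h h' by (simp only: add_diff_add)
qed

lemma graph_scl:
  assumes "graph D f h"
  shows "graph D (scl a f) (scl a h)"
proof -
  obtain m c where m: "\<And>j. m j \<in> G D 0" and c: "c \<in> C (Suc D)" and f: "f = edge_sum Y A K m + c"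
    and h: "h = edge_sum Y A K (\<lambda>j. E (A - {j}) (m j)) + S c"
    using assms unfolding graph_def by blast
  have sum: "scl a (sum g J) = (\<Sum>j\<in>J. scl a (g j))" for g and J :: "nat set"
    by (induction J rule: infinite_finite_induct) (auto simp: scl0 scl_add)
  have "edge_sum Y A K (\<lambda>j. E (A - {j}) (scl a (m j))) = scl a (edge_sum Y A K (\<lambda>j. E (A - {j}) (m j)))"
    "edge_sum Y A K (\<lambda>j. scl a (m j)) = scl a (edge_sum Y A K m)"
    unfolding edge_sum_def sum using m
    by (auto intro!: sum.cong simp: E_scl[of _ _ D] scl_Y[of _ _ "Suc D"] scl_Y[of _ _ D] E_closed0[of _ _ D 0])
  then show ?thesis
    using graphI[of "\<lambda>j. scl a (m j)" D "scl a c"] scl_C[OF c] scl_G[OF m]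
    by (simp add: f h S_scl scl_add)
qed

lemma graph_level:
  assumes "graph D f h"
  shows "f \<in> G (Suc D) 0"
proof -
  obtain m c where m: "\<And>j. m j \<in> G D 0" and c: "c \<in> C (Suc D)" and f: "f = edge_sum Y A K m + c"
    using assms unfolding graph_def by blast
  show ?thesis unfolding f by (rule G_add[OF edge_sum_closed[OF A m]]) (use c C_G in blast)
qed

lemma graph_unique:
  assumes h: "graph D f h" and h': "graph D' f h'"
  shows "h = h'"
proof (cases "f = 0")
  case True
  then show ?thesis using h h' graph_zero by blast
next
  case False
  then have "D = D'" using level_unique[OF graph_level[OF h] graph_level[OF h']] by simp
  then show ?thesis using graph_diff[OF h, of f h'] h' graph_zero[of D "h - h'"] by simp
qed

lemma graph_exists:
  assumes "f \<in> G (Suc D) p"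
  shows "\<exists>h\<in>G (Suc (Suc D)) (Suc p). graph D f h"
proof -
  obtain m c where m: "\<And>j. m j \<in> G D p" and c: "c \<in> C (Suc D)" "c \<in> G (Suc D) p"
    and f: "f = edge_sum Y A K m + c"
    using span[OF assms] by blast
  have "edge_sum Y A K (\<lambda>j. E (A - {j}) (m j)) \<in> G (Suc (Suc D)) (Suc p)"
    unfolding edge_sum_def using m by (intro G_sum Y_closed A E_closed) auto
  then have "edge_sum Y A K (\<lambda>j. E (A - {j}) (m j)) + S c \<in> G (Suc (Suc D)) (Suc p)"
    using S_closed[OF c] by (rule G_add)
  moreover have "m j \<in> G D 0" for j using G_0[OF m] .
  ultimately show ?thesis using graphI[of m D c] c f by blast
qed

lemma extension_exists:
  "\<exists>g. (\<forall>D f f'. f \<in> G D 0 \<longrightarrow> f' \<in> G D 0 \<longrightarrow> g (f - f') = g f - g f') \<and>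
       (\<forall>D a f. f \<in> G D 0 \<longrightarrow> g (scl a f) = scl a (g f)) \<and>
       (\<forall>D p f. f \<in> G D p \<longrightarrow> g f \<in> G (Suc D) (Suc p)) \<and>
       (\<forall>D j f. j \<in> A \<longrightarrow> f \<in> G D 0 \<longrightarrow> g (Y A j f) = Y A j (E (A - {j}) f)) \<and>
       (\<forall>D f. f \<in> C (Suc D) \<longrightarrow> g f = S f)"
proof -
  \<comment> \<open>A nonzero \<open>f\<close> has a single degree, so one function can serve all
    degrees at once; 0 lies in every level and is treated separately.\<close>
  define g where "g f = (if f = 0 then 0 else THE h. \<exists>D. graph D f h)" for f
  have g: "g f = h" if "graph D f h" for D f h
  proof (cases "f = 0")
    case True
    then show ?thesis using that graph_zero g_def by auto
  next
    case False
    then have "g f = (THE h. \<exists>D. graph D f h)" by (simp add: g_def)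
    also have "\<dots> = h" using that graph_unique by blast
    finally show ?thesis .
  qed
  have g_graph: "graph D f (g f)" if f: "f \<in> G (Suc D) 0" for D f
    using graph_exists[OF f] g by blast
  have g0: "g 0 = 0" by (simp add: g_def)
  have level0: "f = 0" if "f \<in> G 0 p" for f p using that G_large[of 0 p f] by simp
  show ?thesis
  proof (intro exI[of _ g] conjI allI impI)
    fix D f f' assume "f \<in> G D 0" "f' \<in> G D 0"
    then show "g (f - f') = g f - g f'"
      by (cases D) (auto dest!: level0 simp: g0 intro!: g graph_diff g_graph)
  next
    fix D a f assume "f \<in> G D 0"
    then show "g (scl a f) = scl a (g f)"
      by (cases D) (auto dest!: level0 simp: g0 scl0 intro!: g graph_scl g_graph)
  next
    fix D p f assume f: "f \<in> G D p"
    show "g f \<in> G (Suc D) (Suc p)"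
    proof (cases D)
      case 0
      then have "f = 0" using f level0 by blast
      then show ?thesis using g0 by simp
    next
      case (Suc D')
      then show ?thesis using graph_exists[of f D' p] f g by auto
    qed
  next
    fix D j f assume j: "j \<in> A" and f: "f \<in> G D 0"
    \<comment> \<open>To evaluate \<open>g\<close> on the image of one operator, the decomposition
      concentrated in slot \<open>j\<close> is used, with complement part 0.\<close>
    let ?m = "\<lambda>i. if i = j then f else 0"
    have fin: "finite (A \<inter> {..<K})" by simp
    have jK: "j \<in> A \<inter> {..<K}" using j K by auto
    have "edge_sum Y A K ?m = (\<Sum>i\<in>A \<inter> {..<K}. if j = i then Y A j f else 0)"
      unfolding edge_sum_def by (intro sum.cong refl) (auto simp: Y_zero[OF A])
    then have 1: "edge_sum Y A K ?m = Y A j f" using jK by (simp only: sum.delta'[OF fin] if_True)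
    have "edge_sum Y A K (\<lambda>i. E (A - {i}) (?m i)) = (\<Sum>i\<in>A \<inter> {..<K}. if j = i then Y A j (E (A - {j}) f) else 0)"
      unfolding edge_sum_def by (intro sum.cong refl) (auto simp: Y_zero[OF A] E0)
    then have 2: "edge_sum Y A K (\<lambda>i. E (A - {i}) (?m i)) = Y A j (E (A - {j}) f)"
      using jK by (simp only: sum.delta'[OF fin] if_True)
    have "graph D (Y A j f) (Y A j (E (A - {j}) f))"
      using graphI[of ?m D 0] f C_zero by (simp only: 1 2 S0) simp
    then show "g (Y A j f) = Y A j (E (A - {j}) f)" by (rule g)
  next
    fix D f assume "f \<in> C (Suc D)"
    moreover have "edge_sum Y A K (\<lambda>j. E (A - {j}) 0) = 0"
      unfolding edge_sum_def by (rule sum.neutral) (auto simp: E0 Y_zero[OF A])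
    ultimately have "graph D f (S f)"
      using graphI[of "\<lambda>_. 0" D f] edge_sum_zero[OF A] by simp
    then show "g f = S f" by (rule g)
  qed
qed

end

subsection \<open>Modules with a basis of words\<close>

text \<open>
  Degrees are shifted by one: words of length \<open>D\<close> live in \<open>level B (Suc D)\<close> and \<open>level B 0 = {0}\<close>, which
  avoids a case distinction in statements relating consecutive degrees.
\<close>

definition level :: "'x list set \<Rightarrow> nat \<Rightarrow> ('x list \<Rightarrow> 'f::field) set" where
  "level B D = {f. \<forall>w. f w \<noteq> 0 \<longrightarrow> w \<in> B \<and> Suc (length w) = D}"

definition smul :: "'f::field \<Rightarrow> ('x \<Rightarrow> 'f) \<Rightarrow> 'x \<Rightarrow> 'f" where
  "smul a f = (\<lambda>w. a * f w)"

definition unit_vec :: "'x \<Rightarrow> 'x \<Rightarrow> 'f::field" where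
  "unit_vec w = (\<lambda>v. if v = w then 1 else 0)"

definition edge :: "(nat set \<Rightarrow> 'v \<Rightarrow> 'v) \<Rightarrow> nat set \<Rightarrow> nat \<Rightarrow> 'v \<Rightarrow> 'v::ab_group_add" where
  "edge V A j f = V A f - V (A - {j}) f"

lemma sum_fun_apply: "(\<Sum>i\<in>S. f i) w = (\<Sum>i\<in>S. f i w)"
  for f :: "'i \<Rightarrow> 'x \<Rightarrow> 'f::comm_monoid_add"
  by (induction S rule: infinite_finite_induct) auto

lemma level_zero [simp]: "0 \<in> level B D"
  by (simp add: level_def)

lemma level_diff: "f \<in> level B D \<Longrightarrow> g \<in> level B D \<Longrightarrow> f - g \<in> level B D"
  by (auto simp: level_def) (metis diff_self)+

lemma level_add: "f \<in> level B D \<Longrightarrow> g \<in> level B D \<Longrightarrow> f + g \<in> level B D"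
  by (auto simp: level_def) (metis add_0)+

lemma level_smul: "f \<in> level B D \<Longrightarrow> smul a f \<in> level B D"
  by (auto simp: level_def smul_def)

lemma level_0: "f \<in> level B 0 \<Longrightarrow> f = 0"
  by (auto simp: level_def)

lemma level_sum: "(\<And>i. i \<in> S \<Longrightarrow> f i \<in> level B D) \<Longrightarrow> (\<Sum>i\<in>S. f i) \<in> level B D"
  by (induction S rule: infinite_finite_induct) (auto intro: level_add)

lemma level_mono: "B \<subseteq> B' \<Longrightarrow> level B D \<subseteq> level B' D"
  by (auto simp: level_def)

lemma level_unique: "f \<in> level B D \<Longrightarrow> f \<in> level B D' \<Longrightarrow> f \<noteq> 0 \<Longrightarrow> D = D'"
  by (force simp: level_def)

lemma smul_apply: "smul a f w = a * f w"
  by (simp add: smul_def)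

lemma smul_add: "smul a (f + g) = smul a f + smul a g"
  by (auto simp: smul_def algebra_simps)

lemma smul_diff: "smul a (f - g) = smul a f - smul a g"
  by (auto simp: smul_def algebra_simps)

text \<open>
  A letter \<open>Z\<close> of a basis word stands for \<open>v Z - v (Z - {Max Z})\<close>.
\<close>

locale Q_model =
  fixes n :: nat and B :: "nat set list set"
    and V :: "nat set \<Rightarrow> (nat set list \<Rightarrow> 'f::field) \<Rightarrow> 'f word_fun"
  assumes B_words: "\<And>w. w \<in> B \<Longrightarrow> set w \<subseteq> generators n"
    and Nil_B: "[] \<in> B"
    and V_diff: "\<And>A D f g. A \<subseteq> {1..n} \<Longrightarrow> f \<in> level B D \<Longrightarrow> g \<in> level B D \<Longrightarrow> V A (f - g) = V A f - V A g"
    and V_smul: "\<And>A D a f. A \<subseteq> {1..n} \<Longrightarrow> f \<in> level B D \<Longrightarrow> V A (smul a f) = smul a (V A f)"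
    and V_closed: "\<And>A D f. A \<subseteq> {1..n} \<Longrightarrow> f \<in> level B D \<Longrightarrow> V A f \<in> level B (Suc D)"
    and V_empty: "\<And>f. V {} f = 0"
    and V_comm: "\<And>A i j D f. A \<subseteq> {1..n} \<Longrightarrow> i \<in> A \<Longrightarrow> j \<in> A \<Longrightarrow> i \<noteq> j \<Longrightarrow> f \<in> level B D \<Longrightarrow>
        edge V A i (edge V (A - {i}) j f) = edge V A j (edge V (A - {j}) i f)"
    and V_regular: "\<And>A k D m. A \<subseteq> {1..n} \<Longrightarrow> k \<in> A \<Longrightarrow> (\<And>j. m j \<in> level B (Suc D)) \<Longrightarrow>
        edge_sum (edge V) A (Suc k) m = 0 \<Longrightarrow>
        \<exists>u. (\<forall>j. u j \<in> level B D) \<and> m k = edge_sum (edge V) (A - {k}) k u"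
    and V_word: "\<And>Z w. Z # w \<in> B \<Longrightarrow> w \<in> B \<and> edge V Z (Max Z) (unit_vec w) = unit_vec (Z # w)"
begin

lemma edge_diff:
  "A \<subseteq> {1..n} \<Longrightarrow> f \<in> level B D \<Longrightarrow> g \<in> level B D \<Longrightarrow> edge V A j (f - g) = edge V A j f - edge V A j g"
proof -
  assume A: "A \<subseteq> {1..n}" and f: "f \<in> level B D" and g: "g \<in> level B D"
  then have "A - {j} \<subseteq> {1..n}" by auto
  then show "edge V A j (f - g) = edge V A j f - edge V A j g"
    using V_diff[OF A f g] V_diff[of "A - {j}" f D g] f g by (simp add: edge_def)
qed

lemma edge_smul:
  "A \<subseteq> {1..n} \<Longrightarrow> f \<in> level B D \<Longrightarrow> edge V A j (smul a f) = smul a (edge V A j f)"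
proof -
  assume A: "A \<subseteq> {1..n}" and f: "f \<in> level B D"
  then have "A - {j} \<subseteq> {1..n}" by auto
  then show "edge V A j (smul a f) = smul a (edge V A j f)"
    using V_smul[OF A f] V_smul[of "A - {j}" f D a] f by (simp add: edge_def smul_diff)
qed

lemma edge_zero: "A \<subseteq> {1..n} \<Longrightarrow> edge V A j 0 = 0"
  using edge_diff[of A 0 0 0 j] by simp

lemma edge_closed: "A \<subseteq> {1..n} \<Longrightarrow> f \<in> level B D \<Longrightarrow> edge V A j f \<in> level B (Suc D)"
  unfolding edge_def by (intro level_diff V_closed) auto

end

section \<open>The word basis of the new module and its filtration\<close>

locale Q_extension = Q_model n B V
  for n B and V :: "nat set \<Rightarrow> (nat set list \<Rightarrow> 'f::field) \<Rightarrow> 'f word_fun" +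
  fixes C :: "nat set \<Rightarrow> nat set list set"
  assumes C_B: "\<And>A. C A \<subseteq> B"
    and C_span: "\<And>A D f. A \<subseteq> {1..n} \<Longrightarrow> f \<in> level B (Suc D) \<Longrightarrow>
        \<exists>m c. (\<forall>j. m j \<in> level B D) \<and> c \<in> level (C A) (Suc D) \<and> f = edge_sum (edge V) A (Suc n) m + c"
    and C_direct: "\<And>A D m c. A \<subseteq> {1..n} \<Longrightarrow> (\<And>j. m j \<in> level B D) \<Longrightarrow> c \<in> level (C A) (Suc D) \<Longrightarrow>
        edge_sum (edge V) A (Suc n) m + c = 0 \<Longrightarrow> c = 0"
begin

abbreviation N :: nat where "N \<equiv> Suc n"

text \<open>The words in \<open>C A\<close> represent a basis of the quotient by the images of the
  \<open>x A j\<close>. A block \<open>insert N A # c\<close> with \<open>c\<close> in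
  \<open>C A\<close> is the new vector that serves as the free value of \<open>d A\<close> at
  \<open>c\<close>; strings of blocks form a basis of the tensor algebra on these vectors. Words as
  representatives keep the whole basis made of words.\<close>

inductive_set tails :: "nat set list set" where
  tails_Nil: "[] \<in> tails"
| tails_Cons: "A \<subseteq> {1..n} \<Longrightarrow> c \<in> C A \<Longrightarrow> t \<in> tails \<Longrightarrow> insert N A # c @ t \<in> tails"

definition pre :: "nat set list \<Rightarrow> nat set list" where "pre w = takeWhile (\<lambda>Z. N \<notin> Z) w"
definition suf :: "nat set list \<Rightarrow> nat set list" where "suf w = dropWhile (\<lambda>Z. N \<notin> Z) w"

text \<open>A basis of the tensor product of the old module with the tensor algebra. The
  factorization is unique and recovered by \<open>pre\<close> and \<open>suf\<close>: letters of
  words in \<open>B\<close> avoid \<open>N\<close>, while a nonempty tail starts with a letter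
  containing it.\<close>

definition B' :: "nat set list set" where "B' = {b @ t | b t. b \<in> B \<and> t \<in> tails}"

lemma pre_suf: "pre w @ suf w = w"
  by (simp add: pre_def suf_def)

lemma length_pre_suf: "length w = length (pre w) + length (suf w)"
  using pre_suf[of w] by (metis length_append)

lemma B_not_N: "b \<in> B \<Longrightarrow> Z \<in> set b \<Longrightarrow> N \<notin> Z"
  using B_words[of b] by (fastforce simp: generators_def)

lemma tails_hd: "t \<in> tails \<Longrightarrow> t = [] \<or> N \<in> hd t"
  by (induction rule: tails.induct) auto

lemma tails_words: "t \<in> tails \<Longrightarrow> set t \<subseteq> generators N"
proof (induction rule: tails.induct)
  case (tails_Cons A c t)
  have "set c \<subseteq> generators n" using B_words C_B tails_Cons by blast
  moreover have "generators n \<subseteq> generators N" by (auto simp: generators_def)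
  ultimately show ?case using tails_Cons by (auto simp: generators_def)
qed simp

lemma pre_append: "b \<in> B \<Longrightarrow> t \<in> tails \<Longrightarrow> pre (b @ t) = b"
  using tails_hd[of t] B_not_N by (cases t) (auto simp: pre_def takeWhile_append)

lemma suf_append: "b \<in> B \<Longrightarrow> t \<in> tails \<Longrightarrow> suf (b @ t) = t"
  using tails_hd[of t] B_not_N by (cases t) (auto simp: suf_def dropWhile_append)

lemma B'_iff: "w \<in> B' \<longleftrightarrow> pre w \<in> B \<and> suf w \<in> tails"
proof
  show "w \<in> B' \<Longrightarrow> pre w \<in> B \<and> suf w \<in> tails"
    by (auto simp: B'_def pre_append suf_append)
  show "pre w \<in> B \<and> suf w \<in> tails \<Longrightarrow> w \<in> B'"
    unfolding B'_def using pre_suf[of w] by (metis (mono_tags, lifting) mem_Collect_eq)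
qed

lemma append_B'_iff: "t \<in> tails \<Longrightarrow> b \<in> B \<Longrightarrow> b @ t \<in> B'"
  by (auto simp: B'_def)

text \<open>
  The new module is a direct sum, over the tails \<open>t\<close>, of copies of the old one; \<open>slice f t\<close> is the
  component of \<open>f\<close> in the copy belonging to \<open>t\<close>.
\<close>

definition slice :: "'f word_fun \<Rightarrow> nat set list \<Rightarrow> 'f word_fun" where
  "slice f t = (\<lambda>b. if b \<in> B then f (b @ t) else 0)"

definition lift :: "('f word_fun \<Rightarrow> 'f word_fun) \<Rightarrow> 'f word_fun \<Rightarrow> 'f word_fun" where
  "lift Z f = (\<lambda>w. if w \<in> B' then Z (slice f (suf w)) (pre w) else 0)"

definition cnt :: "nat set list \<Rightarrow> nat" where
  "cnt w = length (filter (\<lambda>Z. N \<in> Z) w)"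

definition G :: "nat \<Rightarrow> nat \<Rightarrow> 'f word_fun set" where
  "G D p = {f \<in> level B' D. \<forall>w. f w \<noteq> 0 \<longrightarrow> p \<le> cnt w}"

text \<open>A lift from the graded piece of filtration \<open>p\<close> back to the module: slices
  may be prescribed freely at the tails with exactly \<open>p\<close> letters containing
  \<open>N\<close>, and are zero elsewhere.\<close>

definition glue :: "nat \<Rightarrow> (nat set list \<Rightarrow> 'f word_fun) \<Rightarrow> 'f word_fun" where
  "glue p h = (\<lambda>w. if suf w \<in> tails \<and> cnt (suf w) = p then h (suf w) (pre w) else 0)"

lemma cnt_suf: "cnt w = cnt (suf w)"
proof -
  have "filter (\<lambda>Z. N \<in> Z) (pre w) = []" by (auto simp: pre_def filter_empty_conv dest: set_takeWhileD)
  then have "filter (\<lambda>Z. N \<in> Z) w = filter (\<lambda>Z. N \<in> Z) (suf w)"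
    by (subst pre_suf[symmetric], subst filter_append) simp
  then show ?thesis by (simp add: cnt_def)
qed

lemma G_0_eq: "G D 0 = level B' D"
  by (simp add: G_def)

text \<open>The subtraction is truncated on purpose: for a tail too long for degree \<open>D\<close>
  it gives index 0, and \<open>level B 0\<close> forces the slice to vanish.\<close>

lemma slice_level: "f \<in> level B' D \<Longrightarrow> slice f t \<in> level B (D - length t)"
  by (auto simp: level_def slice_def)

lemma slice_0 [simp]: "slice 0 t = 0"
  by (auto simp: slice_def)

lemma slice_diff: "slice (f - g) t = slice f t - slice g t"
  by (auto simp: slice_def)

lemma slice_add: "slice (f + g) t = slice f t + slice g t"
  by (auto simp: slice_def)

lemma slice_smul: "slice (smul a f) t = smul a (slice f t)"
  by (auto simp: slice_def smul_def)

lemma slice_sum: "slice (\<Sum>i\<in>S. f i) t = (\<Sum>i\<in>S. slice (f i) t)"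
proof (induction S rule: infinite_finite_induct)
  case (infinite S)
  then show ?case by (simp only: sum.infinite[OF infinite] slice_0)
next
  case (insert x F)
  then show ?case by (simp only: sum.insert[OF insert(1,2)] slice_add)
qed (simp only: sum.empty slice_0)

lemma slice_eqI:
  assumes "f \<in> level B' D" "g \<in> level B' D" "\<And>t. t \<in> tails \<Longrightarrow> slice f t = slice g t"
  shows "f = g"
proof
  fix w
  show "f w = g w"
  proof (cases "w \<in> B'")
    case True
    then have "slice f (suf w) (pre w) = slice g (suf w) (pre w)" using assms(3) B'_iff by auto
    then show ?thesis using True B'_iff by (simp add: slice_def pre_suf)
  next
    case False
    then show ?thesis using assms(1,2) by (force simp: level_def)
  qed
qed

lemma lift_closed:
  assumes Z: "\<And>D g. g \<in> level B D \<Longrightarrow> Z g \<in> level B (Suc D)" and f: "f \<in> level B' D"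
  shows "lift Z f \<in> level B' (Suc D)"
  unfolding level_def
proof (intro CollectI allI impI conjI)
  fix w assume "lift Z f w \<noteq> 0"
  then have w: "w \<in> B'" and nz: "Z (slice f (suf w)) (pre w) \<noteq> 0" by (auto simp: lift_def split: if_splits)
  show "w \<in> B'" by (rule w)
  have len: "Suc (length (pre w)) = Suc (D - length (suf w))"
    using Z[OF slice_level[OF f]] nz unfolding level_def by blast
  have "slice f (suf w) \<noteq> 0"
  proof
    assume "slice f (suf w) = 0"
    \<comment> \<open>Nothing is assumed about \<open>Z 0\<close> directly; as 0 lies in all levels,
      \<open>Z 0\<close> has two different degrees and is therefore zero.\<close>
    then have "Z (slice f (suf w)) \<in> level B (Suc 0)" "Z (slice f (suf w)) \<in> level B (Suc (Suc 0))"
      using Z[of 0] by auto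
    with nz show False unfolding level_def by fastforce
  qed
  then have "D - length (suf w) \<noteq> 0" using slice_level[OF f, of "suf w"] level_0 by metis
  then show "Suc (length w) = Suc D" using len length_pre_suf[of w] by simp
qed

lemma slice_lift:
  assumes Z: "\<And>D g. g \<in> level B D \<Longrightarrow> Z g \<in> level B (Suc D)" and f: "f \<in> level B' D" and t: "t \<in> tails"
  shows "slice (lift Z f) t = Z (slice f t)"
proof
  fix b
  show "slice (lift Z f) t b = Z (slice f t) b"
  proof (cases "b \<in> B")
    case True
    then show ?thesis using t by (simp add: slice_def lift_def pre_append suf_append append_B'_iff)
  next
    case False
    then have "Z (slice f t) b = 0" using Z[OF slice_level[OF f, of t]] by (auto simp: level_def)
    then show ?thesis using False by (simp add: slice_def)
  qed
qed

lemma G_slice: "f \<in> G D (Suc p) \<Longrightarrow> cnt t = p \<Longrightarrow> slice f t = 0"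
proof
  fix b assume f: "f \<in> G D (Suc p)" and p: "cnt t = p"
  show "slice f t b = 0 b"
  proof (cases "b \<in> B")
    case True
    then have "cnt (b @ t) = p" using p B_not_N[of b] by (auto simp: cnt_def filter_empty_conv)
    then show ?thesis using f by (force simp: G_def slice_def)
  qed (simp add: slice_def)
qed

text \<open>Together with \<open>G_slice\<close> this identifies the graded piece of filtration
  \<open>p\<close> with the families of slices at tails that have \<open>p\<close> letters
  containing \<open>N\<close>. Statements about leading terms become statements about the old
  module.\<close>

lemma G_SucI:
  assumes f: "f \<in> G D p" and 0: "\<And>t. t \<in> tails \<Longrightarrow> cnt t = p \<Longrightarrow> slice f t = 0"
  shows "f \<in> G D (Suc p)"
proof -
  have "Suc p \<le> cnt w" if w: "f w \<noteq> 0" for w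
  proof -
    have "w \<in> B'" "p \<le> cnt w" using f w by (auto simp: G_def level_def)
    moreover have "cnt w \<noteq> p"
    proof
      assume "cnt w = p"
      then have "slice f (suf w) (pre w) = 0" using 0[of "suf w"] \<open>w \<in> B'\<close> B'_iff cnt_suf by auto
      then show False using w \<open>w \<in> B'\<close> B'_iff by (simp add: slice_def pre_suf)
    qed
    ultimately show ?thesis by simp
  qed
  then show ?thesis using f by (simp add: G_def)
qed

lemma glue_G:
  assumes "\<And>t. t \<in> tails \<Longrightarrow> cnt t = p \<Longrightarrow> h t \<in> level B (D - length t)"
  shows "glue p h \<in> G D p"
proof -
  have "w \<in> B' \<and> Suc (length w) = D \<and> p \<le> cnt w" if "glue p h w \<noteq> 0" for w
  proof -
    have s: "suf w \<in> tails" "cnt (suf w) = p" "h (suf w) (pre w) \<noteq> 0"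
      using that by (auto simp: glue_def split: if_splits)
    then have "pre w \<in> B" "Suc (length (pre w)) = D - length (suf w)"
      using assms[of "suf w"] unfolding level_def by blast+
    then show ?thesis using s B'_iff length_pre_suf[of w] cnt_suf[of w] by simp
  qed
  then show ?thesis unfolding G_def level_def by blast
qed

lemma slice_glue:
  assumes "t \<in> tails" "cnt t = p" "h t \<in> level B D"
  shows "slice (glue p h) t = h t"
proof
  fix b
  show "slice (glue p h) t b = h t b"
    using assms by (cases "b \<in> B") (auto simp: slice_def glue_def pre_append suf_append level_def)
qed

section \<open>The old operators on the new module and their perturbations\<close>

definition xl :: "nat set \<Rightarrow> nat \<Rightarrow> 'f word_fun \<Rightarrow> 'f word_fun" where
  "xl A j = edge (\<lambda>A. lift (V A)) A j"

lemma lift_V_closed: "A \<subseteq> {1..n} \<Longrightarrow> f \<in> level B' D \<Longrightarrow> lift (V A) f \<in> level B' (Suc D)"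
  by (intro lift_closed V_closed)

lemma slice_lift_V: "A \<subseteq> {1..n} \<Longrightarrow> f \<in> level B' D \<Longrightarrow> t \<in> tails \<Longrightarrow> slice (lift (V A) f) t = V A (slice f t)"
  by (intro slice_lift[of _ f D] V_closed)

lemma xl_closed: "A \<subseteq> {1..n} \<Longrightarrow> f \<in> level B' D \<Longrightarrow> xl A j f \<in> level B' (Suc D)"
  unfolding xl_def edge_def by (intro level_diff lift_V_closed) auto

lemma slice_xl: 
  assumes "A \<subseteq> {1..n}" "f \<in> level B' D" "t \<in> tails"
  shows "slice (xl A j f) t = edge V A j (slice f t)"
proof -
  have "A - {j} \<subseteq> {1..n}" using assms by auto
  then show ?thesis using assms unfolding xl_def edge_def by (simp add: slice_diff slice_lift_V)
qed

lemma lift_V_diff: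
  assumes "A \<subseteq> {1..n}" "f \<in> level B' D" "g \<in> level B' D"
  shows "lift (V A) (f - g) = lift (V A) f - lift (V A) g"
proof (rule slice_eqI)
  show "lift (V A) (f - g) \<in> level B' (Suc D)" "lift (V A) f - lift (V A) g \<in> level B' (Suc D)"
    using assms by (simp_all add: lift_V_closed level_diff)
  fix t assume "t \<in> tails"
  then show "slice (lift (V A) (f - g)) t = slice (lift (V A) f - lift (V A) g) t"
    using assms V_diff[OF assms(1) slice_level[OF assms(2)] slice_level[OF assms(3)], of t]
    by (simp add: slice_lift_V[of _ _ D] slice_diff level_diff)
qed

lemma lift_V_smul:
  assumes "A \<subseteq> {1..n}" "f \<in> level B' D"
  shows "lift (V A) (smul a f) = smul a (lift (V A) f)"
proof (rule slice_eqI)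
  show "lift (V A) (smul a f) \<in> level B' (Suc D)" "smul a (lift (V A) f) \<in> level B' (Suc D)"
    using assms by (simp_all add: lift_V_closed level_smul)
  fix t assume "t \<in> tails"
  then show "slice (lift (V A) (smul a f)) t = slice (smul a (lift (V A) f)) t"
    using assms V_smul[OF assms(1) slice_level[OF assms(2)], of a t]
    by (simp add: slice_lift_V[of _ _ D] slice_smul level_smul)
qed

lemma lift_V_empty: "lift (V {}) f = 0"
  by (auto simp: lift_def V_empty)

lemma xl_diff:
  assumes "A \<subseteq> {1..n}" "f \<in> level B' D" "g \<in> level B' D"
  shows "xl A j (f - g) = xl A j f - xl A j g"
proof -
  have "A - {j} \<subseteq> {1..n}" using assms by auto
  then show ?thesis using assms unfolding xl_def edge_def by (simp add: lift_V_diff)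
qed

lemma xl_smul:
  assumes "A \<subseteq> {1..n}" "f \<in> level B' D"
  shows "xl A j (smul a f) = smul a (xl A j f)"
proof -
  have "A - {j} \<subseteq> {1..n}" using assms by auto
  then show ?thesis using assms unfolding xl_def edge_def by (simp add: lift_V_smul smul_diff)
qed

lemma G_level: "f \<in> G D p \<Longrightarrow> f \<in> level B' D"
  by (simp add: G_def)

lemma G_diff': "f \<in> G D p \<Longrightarrow> g \<in> G D p \<Longrightarrow> f - g \<in> G D p"
  unfolding G_def by (auto intro: level_diff) (metis diff_self)

lemma G_sum': "(\<And>i. i \<in> S \<Longrightarrow> f i \<in> G D p) \<Longrightarrow> (\<Sum>i\<in>S. f i) \<in> G D p"
proof (induction S rule: infinite_finite_induct)
  case (insert x F)
  have "sum f F \<in> G D p" using insert by simp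
  then have "0 - sum f F \<in> G D p" by (rule G_diff'[rotated]) (simp add: G_def)
  then have "f x - (0 - sum f F) \<in> G D p" by (rule G_diff'[OF insert.prems[OF insertI1]])
  then show ?case unfolding sum.insert[OF insert(1,2)] by (simp only: diff_0 diff_minus_eq_add)
qed (simp_all add: G_def)

lemma G_smul: "f \<in> G D p \<Longrightarrow> smul a f \<in> G D p"
  unfolding G_def by (auto intro: level_smul simp: smul_apply)

lemma G_Suc': "G D (Suc p) \<subseteq> G D p"
  by (auto simp: G_def)

lemma lift_V_G: assumes "A \<subseteq> {1..n}" "f \<in> G D p" shows "lift (V A) f \<in> G (Suc D) p"
proof -
  have "p \<le> cnt w" if nz: "lift (V A) f w \<noteq> 0" for w
  proof -
    have "V A 0 = 0" using V_diff[OF assms(1), of 0 0 0] by simp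
    then have "slice f (suf w) \<noteq> 0" using nz by (auto simp: lift_def split: if_splits)
    then obtain b where "b \<in> B" "f (b @ suf w) \<noteq> 0" by (auto simp: slice_def fun_eq_iff split: if_splits)
    then have "p \<le> cnt (b @ suf w)" using assms(2) by (auto simp: G_def)
    moreover have "cnt (b @ suf w) = cnt w"
      using B_not_N[OF \<open>b \<in> B\<close>] cnt_suf[of w] by (auto simp: cnt_def filter_empty_conv)
    ultimately show ?thesis by simp
  qed
  then show ?thesis using lift_V_closed[OF assms(1) G_level[OF assms(2)]] by (simp add: G_def)
qed

lemma xl_G: "A \<subseteq> {1..n} \<Longrightarrow> f \<in> G D p \<Longrightarrow> xl A j f \<in> G (Suc D) p"
  unfolding xl_def edge_def by (intro G_diff' lift_V_G) auto

lemma G_bound': "G D D \<subseteq> {0}"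
proof
  fix f assume f: "f \<in> G D D"
  have "f w = 0" for w
  proof (rule ccontr)
    assume "f w \<noteq> 0"
    then have "D \<le> cnt w" "Suc (length w) = D" using f by (auto simp: G_def level_def)
    moreover have "cnt w \<le> length w" by (simp add: cnt_def)
    ultimately show False by simp
  qed
  then show "f \<in> {0}" by auto
qed

lemma xl_comm:
  assumes "A \<subseteq> {1..n}" "i \<in> A" "j \<in> A" "i \<noteq> j" "f \<in> level B' D"
  shows "xl A i (xl (A - {i}) j f) = xl A j (xl (A - {j}) i f)"
proof -
  have sub: "A - {i} \<subseteq> {1..n}" "A - {j} \<subseteq> {1..n}" using assms by auto
  note cl = xl_closed[OF sub(1) assms(5)] xl_closed[OF sub(2) assms(5)]
  show ?thesis
  proof (rule slice_eqI[OF xl_closed[OF assms(1) cl(1)] xl_closed[OF assms(1) cl(2)]])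
    fix t assume t: "t \<in> tails"
    show "slice (xl A i (xl (A - {i}) j f)) t = slice (xl A j (xl (A - {j}) i f)) t"
      unfolding slice_xl[OF assms(1) cl(1) t] slice_xl[OF assms(1) cl(2) t]
        slice_xl[OF sub(1) assms(5) t] slice_xl[OF sub(2) assms(5) t]
      by (rule V_comm[OF assms(1-4) slice_level[OF assms(5)]])
  qed
qed

lemma slice_edge_sum_xl:
  assumes "A \<subseteq> {1..n}" "\<And>j. m j \<in> level B' D" "t \<in> tails"
  shows "slice (edge_sum xl A k m) t = edge_sum (edge V) A k (\<lambda>j. slice (m j) t)"
  unfolding edge_sum_def slice_sum using assms by (intro sum.cong refl) (auto intro!: slice_xl)

lemma edge_sum_V_0: "A \<subseteq> {1..n} \<Longrightarrow> edge_sum (edge V) A k (\<lambda>_. 0) = 0"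
  unfolding edge_sum_def by (simp add: edge_zero)

lemma slice_long: "f \<in> level B' D \<Longrightarrow> D \<le> length t \<Longrightarrow> slice f t = 0"
  using slice_level[of f D t] level_0 by simp

text \<open>Lifted operators do not change the tail, so they act on the graded space slice by slice
  as the old ones. Graded regularity is \<open>V_regular\<close> on each slice, and the solutions
  are put together by \<open>glue\<close>.\<close>

lemma filtered_xl: "filtered_edges G xl {A. A \<subseteq> {1..n}}"
proof
  show "0 \<in> G D p" for D p by (simp add: G_def)
next
  fix A k D p m
  assume "A \<in> {A. A \<subseteq> {1..n}}" and k: "k \<in> A" and m: "\<And>j. m j \<in> G (Suc D) p"
    and s: "edge_sum xl A (Suc k) m \<in> G (Suc (Suc D)) (Suc p)"
  then have A: "A \<subseteq> {1..n}" by simp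
  have m': "\<And>j. m j \<in> level B' (Suc D)" using m G_level by blast
  have Ak: "A - {k} \<subseteq> {1..n}" using A by auto
  have ex: "\<exists>u. (\<forall>j. u j \<in> level B (D - length t)) \<and> slice (m k) t = edge_sum (edge V) (A - {k}) k u"
    if t: "t \<in> tails" "cnt t = p" for t
  \<comment> \<open>Only for tails of length at most \<open>D\<close> is
    \<open>Suc D - length t\<close> the successor of \<open>D - length t\<close>; for longer ones
    the slice is zero.\<close>
  proof (cases "length t \<le> D")
    case True
    have "slice (m j) t \<in> level B (Suc (D - length t))" for j
      using slice_level[OF m', of j t] True by (simp add: Suc_diff_le)
    moreover have "edge_sum (edge V) A (Suc k) (\<lambda>j. slice (m j) t) = 0"
      using slice_edge_sum_xl[OF A m' t(1)] G_slice[OF s t(2)] by simp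
    ultimately show ?thesis by (rule V_regular[OF A k])
  next
    case False
    then have "slice (m k) t = 0" by (intro slice_long[OF m']) simp
    then show ?thesis using edge_sum_V_0[OF Ak] by (intro exI[of _ "\<lambda>_. 0"]) simp
  qed
  then obtain h where h: "\<And>t j. t \<in> tails \<Longrightarrow> cnt t = p \<Longrightarrow> h t j \<in> level B (D - length t)"
    and eq: "\<And>t. t \<in> tails \<Longrightarrow> cnt t = p \<Longrightarrow> slice (m k) t = edge_sum (edge V) (A - {k}) k (h t)"
    by metis
  define u where "u j = glue p (\<lambda>t. h t j)" for j
  have u: "u j \<in> G D p" for j unfolding u_def by (rule glue_G) (rule h)
  have su: "slice (u j) t = h t j" if "t \<in> tails" "cnt t = p" for t j
    unfolding u_def using that h[OF that] by (rule slice_glue)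
  have e: "edge_sum xl (A - {k}) k u \<in> G (Suc D) p"
    unfolding edge_sum_def by (intro G_sum' xl_G Ak u)
  have "m k - edge_sum xl (A - {k}) k u \<in> G (Suc D) (Suc p)"
  proof (rule G_SucI)
    show "m k - edge_sum xl (A - {k}) k u \<in> G (Suc D) p" using m e by (rule G_diff')
    fix t assume t: "t \<in> tails" "cnt t = p"
    show "slice (m k - edge_sum xl (A - {k}) k u) t = 0"
      using slice_edge_sum_xl[OF Ak G_level[OF u] t(1), of k] eq[OF t] su[OF t] by (simp add: slice_diff)
  qed
  then show "\<exists>u. (\<forall>j. u j \<in> G D p) \<and> m k - edge_sum xl (A - {k}) k u \<in> G (Suc D) (Suc p)"
    using u by blast
next
  fix A j f g D assume "A \<in> {A. A \<subseteq> {1..n}}" "f \<in> G D 0" "g \<in> G D 0"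
  then show "xl A j (f - g) = xl A j f - xl A j g" by (intro xl_diff) (auto simp: G_0_eq)
next
  fix A i j f D assume "A \<in> {A. A \<subseteq> {1..n}}" "i \<in> A" "j \<in> A" "i \<noteq> j" "f \<in> G D 0"
  then show "xl A i (xl (A - {i}) j f) = xl A j (xl (A - {j}) i f)"
    by (intro xl_comm[of A i j f D]) (auto simp: G_0_eq)
qed (use G_diff' G_Suc' G_bound' xl_G in auto)

interpretation xl: filtered_edges G xl "{A. A \<subseteq> {1..n}}" by (rule filtered_xl)

lemma edge_sum_perturb:
  assumes A: "A \<subseteq> {1..n}" and m: "\<And>j. m j \<in> G D p"
    and Y: "\<And>j f D p. j \<in> A \<Longrightarrow> f \<in> G D p \<Longrightarrow> Y A j f - xl A j f \<in> G (Suc D) (Suc p)"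
  shows "edge_sum Y A k m - edge_sum xl A k m \<in> G (Suc D) (Suc p)"
  unfolding edge_sum_def sum_subtractf[symmetric] using m by (intro xl.G_sum Y) auto

text \<open>\<open>Y\<close> and \<open>xl\<close> have the same leading terms, and
  \<open>graded_regular\<close> sees leading terms only: replacing one sum by the other changes it
  by something one step deeper, both in the hypothesis and in the conclusion.\<close>

lemma perturbation:
  assumes U: "\<And>A. A \<in> U \<Longrightarrow> A \<subseteq> {1..n}"
    and U_down: "\<And>A j. A \<in> U \<Longrightarrow> j \<in> A \<Longrightarrow> A - {j} \<in> U"
    and Y_diff: "\<And>A j f g D. A \<in> U \<Longrightarrow> j \<in> A \<Longrightarrow> f \<in> level B' D \<Longrightarrow> g \<in> level B' D \<Longrightarrow> Y A j (f - g) = Y A j f - Y A j g"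
    and Y: "\<And>A j f D p. A \<in> U \<Longrightarrow> j \<in> A \<Longrightarrow> f \<in> G D p \<Longrightarrow> Y A j f - xl A j f \<in> G (Suc D) (Suc p)"
    and Y_comm: "\<And>A i j f D. A \<in> U \<Longrightarrow> i \<in> A \<Longrightarrow> j \<in> A \<Longrightarrow> i \<noteq> j \<Longrightarrow> f \<in> level B' D \<Longrightarrow>
        Y A i (Y (A - {i}) j f) = Y A j (Y (A - {j}) i f)"
  shows "filtered_edges G Y U"
proof
  fix A k D p m
  assume A: "A \<in> U" and k: "k \<in> A" and m: "\<And>j. m j \<in> G (Suc D) p"
    and s: "edge_sum Y A (Suc k) m \<in> G (Suc (Suc D)) (Suc p)"
  have A': "A \<subseteq> {1..n}" and Ak: "A - {k} \<in> U" and Ak': "A - {k} \<subseteq> {1..n}"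
    using U[OF A] U_down[OF A k] by auto
  have "edge_sum Y A (Suc k) m - (edge_sum Y A (Suc k) m - edge_sum xl A (Suc k) m) \<in> G (Suc (Suc D)) (Suc p)"
    using s edge_sum_perturb[where Y = Y, OF A' m Y[OF A]] by (rule xl.G_diff)
  then have "edge_sum xl A (Suc k) m \<in> G (Suc (Suc D)) (Suc p)" by simp
  then obtain u where u: "\<And>j. u j \<in> G D p" and r: "m k - edge_sum xl (A - {k}) k u \<in> G (Suc D) (Suc p)"
    using xl.graded_regular[of A k m D p] A' k m by blast
  have "m k - edge_sum xl (A - {k}) k u - (edge_sum Y (A - {k}) k u - edge_sum xl (A - {k}) k u) \<in> G (Suc D) (Suc p)"
    using r edge_sum_perturb[where Y = Y, OF Ak' u Y[OF Ak]] by (rule xl.G_diff)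
  then show "\<exists>u. (\<forall>j. u j \<in> G D p) \<and> m k - edge_sum Y (A - {k}) k u \<in> G (Suc D) (Suc p)"
    using u by (auto simp: algebra_simps)
next
  fix A j f D p assume A: "A \<in> U" and j: "j \<in> A" and f: "f \<in> G D p"
  have "Y A j f - xl A j f \<in> G (Suc D) p" using Y[OF A j f] xl.G_Suc by blast
  then have "(Y A j f - xl A j f) + xl A j f \<in> G (Suc D) p" using xl_G[OF U[OF A] f] by (rule xl.G_add)
  then show "Y A j f \<in> G (Suc D) p" by simp
qed (use G_diff' G_Suc' G_bound' U_down in \<open>auto simp: G_0_eq intro: Y_diff Y_comm\<close>)

text \<open>The complement of the images of the \<open>xl A j\<close>: in each slice it is the span
  of the words in \<open>C A\<close>.\<close>

definition Cs :: "nat set \<Rightarrow> nat \<Rightarrow> 'f word_fun set" where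
  "Cs A D = {f \<in> level B' D. \<forall>w. f w \<noteq> 0 \<longrightarrow> pre w \<in> C A}"

lemma slice_Cs: "f \<in> Cs A D \<Longrightarrow> t \<in> tails \<Longrightarrow> slice f t \<in> level (C A) (D - length t)"
  by (auto simp: Cs_def level_def slice_def pre_append dest!: spec[of _ "_ @ t"])

lemma Cs_diff: "f \<in> Cs A D \<Longrightarrow> g \<in> Cs A D \<Longrightarrow> f - g \<in> Cs A D"
  unfolding Cs_def by (auto intro: level_diff) (metis diff_self)

lemma Cs_smul: "f \<in> Cs A D \<Longrightarrow> smul a f \<in> Cs A D"
  unfolding Cs_def by (auto intro: level_smul simp: smul_apply)

lemma xl_span:
  assumes A: "A \<subseteq> {1..n}" and f: "f \<in> G (Suc D) p"
  shows "\<exists>m c. (\<forall>j. m j \<in> G D p) \<and> c \<in> Cs A (Suc D) \<and> c \<in> G (Suc D) p \<and>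
    f - (edge_sum xl A N m + c) \<in> G (Suc D) (Suc p)"
proof -
  have "\<exists>m c. (\<forall>j. m j \<in> level B (D - length t)) \<and> c \<in> level (C A) (Suc D - length t) \<and>
      slice f t = edge_sum (edge V) A N m + c" for t
  proof (cases "length t \<le> D")
    case True
    then show ?thesis using C_span[OF A, of "slice f t" "D - length t"] slice_level[OF G_level[OF f], of t]
      by (simp add: Suc_diff_le)
  next
    case False
    then have "slice f t = 0" by (intro slice_long[OF G_level[OF f]]) simp
    then show ?thesis using edge_sum_V_0[OF A] by (intro exI[of _ "\<lambda>_. 0"] exI[of _ 0]) simp
  qed
  then obtain h c where h: "\<And>t j. h t j \<in> level B (D - length t)"
    and c: "\<And>t. c t \<in> level (C A) (Suc D - length t)"
    and eq: "\<And>t. slice f t = edge_sum (edge V) A N (h t) + c t"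
    by metis
  have c': "c t \<in> level B (Suc D - length t)" for t using c level_mono[OF C_B] by blast
  define m where "m j = glue p (\<lambda>t. h t j)" for j
  have m: "m j \<in> G D p" for j unfolding m_def by (rule glue_G) (rule h)
  have cG: "glue p c \<in> G (Suc D) p" by (rule glue_G) (rule c')
  have "glue p c \<in> Cs A (Suc D)"
    using G_level[OF cG] c by (auto simp: Cs_def glue_def level_def split: if_splits)
  moreover have "f - (edge_sum xl A N m + glue p c) \<in> G (Suc D) (Suc p)"
  proof (rule G_SucI)
    show "f - (edge_sum xl A N m + glue p c) \<in> G (Suc D) p"
      using f m cG A by (intro xl.G_diff xl.G_add xl.edge_sum_closed) auto
    fix t assume t: "t \<in> tails" "cnt t = p"
    have "slice (m j) t = h t j" for j unfolding m_def using t h[of t j] by (rule slice_glue)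
    moreover have "slice (glue p c) t = c t" using t c'[of t] by (rule slice_glue)
    ultimately show "slice (f - (edge_sum xl A N m + glue p c)) t = 0"
      using slice_edge_sum_xl[OF A G_level[OF m] t(1), of N] eq by (simp add: slice_diff slice_add)
  qed
  ultimately show ?thesis using m cG by blast
qed

lemma xl_direct:
  assumes A: "A \<subseteq> {1..n}" and m: "\<And>j. m j \<in> G D p" and c: "c \<in> Cs A (Suc D)" "c \<in> G (Suc D) p"
    and s: "edge_sum xl A N m + c \<in> G (Suc D) (Suc p)"
  shows "c \<in> G (Suc D) (Suc p)"
proof (rule G_SucI[OF c(2)])
  fix t assume t: "t \<in> tails" "cnt t = p"
  show "slice c t = 0"
  proof (cases "length t \<le> D")
    case True
    have m': "m j \<in> level B' D" for j using m G_level by blast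
    have "edge_sum (edge V) A N (\<lambda>j. slice (m j) t) + slice c t = 0"
      using G_slice[OF s t(2)] slice_edge_sum_xl[OF A m' t(1)] by (simp add: slice_add)
    moreover have "slice c t \<in> level (C A) (Suc (D - length t))"
      using slice_Cs[OF c(1) t(1)] True by (simp add: Suc_diff_le)
    ultimately show ?thesis using C_direct[of A "\<lambda>j. slice (m j) t" "D - length t", OF A slice_level[OF m']] by blast
  next
    case False
    then show ?thesis by (intro slice_long[OF G_level[OF c(2)]]) simp
  qed
qed

end

section \<open>Construction of the raising operators\<close>

context Q_extension
begin

interpretation xl: filtered_edges G xl "{A. A \<subseteq> {1..n}}" by (rule filtered_xl)

text \<open>The free part of \<open>d A\<close>: in front of \<open>c @ t\<close> with
  \<open>c\<close> in \<open>C A\<close>, the new letter opens a new block, so that the result is a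
  tail.\<close>

definition shift :: "nat set \<Rightarrow> 'f word_fun \<Rightarrow> 'f word_fun" where
  "shift A f = (\<lambda>w. case w of [] \<Rightarrow> 0 | Z # v \<Rightarrow> if Z = insert N A then f v else 0)"

text \<open>The fourth clause is the relation \<open>d A * y A j = y A j * d (A - {j})\<close> with
  \<open>y\<close> written out. Only \<open>A\<close> and the sets \<open>A - {j}\<close> occur as
  arguments of \<open>d\<close>, which permits a construction by the size of
  \<open>A\<close>.\<close>

definition raising :: "(nat set \<Rightarrow> 'f word_fun \<Rightarrow> 'f word_fun) \<Rightarrow> nat set \<Rightarrow> bool" where
  "raising d A \<longleftrightarrow>
     (\<forall>D f g. f \<in> level B' D \<longrightarrow> g \<in> level B' D \<longrightarrow> d A (f - g) = d A f - d A g) \<and>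
     (\<forall>D a f. f \<in> level B' D \<longrightarrow> d A (smul a f) = smul a (d A f)) \<and>
     (\<forall>D p f. f \<in> G D p \<longrightarrow> d A f \<in> G (Suc D) (Suc p)) \<and>
     (\<forall>D j f. j \<in> A \<longrightarrow> f \<in> level B' D \<longrightarrow>
        d A (xl A j f - d (A - {j}) f) = xl A j (d (A - {j}) f) - d (A - {j}) (d (A - {j}) f)) \<and>
     (\<forall>D f. f \<in> Cs A (Suc D) \<longrightarrow> d A f = shift A f)"

lemma raising_cong:
  "raising d A \<Longrightarrow> d' A = d A \<Longrightarrow> (\<And>j. j \<in> A \<Longrightarrow> d' (A - {j}) = d (A - {j})) \<Longrightarrow> raising d' A"
  unfolding raising_def by simp

lemma
  assumes "raising d A"
  shows d_diff: "f \<in> level B' D \<Longrightarrow> g \<in> level B' D \<Longrightarrow> d A (f - g) = d A f - d A g"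
    and d_smul: "f \<in> level B' D \<Longrightarrow> d A (smul a f) = smul a (d A f)"
    and d_G: "f \<in> G D p \<Longrightarrow> d A f \<in> G (Suc D) (Suc p)"
    and d_xl: "j \<in> A \<Longrightarrow> f \<in> level B' D \<Longrightarrow>
        d A (xl A j f - d (A - {j}) f) = xl A j (d (A - {j}) f) - d (A - {j}) (d (A - {j}) f)"
    and d_shift: "f \<in> Cs A (Suc D) \<Longrightarrow> d A f = shift A f"
  using assms unfolding raising_def by blast+

lemma d_level: "raising d A \<Longrightarrow> f \<in> level B' D \<Longrightarrow> d A f \<in> level B' (Suc D)"
  using d_G[of d A f D 0] G_level by (simp add: G_0_eq)

lemma d_0: "raising d A \<Longrightarrow> d A 0 = 0"
  using d_diff[of d A 0 0 0] by simp

lemma d_add: "raising d A \<Longrightarrow> f \<in> level B' D \<Longrightarrow> g \<in> level B' D \<Longrightarrow> d A (f + g) = d A f + d A g"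
  using d_diff[of d A f D "0 - g"] d_diff[of d A 0 D g] d_0[of d A] level_diff[of 0 B' D g] by simp

lemma shift_diff: "shift A (f - g) = shift A f - shift A g"
  by (rule ext) (simp add: shift_def split: list.split)

lemma shift_smul: "shift A (smul a f) = smul a (shift A f)"
  by (rule ext) (simp add: shift_def smul_apply split: list.split)

text \<open>A prefix in \<open>C A\<close> turns the lengthened word into a tail, hence into a basis
  word with prefix \<open>[]\<close>; the new letter contains \<open>N\<close> and raises the
  filtration by one.\<close>

lemma shift_G:
  assumes A: "A \<subseteq> {1..n}" and f: "f \<in> Cs A D" "f \<in> G D p"
  shows "shift A f \<in> G (Suc D) (Suc p)"
proof -
  have "w \<in> B' \<and> Suc (length w) = Suc D \<and> Suc p \<le> cnt w" if nz: "shift A f w \<noteq> 0" for w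
  proof -
    from nz obtain v where w: "w = insert N A # v" and v: "f v \<noteq> 0"
      by (auto simp: shift_def split: list.splits if_splits)
    then have "v \<in> B'" "Suc (length v) = D" "p \<le> cnt v" "pre v \<in> C A"
      using f by (auto simp: Cs_def G_def level_def)
    moreover have "w \<in> tails"
      unfolding w using tails_Cons[of A "pre v" "suf v"] calculation A B'_iff pre_suf[of v] by simp
    ultimately show ?thesis using append_B'_iff[of w "[]"] Nil_B w by (simp add: cnt_def)
  qed
  then show ?thesis unfolding G_def level_def by blast
qed

text \<open>The sum telescopes, so it depends only on the set of removed elements and not on the
  order of removal. The symmetry of the composites below rests on this.\<close>

lemma xl_chain:
  "xl A i f + xl (A - {i}) j f = lift (V A) f - lift (V (A - {i} - {j})) f"
  by (simp add: xl_def edge_def)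

lemma minus_swap: "A - {i} - {j} = A - {j} - {i}"
  by auto

text \<open>
  In terms of the new module, \<open>yl d A j\<close> is \<open>v A - v (insert N (A - {j}))\<close>.
\<close>

definition yl :: "(nat set \<Rightarrow> 'f word_fun \<Rightarrow> 'f word_fun) \<Rightarrow> nat set \<Rightarrow> nat \<Rightarrow> 'f word_fun \<Rightarrow> 'f word_fun" where
  "yl d A j f = xl A j f - d (A - {j}) f"

text \<open>The relation for \<open>d (A - {i})\<close> lets the mixed terms telescope at the vector
  \<open>d (A - {i} - {j}) f\<close>. Everything on the right except the leading term is then
  visibly symmetric in \<open>i\<close> and \<open>j\<close>, and the leading term is symmetric by
  \<open>xl_comm\<close>.\<close>

lemma yl_yl:
  assumes A: "A \<subseteq> {1..n}" and i: "i \<in> A" and j: "j \<in> A" "i \<noteq> j" and f: "f \<in> level B' D"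
    and d: "raising d (A - {i})" "raising d (A - {i} - {j})"
  shows "yl d A i (yl d (A - {i}) j f) = xl A i (xl (A - {i}) j f)
    - (lift (V A) (d (A - {i} - {j}) f) - lift (V (A - {i} - {j})) (d (A - {i} - {j}) f))
    + d (A - {i} - {j}) (d (A - {i} - {j}) f)"
proof -
  define e where "e = d (A - {i} - {j}) f"
  have Ai: "A - {i} \<subseteq> {1..n}" using A by auto
  have e: "e \<in> level B' (Suc D)" unfolding e_def using d(2) f by (rule d_level)
  have "d (A - {i}) (yl d (A - {i}) j f) = xl (A - {i}) j e - d (A - {i} - {j}) e"
    using d_xl[OF d(1), of j f D] j f by (simp add: yl_def e_def)
  moreover have "xl A i (yl d (A - {i}) j f) = xl A i (xl (A - {i}) j f) - xl A i e"
    unfolding yl_def e_def[symmetric] by (rule xl_diff[OF A xl_closed[OF Ai f] e])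
  ultimately have "yl d A i (yl d (A - {i}) j f)
      = xl A i (xl (A - {i}) j f) - (xl A i e + xl (A - {i}) j e) + d (A - {i} - {j}) e"
    by (simp add: yl_def[of d A])
  then show ?thesis unfolding xl_chain e_def .
qed

lemma filtered_yl:
  assumes d: "\<And>A. A \<subseteq> {1..n} \<Longrightarrow> card A < r \<Longrightarrow> raising d A"
  shows "filtered_edges G (yl d) {A. A \<subseteq> {1..n} \<and> card A \<le> r}"
proof -
  have sub: "raising d (A - {j})" if "A \<in> {A. A \<subseteq> {1..n} \<and> card A \<le> r}" "j \<in> A" for A j
  proof (rule d)
    have "finite A" using that finite_subset by blast
    then have "card (A - {j}) < card A" using that by (intro psubset_card_mono) auto
    then show "card (A - {j}) < r" using that by auto
  qed (use that in auto)
  have sub2: "raising d (A - {i} - {j})" if "A \<in> {A. A \<subseteq> {1..n} \<and> card A \<le> r}" "i \<in> A" "j \<in> A" "i \<noteq> j" for A i j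
  proof (rule d)
    have "finite A" using that finite_subset by blast
    then have "card (A - {i} - {j}) < card A"
      using that by (intro psubset_card_mono) auto
    then show "card (A - {i} - {j}) < r" using that by auto
  qed (use that in auto)
  show ?thesis
  proof (rule perturbation)
    fix A j assume A: "A \<in> {A. A \<subseteq> {1..n} \<and> card A \<le> r}" and j: "j \<in> A"
    have "finite A" using A finite_subset by blast
    then show "A - {j} \<in> {A. A \<subseteq> {1..n} \<and> card A \<le> r}"
      using A card_mono[of A "A - {j}"] by auto
    fix f g D p
    show "yl d A j (f - g) = yl d A j f - yl d A j g" if "f \<in> level B' D" "g \<in> level B' D"
      using A that by (simp add: yl_def xl_diff[of A f D g] d_diff[OF sub[OF A j], of f D g])
    show "yl d A j f - xl A j f \<in> G (Suc D) (Suc p)" if "f \<in> G D p"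
      using xl.G_uminus[OF d_G[OF sub[OF A j] that]] by (simp add: yl_def)
  next
    fix A i j D and f :: "'f word_fun"
    assume A: "A \<in> {A. A \<subseteq> {1..n} \<and> card A \<le> r}" and ij: "i \<in> A" "j \<in> A" "i \<noteq> j" and f: "f \<in> level B' D"
    then have A': "A \<subseteq> {1..n}" by simp
    show "yl d A i (yl d (A - {i}) j f) = yl d A j (yl d (A - {j}) i f)"
      unfolding yl_yl[OF A' ij f sub[OF A ij(1)] sub2[OF A ij]]
        yl_yl[OF A' ij(2,1) ij(3)[symmetric] f sub[OF A ij(2)] sub2[OF A ij(2,1) ij(3)[symmetric]]]
        xl_comm[OF A' ij f] minus_swap[of A j i] ..
  qed simp
qed

text \<open>Since \<open>yl\<close> and \<open>xl\<close> have the same leading terms,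
  \<open>Cs A\<close> complements the images of both. The operators already built on proper subsets
  of \<open>A\<close> play the part of \<open>E\<close>, and their intertwining property is the
  fourth clause of \<open>raising\<close>.\<close>

lemma filtered_complement_yl:
  assumes A: "A \<subseteq> {1..n}" and d: "\<And>B. B \<subseteq> {1..n} \<Longrightarrow> card B < card A \<Longrightarrow> raising d B"
  shows "filtered_complement G (yl d) {B. B \<subseteq> {1..n} \<and> card B \<le> card A} N smul A (Cs A) (shift A) d"
proof -
  interpret Y: filtered_edges G "yl d" "{B. B \<subseteq> {1..n} \<and> card B \<le> card A}"
    by (rule filtered_yl[OF d])
  have fin: "finite A" using A finite_subset by blast
  have sub: "raising d B" if "B \<subseteq> A" "B \<noteq> A" for B
    using that A by (intro d psubset_card_mono[OF fin]) auto
  have pert: "yl d A j f - xl A j f \<in> G (Suc D) (Suc p)" if "j \<in> A" "f \<in> G D p" for j f D p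
    using xl.G_uminus[OF d_G[OF sub that(2), of "A - {j}"]] that(1) by (auto simp: yl_def)
  show ?thesis
  proof
    show "A \<in> {B. B \<subseteq> {1..n} \<and> card B \<le> card A}" using A by simp
    show "f \<in> G D 0 \<Longrightarrow> f \<in> G D' 0 \<Longrightarrow> f \<noteq> 0 \<Longrightarrow> D = D'" for f D D'
      unfolding G_0_eq by (rule level_unique)
    show "0 \<in> Cs A D" for D by (simp add: Cs_def)
    show "Cs A D \<subseteq> G D 0" for D by (auto simp: Cs_def G_def)
    show "A \<subseteq> {..<N}" using A by auto
    fix f D p assume f: "f \<in> G (Suc D) p"
    from xl_span[OF A f] obtain m c where m: "\<And>j. m j \<in> G D p" and c: "c \<in> Cs A (Suc D)" "c \<in> G (Suc D) p"
      and r: "f - (edge_sum xl A N m + c) \<in> G (Suc D) (Suc p)" by blast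
    have "f - (edge_sum xl A N m + c) - (edge_sum (yl d) A N m - edge_sum xl A N m) \<in> G (Suc D) (Suc p)"
      by (rule xl.G_diff[OF r edge_sum_perturb[where Y = "yl d", OF A m pert]])
    then have "f - (edge_sum (yl d) A N m + c) \<in> G (Suc D) (Suc p)" by (simp add: algebra_simps)
    then show "\<exists>m c. (\<forall>j. m j \<in> G D p) \<and> c \<in> Cs A (Suc D) \<and> c \<in> G (Suc D) p \<and>
        f - (edge_sum (yl d) A N m + c) \<in> G (Suc D) (Suc p)"
      using m c by blast
  next
    fix m c D p
    assume m: "\<And>j. m j \<in> G D p" and c: "c \<in> Cs A (Suc D)" "c \<in> G (Suc D) p"
      and s: "edge_sum (yl d) A N m + c \<in> G (Suc D) (Suc p)"
    have "edge_sum (yl d) A N m + c - (edge_sum (yl d) A N m - edge_sum xl A N m) \<in> G (Suc D) (Suc p)"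
      by (rule xl.G_diff[OF s edge_sum_perturb[where Y = "yl d", OF A m pert]])
    then have "edge_sum xl A N m + c \<in> G (Suc D) (Suc p)" by (simp add: algebra_simps)
    then show "c \<in> G (Suc D) (Suc p)" by (rule xl_direct[OF A m c])
  next
    fix j a f D assume j: "j \<in> A" and "f \<in> G D 0"
    then have f: "f \<in> level B' D" by (simp add: G_0_eq)
    have dj: "raising d (A - {j})" using j by (intro sub) auto
    show "d (A - {j}) (smul a f) = smul a (d (A - {j}) f)" by (rule d_smul[OF dj f])
    then show "yl d A j (smul a f) = smul a (yl d A j f)"
      by (simp add: yl_def xl_smul[OF A f] smul_diff)
  next
    fix j f g D assume j: "j \<in> A" and "f \<in> G D 0" "g \<in> G D 0"
    then show "d (A - {j}) (f - g) = d (A - {j}) f - d (A - {j}) g"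
      by (intro d_diff[of _ _ _ D] sub) (auto simp: G_0_eq)
  next
    fix j k f D assume j: "j \<in> A" "k \<in> A" "k \<noteq> j" and "f \<in> G D 0"
    then show "d (A - {j}) (yl d (A - {j}) k f) = yl d (A - {j}) k (d (A - {j} - {k}) f)"
      unfolding yl_def by (intro d_xl[of _ _ _ _ D] sub) (auto simp: G_0_eq)
  next
    show "B \<subseteq> A \<Longrightarrow> B \<noteq> A \<Longrightarrow> f \<in> G D p \<Longrightarrow> d B f \<in> G (Suc D) (Suc p)" for B f D p
      by (rule d_G[OF sub])
    show "f \<in> Cs A D \<Longrightarrow> f \<in> G D p \<Longrightarrow> shift A f \<in> G (Suc D) (Suc p)" for f D p
      by (rule shift_G[OF A])
  qed (use Cs_diff Cs_smul smul_add shift_diff shift_smul G_smul in auto)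
qed

text \<open>Sets of equal size do not constrain each other, so all \<open>d A\<close> with
  \<open>card A = r\<close> can be chosen independently from the values on smaller sets.\<close>

lemma raising_exists_upto: "\<exists>d. \<forall>A. A \<subseteq> {1..n} \<longrightarrow> card A < r \<longrightarrow> raising d A"
proof (induction r)
  case (Suc r)
  then obtain d where d: "\<And>A. A \<subseteq> {1..n} \<Longrightarrow> card A < r \<Longrightarrow> raising d A" by blast
  have "\<exists>g. raising (d(A := g)) A" if A: "A \<subseteq> {1..n}" "card A = r" for A
  proof -
    interpret filtered_complement G "yl d" "{B. B \<subseteq> {1..n} \<and> card B \<le> card A}" N smul A "Cs A" "shift A" d
      by (rule filtered_complement_yl) (use A d in auto)
    have ne: "j \<in> A \<Longrightarrow> (A - {j} = A) = False" for j by blast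
    show ?thesis
      by (rule ex_forward[OF extension_exists]) (simp add: raising_def G_0_eq yl_def ne cong: conj_cong)
  qed
  then obtain g where g: "\<And>A. A \<subseteq> {1..n} \<Longrightarrow> card A = r \<Longrightarrow> raising (d(A := g A)) A" by metis
  define d' where "d' A = (if card A = r then g A else d A)" for A
  have "raising d' A" if A: "A \<subseteq> {1..n}" "card A < Suc r" for A
  proof -
    have fin: "finite A" using A finite_subset by blast
    have sub: "card (A - {j}) < card A" if "j \<in> A" for j
      using that fin by (intro psubset_card_mono) auto
    show ?thesis
    proof (cases "card A = r")
      case True
      have "d' (A - {j}) = (d(A := g A)) (A - {j})" if "j \<in> A" for j
        using sub[OF that] True that by (auto simp: d'_def)
      then show ?thesis using True by (intro raising_cong[OF g[OF A(1) True]]) (auto simp: d'_def)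
    next
      case False
      then have "card A < r" using A by simp
      moreover have "d' (A - {j}) = d (A - {j})" if "j \<in> A" for j
        using sub[OF that] \<open>card A < r\<close> by (auto simp: d'_def)
      ultimately show ?thesis using False by (intro raising_cong[OF d[OF A(1)]]) (auto simp: d'_def)
    qed
  qed
  then show ?case by blast
qed simp

lemma raising_exists: "\<exists>d. \<forall>A. A \<subseteq> {1..n} \<longrightarrow> raising d A"
proof -
  obtain d where d: "\<And>A. A \<subseteq> {1..n} \<Longrightarrow> card A < Suc n \<Longrightarrow> raising d A"
    using raising_exists_upto by blast
  have "card A < Suc n" if "A \<subseteq> {1..n}" for A using card_mono[OF _ that] by simp
  then show ?thesis using d by blast
qed

end

subsection \<open>The module for one more element\<close>

locale Q_raising = Q_extension n B V C
  for n B and V :: "nat set \<Rightarrow> (nat set list \<Rightarrow> 'f::field) \<Rightarrow> 'f word_fun" and C +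
  fixes d :: "nat set \<Rightarrow> 'f word_fun \<Rightarrow> 'f word_fun"
  assumes raising: "\<And>A. A \<subseteq> {1..n} \<Longrightarrow> raising d A"
begin

interpretation xl: filtered_edges G xl "{A. A \<subseteq> {1..n}}" by (rule filtered_xl)

text \<open>Solves \<open>d A = v (insert N A) - v A\<close> for the new generator, the old ones
  acting through their lifts.\<close>

definition V' :: "nat set \<Rightarrow> 'f word_fun \<Rightarrow> 'f word_fun" where
  "V' A f = (if N \<in> A then lift (V (A - {N})) f + d (A - {N}) f else lift (V A) f)"

text \<open>This is \<open>x (insert N A) j\<close> in the new module, the second perturbation of
  \<open>xl\<close>; see \<open>edge_V'_new\<close>.\<close>

definition zl :: "nat set \<Rightarrow> nat \<Rightarrow> 'f word_fun \<Rightarrow> 'f word_fun" where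
  "zl A j f = xl A j f + d A f - d (A - {j}) f"

lemma N_notin: "A \<subseteq> {1..n} \<Longrightarrow> N \<notin> A" and N_neq: "A \<subseteq> {1..n} \<Longrightarrow> j \<in> A \<Longrightarrow> j \<noteq> N"
  by auto

lemma insert_N_Diff: "A \<subseteq> {1..n} \<Longrightarrow> insert N A - {N} = A"
  and Diff_N: "A \<subseteq> {1..n} \<Longrightarrow> A - {N} = A"
  by auto

lemma edge_V'_old: "N \<notin> A \<Longrightarrow> edge V' A j f = xl A j f"
  by (simp add: edge_def V'_def xl_def)

lemma edge_V'_N: "A \<subseteq> {1..n} \<Longrightarrow> edge V' (insert N A) N f = d A f"
  by (simp add: edge_def V'_def Diff_N N_notin)

lemma edge_V'_new:
  assumes "A \<subseteq> {1..n}" "j \<in> A"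
  shows "edge V' (insert N A) j f = zl A j f"
proof -
  have "insert N A - {j} - {N} = A - {j}" "insert N A - {j} = insert N (A - {j})"
    using assms by auto
  then show ?thesis using assms
    by (simp add: edge_def V'_def Diff_N zl_def xl_def)
qed

text \<open>Moving the term \<open>d A (d (A - {j}) f)\<close> to the other side turns the relation
  with \<open>y\<close> into the defining relation of the new algebra for removing \<open>j\<close>
  and \<open>N\<close> from \<open>insert N A\<close>.\<close>

lemma d_commutes:
  assumes A: "A \<subseteq> {1..n}" and j: "j \<in> A" and f: "f \<in> level B' D"
  shows "d A (xl A j f) = zl A j (d (A - {j}) f)"
proof -
  have Aj: "A - {j} \<subseteq> {1..n}" using A by auto
  have "d A (xl A j f) - d A (d (A - {j}) f) = xl A j (d (A - {j}) f) - d (A - {j}) (d (A - {j}) f)"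
    using d_xl[OF raising[OF A] j f]
      d_diff[OF raising[OF A] xl_closed[OF A f, of j] d_level[OF raising[OF Aj] f]] by simp
  then show ?thesis by (simp add: zl_def algebra_simps)
qed

text \<open>The relations for removing \<open>i\<close> and \<open>j\<close> from
  \<open>insert N A\<close> impose nothing new. The terms with \<open>d A\<close> applied to old
  images collect to \<open>d A\<close> of a telescoping sum, the others telescope at
  \<open>e\<close>, and up to \<open>xl_comm\<close> the outcome is symmetric in \<open>i\<close>
  and \<open>j\<close>.\<close>

lemma zl_zl:
  assumes A: "A \<subseteq> {1..n}" and i: "i \<in> A" and j: "j \<in> A" "i \<noteq> j" and f: "f \<in> level B' D"
  defines "e \<equiv> d (A - {i} - {j}) f"
  shows "zl A i (zl (A - {i}) j f) = xl A i (xl (A - {i}) j f)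
    - (lift (V A) e - lift (V (A - {i} - {j})) e) + d (A - {i} - {j}) e - d A e
    + d A (lift (V A) f - lift (V (A - {i} - {j})) f)"
proof -
  have Ai: "A - {i} \<subseteq> {1..n}" and Aij: "A - {i} - {j} \<subseteq> {1..n}" using A by auto
  note rA = raising[OF A] and rAi = raising[OF Ai]
  define h where "h = d (A - {i}) f"
  define x where "x = xl (A - {i}) j f"
  have e: "e \<in> level B' (Suc D)" unfolding e_def by (rule d_level[OF raising[OF Aij] f])
  have h: "h \<in> level B' (Suc D)" unfolding h_def by (rule d_level[OF rAi f])
  have x: "x \<in> level B' (Suc D)" unfolding x_def by (rule xl_closed[OF Ai f])
  have z: "zl (A - {i}) j f = x + h - e" by (simp add: zl_def x_def h_def e_def)
  have xh: "x + h \<in> level B' (Suc D)" by (rule level_add[OF x h])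
  have 1: "xl A i (x + h - e) = xl A i x + xl A i h - xl A i e"
    using xl_diff[OF A xh e, of i] xl.Y_add[of A i x "Suc D" h] A i x h by (simp add: G_0_eq)
  have 2: "d A (x + h - e) = d A x + d A h - d A e"
    using d_diff[OF rA xh e] d_add[OF rA x h] by simp
  have 3: "d (A - {i}) (x + h - e) = d (A - {i}) x + d (A - {i}) h - d (A - {i}) e"
    using d_diff[OF rAi xh e] d_add[OF rAi x h] by simp
  have 4: "d (A - {i}) x = xl (A - {i}) j e + d (A - {i}) e - d (A - {i} - {j}) e"
    using d_commutes[OF Ai _ f, of j] j by (simp add: x_def e_def zl_def)
  have 5: "d A (xl A i f) = xl A i h + d A h - d (A - {i}) h"
    using d_commutes[OF A i f] by (simp add: h_def zl_def)
  have 6: "d A (xl A i f) + d A x = d A (lift (V A) f - lift (V (A - {i} - {j})) f)"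
    unfolding xl_chain[symmetric] x_def by (rule d_add[OF rA xl_closed[OF A f] xl_closed[OF Ai f], symmetric])
  have "zl A i (zl (A - {i}) j f) = xl A i x - (xl A i e + xl (A - {i}) j e) + d (A - {i} - {j}) e - d A e
      + (d A (xl A i f) + d A x)"
    unfolding z zl_def[of A i] 1 2 3 4 5 by (simp add: algebra_simps)
  then show ?thesis unfolding 6 xl_chain unfolding x_def .
qed

lemma zl_comm:
  assumes "A \<subseteq> {1..n}" "i \<in> A" "j \<in> A" "i \<noteq> j" "f \<in> level B' D"
  shows "zl A i (zl (A - {i}) j f) = zl A j (zl (A - {j}) i f)"
  unfolding zl_zl[OF assms] zl_zl[OF assms(1,3,2) assms(4)[symmetric] assms(5)]
    xl_comm[OF assms] minus_swap[of A j i] ..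

lemma zl_xl_G:
  assumes A: "A \<subseteq> {1..n}" and f: "f \<in> G D p"
  shows "zl A j f - xl A j f \<in> G (Suc D) (Suc p)"
proof -
  have "d A f - d (A - {j}) f \<in> G (Suc D) (Suc p)"
    using A by (intro xl.G_diff d_G[OF raising] f) auto
  then show ?thesis by (simp add: zl_def)
qed

lemma zl_diff:
  assumes "A \<subseteq> {1..n}" "f \<in> level B' D" "g \<in> level B' D"
  shows "zl A j (f - g) = zl A j f - zl A j g"
proof -
  have "A - {j} \<subseteq> {1..n}" using assms by auto
  then show ?thesis
    using xl_diff[OF assms, of j] d_diff[OF raising[OF assms(1)] assms(2,3)]
      d_diff[OF raising, of "A - {j}" f D g] assms(2,3) by (simp add: zl_def)
qed

lemma filtered_zl: "filtered_edges G zl {A. A \<subseteq> {1..n}}"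
  by (rule perturbation) (auto intro!: zl_diff zl_xl_G zl_comm)

interpretation zl: filtered_edges G zl "{A. A \<subseteq> {1..n}}" by (rule filtered_zl)

text \<open>Makes the decomposition \<open>span\<close> available for the operators
  \<open>xl\<close>; the prescription is the zero operator, which meets the intertwining
  conditions.\<close>

lemma complement_xl:
  assumes A: "A \<subseteq> {1..n}"
  shows "filtered_complement G xl {A. A \<subseteq> {1..n}} N smul A (Cs A) (\<lambda>_. 0) (\<lambda>_ _. 0)"
proof
  show "A \<in> {A. A \<subseteq> {1..n}}" "A \<subseteq> {..<N}" using A by auto
  show "f \<in> G D 0 \<Longrightarrow> f \<in> G D' 0 \<Longrightarrow> f \<noteq> 0 \<Longrightarrow> D = D'" for f D D'
    unfolding G_0_eq by (rule level_unique)
  show "0 \<in> Cs A D" "Cs A D \<subseteq> G D 0" for D by (auto simp: Cs_def G_def)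
  show "f \<in> G (Suc D) p \<Longrightarrow> \<exists>m c. (\<forall>j. m j \<in> G D p) \<and> c \<in> Cs A (Suc D) \<and>
        c \<in> G (Suc D) p \<and> f - (edge_sum xl A N m + c) \<in> G (Suc D) (Suc p)" for f D p
    by (rule xl_span[OF A])
  show "(\<And>j. m j \<in> G D p) \<Longrightarrow> c \<in> Cs A (Suc D) \<Longrightarrow> c \<in> G (Suc D) p \<Longrightarrow>
        edge_sum xl A N m + c \<in> G (Suc D) (Suc p) \<Longrightarrow> c \<in> G (Suc D) (Suc p)" for m c D p
    by (rule xl_direct[OF A])
  show "j \<in> A \<Longrightarrow> f \<in> G D 0 \<Longrightarrow> xl A j (smul a f) = smul a (xl A j f)" for j a f D
    unfolding G_0_eq by (rule xl_smul[OF A])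
  show "(\<lambda>_. 0) (smul a f) = smul a ((\<lambda>_. 0) f)" for a and f :: "'f word_fun"
    by (simp add: smul_def fun_eq_iff)
  show "(\<lambda>_ _. 0) (A - {j}) (smul a f) = smul a ((\<lambda>_ _. 0) (A - {j}) f)" for j a and f :: "'f word_fun"
    by (simp add: smul_def fun_eq_iff)
  show "(\<lambda>_ _. 0) (A - {j}) (xl (A - {j}) k f) = xl (A - {j}) k ((\<lambda>_ _. 0) (A - {j} - {k}) f)"
    if "k \<in> A" "k \<noteq> j" for j k f
    using xl.Y_zero[of "A - {j}" k] that A by auto
qed (use Cs_diff Cs_smul smul_add G_smul xl.G_zero in auto)

lemma edge_V_Nil:
  assumes A: "A \<subseteq> {1..n}" and f: "f \<in> level B D"
  shows "edge V A j f [] = 0"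
proof (rule ccontr)
  assume "edge V A j f [] \<noteq> 0"
  then have "D = 0" using edge_closed[OF A f, of j] by (auto simp: level_def)
  then have "f = 0" using f level_0 by simp
  then show False using \<open>edge V A j f [] \<noteq> 0\<close> edge_zero[OF A] by simp
qed

text \<open>Leading terms cannot cancel. In a slice, \<open>shift A c\<close> is supported on the
  empty word, because a nonempty word of \<open>B\<close> does not start with a letter containing
  \<open>N\<close>; images of the old operators have no coefficient there. So \<open>c\<close> is
  forced ever deeper into a bounded filtration.\<close>

lemma shift_independent:
  assumes A: "A \<subseteq> {1..n}" and c: "c \<in> Cs A D" and m: "\<And>j. m j \<in> level B' D"
    and eq: "shift A c + edge_sum zl A N m = 0"
  shows "c = 0"
proof -
  have c0: "c \<in> G D 0" and m0: "\<And>j. m j \<in> G D 0" using c m by (auto simp: G_0_eq Cs_def)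
  have "shift A c \<in> G (Suc D) p" for p
  proof (induction p)
    case 0
    then show ?case using shift_G[OF A c c0] xl.G_0 by blast
  next
    case (Suc p)
    have "edge_sum zl A N m = 0 - shift A c" using eq by (simp add: add_eq_0_iff)
    then have "edge_sum zl A N m \<in> G (Suc D) p" using xl.G_diff[OF xl.G_zero Suc] by simp
    then obtain v where v: "\<And>j. v j \<in> G D p" and vs: "edge_sum zl A N v = edge_sum zl A N m"
      using zl.strict[of A m D N p] A m0 by blast
    have "edge_sum zl A N v - edge_sum xl A N v \<in> G (Suc D) (Suc p)"
      by (rule edge_sum_perturb[where Y = zl, OF A v zl_xl_G[OF A]])
    moreover have "0 - (edge_sum zl A N v - edge_sum xl A N v) = shift A c + edge_sum xl A N v"
      using eq unfolding vs by (simp add: add_eq_0_iff2)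
    ultimately have s: "shift A c + edge_sum xl A N v \<in> G (Suc D) (Suc p)"
      using xl.G_diff[OF xl.G_zero] by metis
    show ?case
    proof (rule G_SucI[OF Suc])
      fix t assume t: "t \<in> tails" "cnt t = p"
      have v': "\<And>j. v j \<in> level B' D" using v G_level by blast
      have sl: "slice (shift A c) t + edge_sum (edge V) A N (\<lambda>j. slice (v j) t) = 0"
        using G_slice[OF s t(2)] slice_edge_sum_xl[OF A v' t(1)] by (simp add: slice_add)
      \<comment> \<open>The operators \<open>edge V\<close> lengthen words by one, so no image has a
        coefficient at the empty word.\<close>
      have nil: "edge_sum (edge V) A N (\<lambda>j. slice (v j) t) [] = 0"
        unfolding edge_sum_def sum_fun_apply
        by (intro sum.neutral ballI edge_V_Nil[OF A slice_level[OF v']])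
      show "slice (shift A c) t = 0"
      proof
        fix b
        show "slice (shift A c) t b = 0 b"
        proof (cases "b = []")
          case True
          then show ?thesis using fun_cong[OF sl, of "[]"] nil by simp
        next
          case False
          then obtain Z b' where b: "b = Z # b'" by (cases b) auto
          then have "b \<in> B \<Longrightarrow> N \<notin> Z" using B_not_N[of b Z] by simp
          then show ?thesis by (auto simp: slice_def shift_def b)
        qed
      qed
    qed
  qed
  then have "shift A c = 0" using xl.G_bound by blast
  then have "shift A c (insert N A # v) = 0" for v by simp
  then have "c v = 0" for v by (simp add: shift_def)
  then show "c = 0" by auto
qed

lemma insert_N_cases:
  assumes "A \<subseteq> {1..N}"
  obtains "A \<subseteq> {1..n}" "N \<notin> A" | A0 where "A0 \<subseteq> {1..n}" "A = insert N A0"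
proof (cases "N \<in> A")
  case True
  then have "A - {N} \<subseteq> {1..n}" "A = insert N (A - {N})" using assms by (auto simp: le_Suc_eq)
  then show ?thesis by (rule that(2))
next
  case False
  then have "A \<subseteq> {1..n}" using assms by (force simp: le_Suc_eq)
  then show ?thesis using that(1) False by blast
qed

lemma V'_insert: "A \<subseteq> {1..n} \<Longrightarrow> V' (insert N A) f = lift (V A) f + d A f"
  by (simp add: V'_def Diff_N)

lemma V'_old: "N \<notin> A \<Longrightarrow> V' A f = lift (V A) f"
  by (simp add: V'_def)

text \<open>For \<open>k < N\<close> this is regularity of \<open>xl\<close> or \<open>zl\<close>.
  For \<open>k = N\<close> the last component is split into images under \<open>xl\<close> and a
  part in the complement; \<open>d_commutes\<close> carries the images into the remaining sum, and
  \<open>shift_independent\<close> kills the complement part.\<close>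

lemma V'_regular:
  assumes A: "A \<subseteq> {1..N}" and k: "k \<in> A" and m: "\<And>j. m j \<in> level B' (Suc D)"
    and eq: "edge_sum (edge V') A (Suc k) m = 0"
  shows "\<exists>u. (\<forall>j. u j \<in> level B' D) \<and> m k = edge_sum (edge V') (A - {k}) k u"
  using A
proof (cases rule: insert_N_cases)
  case 1
  have "edge_sum xl A (Suc k) m = 0" using eq 1 by (simp add: edge_sum_def edge_V'_old)
  then obtain u where "\<forall>j. u j \<in> level B' D" "m k = edge_sum xl (A - {k}) k u"
    using xl.regular[of A k m D] 1 k m by (auto simp: G_0_eq)
  then show ?thesis using 1 by (intro exI[of _ u]) (simp add: edge_sum_def edge_V'_old)
next
  case (2 A0)
  \<comment> \<open>\<open>N\<close> is the largest element, so a sum cut off at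
    \<open>k \<le> N\<close> does not contain it.\<close>
  have new: "edge_sum (edge V') (insert N E) k u = edge_sum zl E k u" if "E \<subseteq> {1..n}" "k \<le> N" for u E k
  proof -
    have "insert N E \<inter> {..<k} = E \<inter> {..<k}" using that by auto
    then show ?thesis using that by (auto simp: edge_sum_def edge_V'_new intro!: sum.cong)
  qed
  show ?thesis
  proof (cases "k = N")
    case True
    have ins: "edge_sum (edge V') (insert N A0) (Suc N) m = d A0 (m N) + edge_sum zl A0 N m"
      unfolding edge_sum_Suc[of _ _ N] new[OF 2(1) order_refl] edge_V'_N[OF 2(1)] by simp
    interpret C: filtered_complement G xl "{A. A \<subseteq> {1..n}}" N smul A0 "Cs A0" "\<lambda>_. 0" "\<lambda>_ _. 0"
      by (rule complement_xl[OF 2(1)])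
    obtain u c where u: "\<And>j. u j \<in> level B' D" and c: "c \<in> Cs A0 (Suc D)"
      and mN: "m N = edge_sum xl A0 N u + c"
      using C.span[of "m N" D 0] m by (auto simp: G_0_eq)
    have c': "c \<in> level B' (Suc D)" using c by (simp add: Cs_def)
    \<comment> \<open>These are the components that \<open>d A0\<close> produces from the image
      part, by \<open>d_commutes\<close>.\<close>
    define v where "v j = (if j \<in> A0 then d (A0 - {j}) (u j) else 0)" for j
    have v: "v j \<in> level B' (Suc D)" for j
    proof (cases "j \<in> A0")
      case True
      have "raising d (A0 - {j})" using 2(1) by (intro raising) auto
      then show ?thesis using d_level[OF _ u] True by (simp add: v_def)
    qed (simp add: v_def)
    have xu: "xl A0 j (u j) \<in> level B' (Suc D)" for j by (rule xl_closed[OF 2(1) u])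
    have "d A0 (\<Sum>j\<in>S. xl A0 j (u j)) = (\<Sum>j\<in>S. d A0 (xl A0 j (u j)))" for S
    proof (induction S rule: infinite_finite_induct)
      case (infinite S)
      show ?case unfolding sum.infinite[OF infinite] by (rule d_0[OF raising[OF 2(1)]])
    next
      case (insert x F)
      have "(\<Sum>j\<in>F. xl A0 j (u j)) \<in> level B' (Suc D)" by (rule level_sum) (rule xu)
      then show ?case unfolding sum.insert[OF insert(1,2)]
        by (simp only: d_add[OF raising[OF 2(1)] xu] insert.IH)
    qed (simp only: sum.empty d_0[OF raising[OF 2(1)]])
    then have "d A0 (edge_sum xl A0 N u) = edge_sum zl A0 N v"
      unfolding edge_sum_def using 2(1) u by (auto simp: v_def d_commutes[of _ _ _ D] intro!: sum.cong)
    moreover have "edge_sum xl A0 N u \<in> level B' (Suc D)" unfolding edge_sum_def by (rule level_sum[OF xu])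
    ultimately have "d A0 (m N) = edge_sum zl A0 N v + shift A0 c"
      unfolding mN using d_add[OF raising[OF 2(1)] _ c'] d_shift[OF raising[OF 2(1)] c] by simp
    then have "edge_sum zl A0 N v + shift A0 c + edge_sum zl A0 N m = 0"
      using eq ins True 2(2) by simp
    moreover have "edge_sum zl A0 N (\<lambda>j. v j + m j) = edge_sum zl A0 N v + edge_sum zl A0 N m"
      using 2(1) v m by (intro zl.edge_sum_add[of _ _ "Suc D"]) (auto simp: G_0_eq)
    ultimately have "shift A0 c + edge_sum zl A0 N (\<lambda>j. v j + m j) = 0" by (simp add: algebra_simps)
    then have "c = 0" by (rule shift_independent[OF 2(1) c level_add[OF v m]])
    then have "m k = edge_sum (edge V') (A - {k}) k u"
      using mN True 2 by (simp add: Diff_N edge_sum_def edge_V'_old N_notin)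
    then show ?thesis using u by blast
  next
    case False
    then have k0: "k \<in> A0" "k \<le> n" using k 2 by auto
    have sub: "A - {k} = insert N (A0 - {k})" using 2 False by auto
    have "edge_sum zl A0 (Suc k) m = 0" using eq new[of A0 "Suc k" m] 2 k0 by simp
    then obtain u where "\<forall>j. u j \<in> level B' D" "m k = edge_sum zl (A0 - {k}) k u"
      using zl.regular[of A0 k m D] 2 k0 m by (auto simp: G_0_eq)
    moreover have "A0 - {k} \<subseteq> {1..n}" using 2 by auto
    ultimately show ?thesis using new[of "A0 - {k}" k u] k0 sub by (intro exI[of _ u]) simp
  qed
qed

lemma slice_unit_vec:
  assumes "b \<in> B" "t \<in> tails" "s \<in> tails"
  shows "slice (unit_vec (b @ t)) s = (if s = t then unit_vec b else 0)"
proof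
  fix a
  have "a @ s = b @ t \<longleftrightarrow> a = b \<and> s = t" if "a \<in> B"
    using that assms pre_append suf_append by metis
  then show "slice (unit_vec (b @ t)) s a = (if s = t then unit_vec b else 0) a"
    using assms by (auto simp: slice_def unit_vec_def)
qed

lemma unit_vec_level: "w \<in> B' \<Longrightarrow> unit_vec w \<in> level B' (Suc (length w))"
  by (auto simp: level_def unit_vec_def)

text \<open>If the first letter contains \<open>N\<close>, the rest lies in \<open>Cs A\<close>,
  where \<open>d A\<close> merely prefixes that letter. Otherwise the letter belongs to the old
  prefix, and the old property is used in a single slice.\<close>

lemma V'_word:
  assumes "Z # w \<in> B'"
  shows "w \<in> B' \<and> edge V' Z (Max Z) (unit_vec w) = unit_vec (Z # w)"
proof -
  obtain b t where bt: "Z # w = b @ t" "b \<in> B" "t \<in> tails" using assms by (auto simp: B'_def)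
  show ?thesis
  proof (cases b)
    case Nil
    then obtain A c s where A: "A \<subseteq> {1..n}" and c: "c \<in> C A" and s: "s \<in> tails" and eq: "Z = insert N A" "w = c @ s"
      using bt by (cases rule: tails.cases[OF bt(3)]) auto
    have cB: "c \<in> B" using c C_B by blast
    then have w: "w \<in> B'" using eq s append_B'_iff by blast
    have fin: "finite A" using A finite_subset by blast
    have "Max Z = N" unfolding eq
      by (rule Max_eqI) (use A fin in \<open>auto intro: le_SucI\<close>)
    moreover have "unit_vec w \<in> Cs A (Suc (length w))"
      using unit_vec_level[OF w] c eq pre_append[OF cB s] by (auto simp: Cs_def unit_vec_def)
    then have "d A (unit_vec w) = shift A (unit_vec w)" by (rule d_shift[OF raising[OF A]])
    moreover have "shift A (unit_vec w) = unit_vec (Z # w)"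
      by (auto simp: shift_def unit_vec_def eq fun_eq_iff split: list.split)
    ultimately show ?thesis using w edge_V'_N[OF A] eq(1) by simp
  next
    case (Cons Z' b')
    then have b: "b = Z # b'" and w: "w = b' @ t" using bt by auto
    have b': "b' \<in> B" and eb: "edge V Z (Max Z) (unit_vec b') = unit_vec b"
      using V_word[of Z b'] bt(2) b by auto
    have w': "w \<in> B'" using w b' bt append_B'_iff by blast
    have Z: "Z \<subseteq> {1..n}" using B_words[OF bt(2)] b by (auto simp: generators_def)
    have NZ: "N \<notin> Z" using B_not_N[OF bt(2)] b by simp
    have "xl Z (Max Z) (unit_vec w) = unit_vec (Z # w)"
    proof (rule slice_eqI)
      show "xl Z (Max Z) (unit_vec w) \<in> level B' (Suc (Suc (length w)))"
        by (rule xl_closed[OF Z unit_vec_level[OF w']])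
      show "unit_vec (Z # w) \<in> level B' (Suc (Suc (length w)))"
        using unit_vec_level[OF assms] by simp
      fix s assume s: "s \<in> tails"
      show "slice (xl Z (Max Z) (unit_vec w)) s = slice (unit_vec (Z # w)) s"
        unfolding slice_xl[OF Z unit_vec_level[OF w'] s] bt(1)
        unfolding w slice_unit_vec[OF b' bt(3) s] slice_unit_vec[OF bt(2,3) s]
        using eb edge_zero[OF Z] by simp
    qed
    then show ?thesis using w' edge_V'_old[OF NZ] by simp
  qed
qed

lemma Q_model_V': "Q_model N B' V'"
proof
  fix w assume "w \<in> B'"
  then obtain b t where "w = b @ t" "b \<in> B" "t \<in> tails" by (auto simp: B'_def)
  moreover have "generators n \<subseteq> generators N" by (auto simp: generators_def)
  ultimately show "set w \<subseteq> generators N" using B_words tails_words by fastforce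
next
  show "[] \<in> B'" using Nil_B tails_Nil append_B'_iff[of "[]" "[]"] by simp
next
  fix A D and f g :: "'f word_fun" assume "A \<subseteq> {1..N}" and f: "f \<in> level B' D" and g: "g \<in> level B' D"
  then show "V' A (f - g) = V' A f - V' A g"
    using lift_V_diff[OF _ f g] d_diff[OF raising f g]
    by (cases rule: insert_N_cases) (auto simp: V'_old V'_insert)
next
  fix A D a and f :: "'f word_fun" assume "A \<subseteq> {1..N}" and f: "f \<in> level B' D"
  then show "V' A (smul a f) = smul a (V' A f)"
    using lift_V_smul[OF _ f] d_smul[OF raising f]
    by (cases rule: insert_N_cases) (auto simp: V'_old V'_insert smul_add)
next
  fix A D and f :: "'f word_fun" assume "A \<subseteq> {1..N}" and f: "f \<in> level B' D"
  then show "V' A f \<in> level B' (Suc D)"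
    using lift_V_closed[OF _ f] d_level[OF raising f]
    by (cases rule: insert_N_cases) (auto simp: V'_old V'_insert intro!: level_add)
next
  show "V' {} f = 0" for f by (simp add: V'_old lift_V_empty)
next
  fix A i j D and f :: "'f word_fun" assume "A \<subseteq> {1..N}" and ij: "i \<in> A" "j \<in> A" "i \<noteq> j" and f: "f \<in> level B' D"
  then show "edge V' A i (edge V' (A - {i}) j f) = edge V' A j (edge V' (A - {j}) i f)"
  proof (cases rule: insert_N_cases)
    case 1
    then show ?thesis using xl_comm[OF _ ij f] by (simp add: edge_V'_old)
  next
    case (2 A0)
    have *: "edge V' A j (edge V' (A - {j}) N f) = edge V' A N (edge V' (A - {N}) j f)" if j: "j \<in> A0" for j
    proof -
      have "A - {j} = insert N (A0 - {j})" "A0 - {j} \<subseteq> {1..n}" "j \<noteq> N" using 2 j N_notin by auto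
      then show ?thesis
        using 2 j d_commutes[OF 2(1) j f] by (simp add: edge_V'_N edge_V'_new Diff_N edge_V'_old N_notin)
    qed
    consider "i = N" "j \<in> A0" | "j = N" "i \<in> A0" | "i \<in> A0" "j \<in> A0" using ij 2 by auto
    then show ?thesis
    proof cases
      case 3
      have "A - {i} = insert N (A0 - {i})" "A - {j} = insert N (A0 - {j})"
        "A0 - {i} \<subseteq> {1..n}" "A0 - {j} \<subseteq> {1..n}"
        using 2 3 N_notin by auto
      then show ?thesis using 2 3 ij zl_comm[OF 2(1) 3 ij(3) f] by (simp add: edge_V'_new)
    qed (use * in simp_all)
  qed
next
  show "A \<subseteq> {1..N} \<Longrightarrow> k \<in> A \<Longrightarrow> (\<And>j. m j \<in> level B' (Suc D)) \<Longrightarrow>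
        edge_sum (edge V') A (Suc k) m = 0 \<Longrightarrow>
        \<exists>u. (\<forall>j. u j \<in> level B' D) \<and> m k = edge_sum (edge V') (A - {k}) k u" for A k m D
    by (rule V'_regular)
  show "Z # w \<in> B' \<Longrightarrow> w \<in> B' \<and> edge V' Z (Max Z) (unit_vec w) = unit_vec (Z # w)" for Z w
    by (rule V'_word)
qed

end

section \<open>Evaluation of word functions at a vector\<close>

lemma smul_0 [simp]: "smul 0 f = 0" and smul_zero [simp]: "smul a 0 = 0" and smul_1 [simp]: "smul 1 f = f"
  by (simp_all add: smul_def fun_eq_iff)

lemma smul_add_left: "smul (a + b) f = smul a f + smul b f"
  by (simp add: smul_def fun_eq_iff algebra_simps)

lemma smul_diff_left: "smul (a - b) f = smul a f - smul b f"
  by (simp add: smul_def fun_eq_iff algebra_simps)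

lemma smul_smul: "smul a (smul b f) = smul (a * b) f"
  by (simp add: smul_def fun_eq_iff algebra_simps)

primrec word_act :: "(nat set \<Rightarrow> 'v \<Rightarrow> 'v::ab_group_add) \<Rightarrow> nat set list \<Rightarrow> 'v \<Rightarrow> 'v" where
  "word_act L [] z = z"
| "word_act L (Z # w) z = edge L Z (Max Z) (word_act L w z)"

lemma word_act_append: "word_act L (v @ w) z = word_act L v (word_act L w z)"
  by (induction v) auto

text \<open>The only candidate for a homomorphism that sends \<open>[]\<close> to \<open>z\<close>:
  by \<open>V_word\<close> a basis word is obtained from \<open>[]\<close> by the operators that
  \<open>word_act\<close> applies to \<open>z\<close>.\<close>

definition ev :: "(nat set \<Rightarrow> ('x \<Rightarrow> 'f) \<Rightarrow> 'x \<Rightarrow> 'f) \<Rightarrow> (nat set list \<Rightarrow> 'f::field) \<Rightarrow> ('x \<Rightarrow> 'f) \<Rightarrow> 'x \<Rightarrow> 'f" where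
  "ev L f z = (\<Sum>w | f w \<noteq> 0. smul (f w) (word_act L w z))"

lemma ev_eq:
  assumes "finite W" "\<And>w. f w \<noteq> 0 \<Longrightarrow> w \<in> W"
  shows "ev L f z = (\<Sum>w\<in>W. smul (f w) (word_act L w z))"
  unfolding ev_def by (rule sum.mono_neutral_left) (use assms in auto)

lemma ev_0 [simp]: "ev L 0 z = 0"
  by (simp add: ev_def)

lemma ev_unit_vec: "ev L (unit_vec w) z = word_act L w z"
  by (subst ev_eq[of "{w}"]) (auto simp: unit_vec_def split: if_splits)

lemma finite_words: "finite {w. set w \<subseteq> generators n \<and> length w \<le> D}"
  by (rule finite_lists_length_le) (simp add: generators_def)

definition word_supp :: "nat \<Rightarrow> nat \<Rightarrow> (nat set list \<Rightarrow> 'f::field) set" where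
  "word_supp n D = {f. \<forall>w. f w \<noteq> 0 \<longrightarrow> set w \<subseteq> generators n \<and> length w \<le> D}"

lemma ev_diff:
  assumes "f \<in> word_supp n D" "g \<in> word_supp n D"
  shows "ev L (f - g) z = ev L f z - ev L g z"
proof -
  note ev = ev_eq[OF finite_words[of n D], of _ L z]
  have "(f - g) w \<noteq> 0 \<Longrightarrow> f w \<noteq> 0 \<or> g w \<noteq> 0" for w by auto
  then show ?thesis using assms
    by (subst ev, force simp: word_supp_def) (simp add: ev word_supp_def smul_diff_left sum_subtractf)
qed

subsection \<open>The universal property\<close>

text \<open>
  \<open>M\<close> modulo \<open>I\<close> is a left module over \<open>Q\<^sub>n\<close>, with \<open>v A\<close> acting as \<open>L A\<close>; quotients are avoided by
  working up to elements of \<open>I\<close>.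
\<close>

locale Q_rep =
  fixes n :: nat and L :: "nat set \<Rightarrow> ('x \<Rightarrow> 'f::field) \<Rightarrow> 'x \<Rightarrow> 'f" and M I :: "('x \<Rightarrow> 'f) set"
  assumes I_zero: "0 \<in> I" and I_diff: "\<And>f g. f \<in> I \<Longrightarrow> g \<in> I \<Longrightarrow> f - g \<in> I"
    and I_smul: "\<And>a f. f \<in> I \<Longrightarrow> smul a f \<in> I"
    and M_zero: "0 \<in> M" and M_diff: "\<And>f g. f \<in> M \<Longrightarrow> g \<in> M \<Longrightarrow> f - g \<in> M"
    and M_smul: "\<And>a f. f \<in> M \<Longrightarrow> smul a f \<in> M"
    and L_diff: "\<And>A f g. L A (f - g) = L A f - L A g"
    and L_smul: "\<And>A a f. L A (smul a f) = smul a (L A f)"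
    and L_M: "\<And>A f. A \<subseteq> {1..n} \<Longrightarrow> f \<in> M \<Longrightarrow> L A f \<in> M"
    and L_I: "\<And>A f. A \<subseteq> {1..n} \<Longrightarrow> f \<in> I \<Longrightarrow> L A f \<in> I"
    and L_empty: "\<And>f. L {} f = 0"
    and L_comm: "\<And>A i j f. A \<subseteq> {1..n} \<Longrightarrow> i \<in> A \<Longrightarrow> j \<in> A \<Longrightarrow> i \<noteq> j \<Longrightarrow> f \<in> M \<Longrightarrow>
        edge L A i (edge L (A - {i}) j f) - edge L A j (edge L (A - {j}) i f) \<in> I"
begin

definition cong (infix \<open>\<asymp>\<close> 50) where "f \<asymp> g \<longleftrightarrow> f - g \<in> I"

lemma I_add: "f \<in> I \<Longrightarrow> g \<in> I \<Longrightarrow> f + g \<in> I"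
  using I_diff[of f "0 - g"] I_diff[of 0 g] I_zero by simp

lemma cong_refl [simp]: "f \<asymp> f"
  by (simp add: cong_def I_zero)

lemma cong_sym: "f \<asymp> g \<Longrightarrow> g \<asymp> f"
  using I_diff[of 0 "f - g"] I_zero by (simp add: cong_def)

lemma cong_trans [trans]: "f \<asymp> g \<Longrightarrow> g \<asymp> h \<Longrightarrow> f \<asymp> h"
  using I_add[of "f - g" "g - h"] by (simp add: cong_def)

lemma eq_cong_trans [trans]: "f = g \<Longrightarrow> g \<asymp> h \<Longrightarrow> f \<asymp> h"
  and cong_eq_trans [trans]: "f \<asymp> g \<Longrightarrow> g = h \<Longrightarrow> f \<asymp> h"
  by simp_all

lemma cong_add: "f \<asymp> g \<Longrightarrow> f' \<asymp> g' \<Longrightarrow> f + f' \<asymp> g + g'"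
  using I_add[of "f - g" "f' - g'"] by (simp add: cong_def algebra_simps)

lemma cong_diff: "f \<asymp> g \<Longrightarrow> f' \<asymp> g' \<Longrightarrow> f - f' \<asymp> g - g'"
  using I_diff[of "f - g" "f' - g'"] by (simp add: cong_def algebra_simps)

lemma cong_smul: "f \<asymp> g \<Longrightarrow> smul a f \<asymp> smul a g"
  using I_smul[of "f - g" a] by (simp add: cong_def smul_diff)

lemma cong_sum: "(\<And>i. i \<in> S \<Longrightarrow> f i \<asymp> g i) \<Longrightarrow> (\<Sum>i\<in>S. f i) \<asymp> (\<Sum>i\<in>S. g i)"
proof (induction S rule: infinite_finite_induct)
  case (insert x F)
  then show ?case unfolding sum.insert[OF insert(1,2)] by (intro cong_add) auto
qed simp_all

lemma L_0: "L A 0 = 0"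
  using L_diff[of A 0 0] by simp

lemma L_add: "L A (f + g) = L A f + L A g"
  using L_diff[of A f "0 - g"] L_diff[of A 0 g] L_0[of A] by simp

lemma edge_L_diff: "edge L A j (f - g) = edge L A j f - edge L A j g"
  by (simp add: edge_def L_diff)

lemma edge_L_add: "edge L A j (f + g) = edge L A j f + edge L A j g"
  by (simp add: edge_def L_add)

lemma L_sum: "L A (\<Sum>i\<in>S. f i) = (\<Sum>i\<in>S. L A (f i))"
proof (induction S rule: infinite_finite_induct)
  case (infinite S)
  show ?case unfolding sum.infinite[OF infinite] by (rule L_0)
next
  case (insert x F)
  show ?case unfolding sum.insert[OF insert(1,2)] L_add insert.IH ..
qed (simp only: sum.empty L_0)

lemma L_cong: "A \<subseteq> {1..n} \<Longrightarrow> f \<asymp> g \<Longrightarrow> L A f \<asymp> L A g"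
  using L_I[of A "f - g"] by (simp add: cong_def L_diff)

lemma edge_L_cong: "A \<subseteq> {1..n} \<Longrightarrow> f \<asymp> g \<Longrightarrow> edge L A j f \<asymp> edge L A j g"
  unfolding edge_def by (intro cong_diff L_cong) auto

lemma edge_L_M: "A \<subseteq> {1..n} \<Longrightarrow> f \<in> M \<Longrightarrow> edge L A j f \<in> M"
  unfolding edge_def by (intro M_diff L_M) auto

lemma M_add: "f \<in> M \<Longrightarrow> g \<in> M \<Longrightarrow> f + g \<in> M"
  using M_diff[of f "0 - g"] M_diff[of 0 g] M_zero by simp

lemma M_sum: "(\<And>i. i \<in> S \<Longrightarrow> f i \<in> M) \<Longrightarrow> (\<Sum>i\<in>S. f i) \<in> M"
proof (induction S rule: infinite_finite_induct)
  case (insert x F)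
  then show ?case unfolding sum.insert[OF insert(1,2)] by (intro M_add) auto
qed (simp_all add: M_zero)

lemma word_act_M: "set w \<subseteq> generators n \<Longrightarrow> z \<in> M \<Longrightarrow> word_act L w z \<in> M"
  by (induction w) (auto simp: generators_def intro!: edge_L_M)

lemma ev_M: "f \<in> word_supp n D \<Longrightarrow> z \<in> M \<Longrightarrow> ev L f z \<in> M"
  unfolding ev_def by (intro M_sum M_smul word_act_M) (auto simp: word_supp_def)

end

text \<open>Says that evaluation is a module homomorphism into \<open>M\<close> modulo
  \<open>I\<close>, so the model is free on \<open>[]\<close>. The base point \<open>z\<close> has
  to vary, because the extension step evaluates slices at \<open>word_act L t z\<close>. The target
  uses word functions as well, the type in which the free algebra lives.\<close>

definition universal :: "nat \<Rightarrow> nat set list set \<Rightarrow> (nat set \<Rightarrow> (nat set list \<Rightarrow> 'f::field) \<Rightarrow> 'f word_fun) \<Rightarrow> bool" where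
  "universal n B V \<longleftrightarrow> (\<forall>(L :: nat set \<Rightarrow> 'f word_fun \<Rightarrow> 'f word_fun) M I. Q_rep n L M I \<longrightarrow>
     (\<forall>A D f z. A \<subseteq> {1..n} \<longrightarrow> f \<in> level B D \<longrightarrow> z \<in> M \<longrightarrow> ev L (V A f) z - L A (ev L f z) \<in> I))"

context Q_model
begin

lemma level_word_supp: "f \<in> level B D \<Longrightarrow> f \<in> word_supp n D"
  using B_words by (auto simp: level_def word_supp_def)

end

locale Q_extension_rep = Q_raising n B V C d + R: Q_rep "Suc n" L M I
  for n B and V :: "nat set \<Rightarrow> (nat set list \<Rightarrow> 'f::field) \<Rightarrow> 'f word_fun" and C d
    and L :: "nat set \<Rightarrow> 'f word_fun \<Rightarrow> 'f word_fun" and M I +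
  assumes univ: "universal n B V"
begin

notation R.cong (infix \<open>\<asymp>\<close> 50)

interpretation B': Q_model N B' V' by (rule Q_model_V')

lemma rep_restrict: "Q_rep n L M I"
proof
  show "A \<subseteq> {1..n} \<Longrightarrow> f \<in> M \<Longrightarrow> L A f \<in> M" for A f by (rule R.L_M) auto
  show "A \<subseteq> {1..n} \<Longrightarrow> f \<in> I \<Longrightarrow> L A f \<in> I" for A f by (rule R.L_I) auto
  show "A \<subseteq> {1..n} \<Longrightarrow> i \<in> A \<Longrightarrow> j \<in> A \<Longrightarrow> i \<noteq> j \<Longrightarrow> f \<in> M \<Longrightarrow>
        edge L A i (edge L (A - {i}) j f) - edge L A j (edge L (A - {j}) i f) \<in> I" for A i j f
    by (rule R.L_comm) auto
qed (use R.I_zero R.I_diff R.I_smul R.M_zero R.M_diff R.M_smul R.L_diff R.L_smul R.L_empty in auto)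

lemma ev_V: "A \<subseteq> {1..n} \<Longrightarrow> f \<in> level B D \<Longrightarrow> z \<in> M \<Longrightarrow> ev L (V A f) z \<asymp> L A (ev L f z)"
  using univ rep_restrict unfolding universal_def R.cong_def by blast

lemma finite_tails: "finite {t \<in> tails. length t \<le> K}"
  by (rule finite_subset[OF _ finite_words[of N K]]) (use tails_words in auto)

lemma finite_B: "finite {b \<in> B. length b \<le> K}"
  by (rule finite_subset[OF _ finite_words[of n K]]) (use B_words in auto)

text \<open>Evaluating \<open>b @ t\<close> at \<open>z\<close> is evaluating \<open>b\<close> at
  the vector obtained from \<open>t\<close>. This reduces lifted operators to the universal property
  of the old module at other base points.\<close>

lemma ev_slices:
  assumes f: "f \<in> level B' D" and K: "D \<le> K"
  shows "ev L f z = (\<Sum>t | t \<in> tails \<and> length t \<le> K. ev L (slice f t) (word_act L t z))"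
proof -
  let ?T = "{t \<in> tails. length t \<le> K}" and ?W = "{b \<in> B. length b \<le> K}"
  have inj: "inj_on (\<lambda>(t, b). b @ t) (?T \<times> ?W)"
  proof (rule inj_onI, clarify)
    fix t b t' b' assume "t \<in> tails" "b \<in> B" "t' \<in> tails" "b' \<in> B" "b @ t = b' @ t'"
    then show "t = t' \<and> b = b'" using pre_append suf_append by metis
  qed
  have supp: "w \<in> (\<lambda>(t, b). b @ t) ` (?T \<times> ?W)" if "f w \<noteq> 0" for w
  proof -
    have w: "w \<in> B'" "Suc (length w) = D" using f that by (auto simp: level_def)
    then have "suf w \<in> ?T" "pre w \<in> ?W" using B'_iff K length_pre_suf[of w] by auto
    then show ?thesis using pre_suf[of w] by (intro image_eqI[of _ _ "(suf w, pre w)"]) auto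
  qed
  have "ev L f z = (\<Sum>w\<in>(\<lambda>(t, b). b @ t) ` (?T \<times> ?W). smul (f w) (word_act L w z))"
    by (rule ev_eq) (use supp finite_tails finite_B in auto)
  also have "\<dots> = (\<Sum>(t, b)\<in>?T \<times> ?W. smul (f (b @ t)) (word_act L (b @ t) z))"
    by (subst sum.reindex[OF inj]) (simp add: case_prod_unfold)
  also have "\<dots> = (\<Sum>t\<in>?T. \<Sum>b\<in>?W. smul (f (b @ t)) (word_act L (b @ t) z))"
    by (rule sum.cartesian_product[symmetric])
  also have "\<dots> = (\<Sum>t\<in>?T. ev L (slice f t) (word_act L t z))"
  proof (rule sum.cong[OF refl])
    fix t assume "t \<in> ?T"
    have "ev L (slice f t) (word_act L t z) = (\<Sum>b\<in>?W. smul (slice f t b) (word_act L b (word_act L t z)))"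
    proof (rule ev_eq[OF finite_B])
      fix b assume nz: "slice f t b \<noteq> 0"
      then have "b \<in> B" "Suc (length (b @ t)) = D" using f by (auto simp: slice_def level_def split: if_splits)
      then show "b \<in> ?W" using K by simp
    qed
    also have "\<dots> = (\<Sum>b\<in>?W. smul (f (b @ t)) (word_act L (b @ t) z))"
      by (rule sum.cong) (auto simp: slice_def word_act_append)
    finally show "(\<Sum>b\<in>?W. smul (f (b @ t)) (word_act L (b @ t) z)) = ev L (slice f t) (word_act L t z)" ..
  qed
  finally show ?thesis by simp
qed

lemma ev_level_diff: "f \<in> level B' D \<Longrightarrow> g \<in> level B' D \<Longrightarrow> ev L (f - g) z = ev L f z - ev L g z"
  by (intro ev_diff[of _ N D] B'.level_word_supp)

lemma ev_level_add: "f \<in> level B' D \<Longrightarrow> g \<in> level B' D \<Longrightarrow> ev L (f + g) z = ev L f z + ev L g z"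
  using ev_level_diff[of f D "0 - g" z] ev_level_diff[of 0 D g z] level_diff[of 0 B' D g] by simp

lemma ev_level_M: "f \<in> level B' D \<Longrightarrow> z \<in> M \<Longrightarrow> ev L f z \<in> M"
  by (intro R.ev_M[of _ D] B'.level_word_supp)

lemma ev_level_sum: "(\<And>i. i \<in> S \<Longrightarrow> f i \<in> level B' D) \<Longrightarrow> ev L (\<Sum>i\<in>S. f i) z = (\<Sum>i\<in>S. ev L (f i) z)"
proof (induction S rule: infinite_finite_induct)
  case (insert x F)
  have "sum f F \<in> level B' D" by (rule level_sum) (use insert.prems in auto)
  then show ?case unfolding sum.insert[OF insert(1,2)]
    using ev_level_add[of "f x" D "sum f F" z] insert by (simp only: insertI1 insertI2)
qed simp_all

lemma ev_lift_V:
  assumes A: "A \<subseteq> {1..n}" and f: "f \<in> level B' D" and z: "z \<in> M"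
  shows "ev L (lift (V A) f) z \<asymp> L A (ev L f z)"
proof -
  have "ev L (lift (V A) f) z = (\<Sum>t | t \<in> tails \<and> length t \<le> Suc D. ev L (V A (slice f t)) (word_act L t z))"
    unfolding ev_slices[OF lift_V_closed[OF A f] order_refl]
    by (rule sum.cong) (simp_all add: slice_lift_V[OF A f])
  also have "\<dots> \<asymp> (\<Sum>t | t \<in> tails \<and> length t \<le> Suc D. L A (ev L (slice f t) (word_act L t z)))"
    by (rule R.cong_sum, rule ev_V[OF A slice_level[OF f]]) (auto intro!: R.word_act_M z dest: tails_words)
  also have "\<dots> = L A (ev L f z)"
    unfolding R.L_sum[symmetric] by (subst ev_slices[OF f, of "Suc D"]) simp_all
  finally show ?thesis .
qed

lemma ev_xl:
  assumes A: "A \<subseteq> {1..n}" and f: "f \<in> level B' D" and z: "z \<in> M"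
  shows "ev L (xl A j f) z \<asymp> edge L A j (ev L f z)"
proof -
  have Aj: "A - {j} \<subseteq> {1..n}" using A by auto
  show ?thesis unfolding xl_def edge_def
    unfolding ev_level_diff[OF lift_V_closed[OF A f] lift_V_closed[OF Aj f]]
    by (intro R.cong_diff ev_lift_V[OF _ f z] A Aj)
qed

lemma Max_insert_N: "A \<subseteq> {1..n} \<Longrightarrow> Max (insert N A) = N"
  by (rule Max_eqI) (auto intro: le_SucI finite_subset)

lemma ev_shift:
  assumes A: "A \<subseteq> {1..n}" and f: "f \<in> level B' D"
  shows "ev L (shift A f) z = edge L (insert N A) N (ev L f z)"
proof -
  let ?W = "{w. set w \<subseteq> generators N \<and> length w \<le> D}"
  have edge_sum: "edge L Z j (\<Sum>i\<in>S. g i) = (\<Sum>i\<in>S. edge L Z j (g i))" for Z j g and S :: "nat set list set"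
    unfolding edge_def R.L_sum sum_subtractf ..
  have edge_smul: "edge L Z j (smul a g) = smul a (edge L Z j g)" for Z j a g
    unfolding edge_def R.L_smul smul_diff ..
  have "ev L (shift A f) z = (\<Sum>w\<in>(\<lambda>w. insert N A # w) ` ?W. smul (shift A f w) (word_act L w z))"
  proof (rule ev_eq)
    show "w \<in> (\<lambda>w. insert N A # w) ` ?W" if "shift A f w \<noteq> 0" for w
      using that B'.level_word_supp[OF f] by (auto simp: shift_def word_supp_def split: list.splits if_splits)
  qed (use finite_words in auto)
  also have "\<dots> = (\<Sum>w\<in>?W. smul (f w) (edge L (insert N A) N (word_act L w z)))"
    by (subst sum.reindex) (auto simp: shift_def Max_insert_N[OF A])
  also have "\<dots> = edge L (insert N A) N (ev L f z)"
    unfolding edge_smul[symmetric] edge_sum[symmetric]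
    by (subst ev_eq[OF finite_words[of N D]]) (use B'.level_word_supp[OF f] in \<open>auto simp: word_supp_def\<close>)
  finally show ?thesis .
qed

text \<open>\<open>f\<close> is split into images under \<open>yl\<close> and a part in
  \<open>Cs A\<close>. On the latter \<open>d A\<close> prefixes a letter with maximum
  \<open>N\<close>, which evaluation turns into the required operator. On the images the relation of
  \<open>d\<close> is matched by the commutation relations in the target; induction on the size of
  \<open>A\<close> handles the \<open>d (A - {j})\<close> hidden in \<open>yl\<close>.\<close>

lemma ev_d:
  assumes "A \<subseteq> {1..n}" "f \<in> level B' D" "z \<in> M"
  shows "ev L (d A f) z \<asymp> edge L (insert N A) N (ev L f z)"
  using assms
proof (induction "card A" arbitrary: A f D rule: less_induct)
  case less
  note A = less.prems(1) and f = less.prems(2) and z = less.prems(3)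
  have finA: "finite A" using A finite_subset by blast
  have NA: "insert N A \<subseteq> {1..N}" using A by auto
  note rA = raising[OF A]
  show ?case
  proof (cases D)
    case 0
    then have "f = 0" using f level_0 by blast
    then show ?thesis using d_0[OF rA] by (simp add: edge_def R.L_0)
  next
    case (Suc D')
    interpret C: filtered_complement G "yl d" "{B. B \<subseteq> {1..n} \<and> card B \<le> card A}" N smul A "Cs A" "shift A" d
      by (rule filtered_complement_yl[OF A raising])
    obtain m c where m: "\<And>j. m j \<in> level B' D'" and c: "c \<in> Cs A (Suc D')"
      and fe: "f = edge_sum (yl d) A N m + c"
      using C.span[of f D' 0] f Suc by (auto simp: G_0_eq)
    have c': "c \<in> level B' (Suc D')" using c by (simp add: Cs_def)
    let ?D = "\<lambda>A. edge L (insert N A) N"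
    have IH: "ev L (d (A - {j}) g) z \<asymp> ?D (A - {j}) (ev L g z)" if "j \<in> A" "g \<in> level B' E" for j g E
      using that A z psubset_card_mono[OF finA, of "A - {j}"] by (intro less.hyps[of _ g E]) auto
    have yl_level: "yl d A j g \<in> level B' (Suc E)" if "j \<in> A" "g \<in> level B' E" for j g E
    proof -
      have "A - {j} \<subseteq> {1..n}" using A by auto
      then show ?thesis unfolding yl_def
        by (intro level_diff xl_closed[OF A that(2)] d_level[OF raising that(2)])
    qed
    have ev_yl: "ev L (yl d A j g) z \<asymp> edge L A j (ev L g z) - ?D (A - {j}) (ev L g z)"
      if j: "j \<in> A" and g: "g \<in> level B' E" for j g E
    proof -
      have "A - {j} \<subseteq> {1..n}" using A by auto
      then have dg: "d (A - {j}) g \<in> level B' (Suc E)" by (intro d_level[OF raising g])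
      show ?thesis unfolding yl_def ev_level_diff[OF xl_closed[OF A g] dg]
        by (intro R.cong_diff ev_xl[OF A g z] IH[OF j g])
    qed
    \<comment> \<open>The counterpart in the target of
      \<open>d A * y A j = y A j * d (A - {j})\<close>, where \<open>?D A\<close> stands for the
      action of \<open>x (insert N A) N\<close>.\<close>
    have key: "ev L (yl d A j (d (A - {j}) g)) z \<asymp> ?D A (ev L (yl d A j g) z)"
      if j: "j \<in> A" and g: "g \<in> level B' E" for j g E
    proof -
      let ?e = "ev L g z"
      have Aj: "A - {j} \<subseteq> {1..n}" "insert N (A - {j}) \<subseteq> {1..N}" "A \<subseteq> {1..N}" using A by auto
      have jN: "j \<noteq> N" "N \<notin> A" using j A by auto
      have e: "?e \<in> M" by (rule ev_level_M[OF g z])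
      have dg: "d (A - {j}) g \<in> level B' (Suc E)" by (rule d_level[OF raising[OF Aj(1)] g])
      define h where "h = ?D (A - {j}) ?e"
      have "ev L (yl d A j (d (A - {j}) g)) z
          \<asymp> edge L A j (ev L (d (A - {j}) g) z) - ?D (A - {j}) (ev L (d (A - {j}) g) z)"
        by (rule ev_yl[OF j dg])
      also have "\<dots> \<asymp> edge L A j h - ?D (A - {j}) h"
        unfolding h_def by (intro R.cong_diff R.edge_L_cong Aj IH[OF j g])
      \<comment> \<open>Both sides equal \<open>L A h - L (insert N (A - {j})) h\<close>.\<close>
      also have "\<dots> = edge L (insert N A) j h - ?D A h"
      proof -
        have s: "insert N A - {j} = insert N (A - {j})" "insert N A - {N} = A"
          "insert N (A - {j}) - {N} = A - {j}" using jN by auto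
        show ?thesis unfolding edge_def s by simp
      qed
      also have "\<dots> \<asymp> ?D A (edge L A j ?e) - ?D A h"
      proof (rule R.cong_diff[OF R.cong_sym R.cong_refl])
        have s: "insert N A - {j} = insert N (A - {j})" "insert N A - {N} = A" using jN by auto
        show "?D A (edge L A j ?e) \<asymp> edge L (insert N A) j h"
          using R.L_comm[OF NA, of N j ?e] j jN e by (simp add: h_def s R.cong_def)
      qed
      also have "\<dots> = ?D A (edge L A j ?e - h)" by (simp add: R.edge_L_diff)
      also have "\<dots> \<asymp> ?D A (ev L (yl d A j g) z)"
        unfolding h_def by (intro R.edge_L_cong NA R.cong_sym[OF ev_yl[OF j g]])
      finally show ?thesis .
    qed
    let ?S = "A \<inter> {..<N}"
    have ye: "yl d A j (m j) \<in> level B' (Suc D')" if "j \<in> ?S" for j using yl_level m that by auto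
    have ye': "yl d A j (d (A - {j}) (m j)) \<in> level B' (Suc (Suc D'))" if "j \<in> ?S" for j
    proof -
      have "A - {j} \<subseteq> {1..n}" using A by auto
      then show ?thesis using that by (intro yl_level d_level[OF raising m]) auto
    qed
    have es: "edge_sum (yl d) A N m \<in> level B' (Suc D')" unfolding edge_sum_def by (rule level_sum[OF ye])
    have dsum: "d A (\<Sum>j\<in>S. yl d A j (m j)) = (\<Sum>j\<in>S. d A (yl d A j (m j)))" if "S \<subseteq> ?S" for S
      using that
    proof (induction S rule: infinite_finite_induct)
      case (infinite S)
      show ?case unfolding sum.infinite[OF infinite(1)] by (rule d_0[OF rA])
    next
      case (insert x F)
      have "(\<Sum>j\<in>F. yl d A j (m j)) \<in> level B' (Suc D')" by (rule level_sum, rule ye) (use insert.prems in auto)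
      moreover have "yl d A x (m x) \<in> level B' (Suc D')" using insert.prems by (intro ye) auto
      ultimately show ?case unfolding sum.insert[OF insert(1,2)] using insert
        by (simp only: d_add[OF rA] insert_subset)
    qed (simp only: sum.empty d_0[OF rA])
    have dyl: "d A (yl d A j (m j)) = yl d A j (d (A - {j}) (m j))" if "j \<in> A" for j
      unfolding yl_def by (rule d_xl[OF rA that m])
    have df: "d A f = (\<Sum>j\<in>?S. yl d A j (d (A - {j}) (m j))) + shift A c"
      unfolding fe d_add[OF rA es c'] d_shift[OF rA c]
      unfolding edge_sum_def dsum[OF order_refl]
      by (intro arg_cong2[of _ _ _ _ "(+)"] sum.cong dyl refl) auto
    have sc: "shift A c \<in> level B' (Suc (Suc D'))"
      using d_level[OF rA c'] by (simp add: d_shift[OF rA c])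
    have se: "(\<Sum>j\<in>?S. yl d A j (d (A - {j}) (m j))) \<in> level B' (Suc (Suc D'))"
      by (rule level_sum[OF ye'])
    have "ev L (d A f) z = (\<Sum>j\<in>?S. ev L (yl d A j (d (A - {j}) (m j))) z) + ?D A (ev L c z)"
    proof -
      have "ev L (\<Sum>j\<in>?S. yl d A j (d (A - {j}) (m j))) z = (\<Sum>j\<in>?S. ev L (yl d A j (d (A - {j}) (m j))) z)"
        by (rule ev_level_sum) (rule ye')
      then show ?thesis unfolding df ev_level_add[OF se sc] ev_shift[OF A c'] by (rule arg_cong)
    qed
    also have "\<dots> \<asymp> (\<Sum>j\<in>?S. ?D A (ev L (yl d A j (m j)) z)) + ?D A (ev L c z)"
      by (intro R.cong_add R.cong_sum R.cong_refl key[OF _ m]) auto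
    also have "\<dots> = ?D A (ev L f z)"
    proof -
      have "(\<Sum>j\<in>?S. ?D A (ev L (yl d A j (m j)) z)) = ?D A (ev L (edge_sum (yl d) A N m) z)"
      proof -
        have "ev L (edge_sum (yl d) A N m) z = (\<Sum>j\<in>?S. ev L (yl d A j (m j)) z)"
          unfolding edge_sum_def by (rule ev_level_sum) (rule ye)
        then show ?thesis unfolding edge_def by (simp only: R.L_sum sum_subtractf)
      qed
      then show ?thesis unfolding fe ev_level_add[OF es c'] R.edge_L_add by simp
    qed
    finally show ?thesis .
  qed
qed

lemma ev_V':
  assumes A: "A \<subseteq> {1..N}" and f: "f \<in> level B' D" and z: "z \<in> M"
  shows "ev L (V' A f) z \<asymp> L A (ev L f z)"
  using A
proof (cases rule: insert_N_cases)
  case 1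
  then show ?thesis using ev_lift_V[OF _ f z] by (simp add: V'_old)
next
  case (2 A0)
  have "ev L (V' A f) z = ev L (lift (V A0) f) z + ev L (d A0 f) z"
    unfolding 2(2) V'_insert[OF 2(1)]
    by (rule ev_level_add[OF lift_V_closed[OF 2(1) f] d_level[OF raising[OF 2(1)] f]])
  also have "\<dots> \<asymp> L A0 (ev L f z) + edge L (insert N A0) N (ev L f z)"
    by (intro R.cong_add ev_lift_V[OF 2(1) f z] ev_d[OF 2(1) f z])
  also have "\<dots> = L A (ev L f z)" by (simp add: edge_def insert_N_Diff[OF 2(1)] 2(2))
  finally show ?thesis .
qed

end

lemma (in Q_raising) universal_V': "universal n B V \<Longrightarrow> universal N B' V'"
  unfolding universal_def[of N]
proof (intro allI impI)
  fix L :: "nat set \<Rightarrow> 'f word_fun \<Rightarrow> 'f word_fun"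
    and M I A D and f z :: "'f word_fun"
  assume u: "universal n B V" and R: "Q_rep N L M I" and H: "A \<subseteq> {1..N}" "f \<in> level B' D" "z \<in> M"
  interpret R: Q_rep N L M I by (rule R)
  interpret Q_extension_rep n B V C d L M I by unfold_locales (rule u)
  show "ev L (V' A f) z - L A (ev L f z) \<in> I"
    using ev_V'[OF H] by (simp add: R.cong_def)
qed

subsection \<open>Dimensions\<close>

interpretation fun_vs: vector_space smul
  by unfold_locales (simp_all add: smul_add smul_add_left smul_smul)

definition words_of :: "'x list set \<Rightarrow> nat \<Rightarrow> 'x list set" where
  "words_of B D = {w \<in> B. Suc (length w) = D}"

lemma level_eq: "level B D = {f. \<forall>w. f w \<noteq> 0 \<longrightarrow> w \<in> words_of B D}"
  by (simp add: level_def words_of_def)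

lemma level_subspace: "fun_vs.subspace (level B D)"
  unfolding fun_vs.subspace_def by (simp add: level_add level_smul)

lemma level_sum_unit:
  assumes "finite (words_of B D)" "f \<in> level B D"
  shows "f = (\<Sum>w\<in>words_of B D. smul (f w) (unit_vec w))"
proof
  fix v
  have "(\<Sum>w\<in>words_of B D. f w * (if v = w then 1 else 0)) = (if v \<in> words_of B D then f v else 0)"
    using assms(1) by (simp add: if_distrib sum.delta cong: if_cong)
  also have "\<dots> = f v" using assms(2) by (auto simp: level_eq)
  finally show "f v = (\<Sum>w\<in>words_of B D. smul (f w) (unit_vec w)) v"
    by (simp add: sum_fun_apply smul_apply unit_vec_def)
qed

lemma unit_in_level: "w \<in> words_of B D \<Longrightarrow> unit_vec w \<in> level B D"
  by (auto simp: level_eq unit_vec_def)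

lemma span_units:
  assumes "finite (words_of B D)"
  shows "fun_vs.span (unit_vec ` words_of B D) = (level B D :: ('x list \<Rightarrow> 'f::field) set)"
proof
  show "fun_vs.span (unit_vec ` words_of B D) \<subseteq> (level B D :: ('x list \<Rightarrow> 'f) set)"
    by (rule fun_vs.span_minimal[OF _ level_subspace]) (auto intro: unit_in_level)
  show "level B D \<subseteq> (fun_vs.span (unit_vec ` words_of B D) :: ('x list \<Rightarrow> 'f) set)"
  proof
    fix f :: "'x list \<Rightarrow> 'f" assume "f \<in> level B D"
    then have "f = (\<Sum>w\<in>words_of B D. smul (f w) (unit_vec w))" by (rule level_sum_unit[OF assms])
    also have "\<dots> \<in> fun_vs.span (unit_vec ` words_of B D)"
      by (intro fun_vs.span_sum fun_vs.span_scale fun_vs.span_base) auto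
    finally show "f \<in> fun_vs.span (unit_vec ` words_of B D)" .
  qed
qed

lemma inj_unit_vec: "inj (unit_vec :: 'x \<Rightarrow> 'x \<Rightarrow> 'f::field)"
  by (rule injI) (auto simp: unit_vec_def fun_eq_iff split: if_splits)

lemma words_of_remove: "words_of (B - {w}) D = words_of B D - {w}"
  by (auto simp: words_of_def)

lemma independent_units:
  assumes "finite (words_of B D)"
  shows "fun_vs.independent (unit_vec ` words_of B D :: ('x list \<Rightarrow> 'f::field) set)"
  unfolding fun_vs.dependent_def
proof (rule notI, elim bexE)
  fix a :: "'x list \<Rightarrow> 'f"
  assume "a \<in> unit_vec ` words_of B D" and a: "a \<in> fun_vs.span (unit_vec ` words_of B D - {a})"
  then obtain w where w: "w \<in> words_of B D" "a = unit_vec w" by auto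
  have "unit_vec ` words_of B D - {a} = (unit_vec ` words_of (B - {w}) D :: ('x list \<Rightarrow> 'f) set)"
    unfolding words_of_remove w(2) using inj_unit_vec[where ?'f = 'f] by (auto dest: injD)
  then have "a \<in> level (B - {w}) D"
    using a span_units[of "B - {w}" D, where ?'f = 'f] assms by (simp add: words_of_remove)
  moreover have "a w = 1" by (simp add: w(2) unit_vec_def)
  ultimately show False unfolding level_def by force
qed

lemma dim_level:
  assumes "finite (words_of B D)"
  shows "fun_vs.dim (level B D :: ('x list \<Rightarrow> 'f::field) set) = card (words_of B D)"
proof -
  have "fun_vs.dim (level B D :: ('x list \<Rightarrow> 'f) set) = card (unit_vec ` words_of B D :: ('x list \<Rightarrow> 'f) set)"
    by (rule fun_vs.dim_eq_card) (use span_units[OF assms] independent_units[OF assms] in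
        \<open>auto simp: fun_vs.span_eq_iff[THEN iffD2, OF level_subspace]\<close>)
  then show ?thesis using card_image[OF inj_on_subset[OF inj_unit_vec[where ?'f = 'f]]] by simp
qed

lemma dim_zero_space: "fun_vs.dim {0} = 0"
  using fun_vs.dim_eq_card[of "{}" "{0}", OF _ fun_vs.independent_empty] by simp

lemma finite_basis:
  assumes "finite (words_of B D)" "fun_vs.subspace J" "J \<subseteq> level B D"
  obtains S where "S \<subseteq> J" "fun_vs.independent S" "fun_vs.span S = J" "finite S" "card S = fun_vs.dim J"
proof -
  obtain S where S: "S \<subseteq> J" "fun_vs.independent S" "J \<subseteq> fun_vs.span S" "card S = fun_vs.dim J"
    by (rule fun_vs.basis_exists)
  have "S \<subseteq> fun_vs.span (unit_vec ` words_of B D)"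
    using S(1) assms(3) span_units[OF assms(1)] by blast
  then have "finite S" using fun_vs.independent_span_bound[OF _ S(2)] assms(1) by blast
  moreover have "fun_vs.span S = J"
    using S(3) fun_vs.span_minimal[OF S(1) assms(2)] by blast
  ultimately show ?thesis using that S by blast
qed

text \<open>A basis of \<open>J\<close> is completed by unit vectors to a basis of the level, so the
  complement is spanned by words; this is what allows \<open>C A\<close> to consist of
  words.\<close>

lemma complement_exists:
  fixes J :: "('x list \<Rightarrow> 'f::field) set"
  assumes fin: "finite (words_of B D)" and J: "fun_vs.subspace J" "J \<subseteq> level B D"
  shows "\<exists>C \<subseteq> words_of B D. (\<forall>f\<in>level B D. \<exists>j\<in>J. \<exists>c\<in>level C D. f = j + c) \<and>
    (\<forall>j\<in>J. \<forall>c\<in>level C D. j + c = 0 \<longrightarrow> c = 0) \<and>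
    card C + fun_vs.dim J = card (words_of B D)"
proof -
  obtain S where S: "S \<subseteq> J" "fun_vs.independent S" "fun_vs.span S = J" "finite S" "card S = fun_vs.dim J"
    using finite_basis[OF fin J] .
  let ?u = "unit_vec :: 'x list \<Rightarrow> 'x list \<Rightarrow> 'f"
  obtain T where T: "S \<subseteq> T" "T \<subseteq> S \<union> ?u ` words_of B D" "fun_vs.independent T"
    "S \<union> ?u ` words_of B D \<subseteq> fun_vs.span T"
    using fun_vs.maximal_independent_subset_extend[of S "S \<union> ?u ` words_of B D"] S(2) by blast
  define C where "C = {w \<in> words_of B D. ?u w \<in> T - S}"
  have C: "C \<subseteq> words_of B D" by (auto simp: C_def)
  have wC: "words_of C D = C" using C by (auto simp: words_of_def)
  have finC: "finite C" using finite_subset[OF C fin] .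
  have TC: "T = S \<union> ?u ` C" and disj: "S \<inter> ?u ` C = {}" using T(1,2) by (auto simp: C_def)
  have spanC: "fun_vs.span (?u ` C') = level C' D" if "C' \<subseteq> C" for C'
  proof -
    have "words_of C' D = C'" using that C by (auto simp: words_of_def)
    then show ?thesis using span_units[of C' D, where ?'f = 'f] finite_subset[OF that finC] by simp
  qed
  have spanT: "fun_vs.span T = level B D"
  proof
    have "T \<subseteq> level B D" using T(2) S(1) J(2) unit_in_level by blast
    then show "fun_vs.span T \<subseteq> level B D" by (rule fun_vs.span_minimal[OF _ level_subspace])
    have "fun_vs.span (?u ` words_of B D) \<subseteq> fun_vs.span T"
      by (rule fun_vs.span_minimal[OF _ fun_vs.subspace_span]) (use T(4) in blast)
    then show "level B D \<subseteq> fun_vs.span T" unfolding span_units[OF fin] .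
  qed
  have "card T = card S + card C"
    unfolding TC using card_Un_disjoint[OF S(4) _ disj] finC
      card_image[OF inj_on_subset[OF inj_unit_vec[where ?'f = 'f]], of C] by simp
  moreover have "card T = card (words_of B D)"
    using fun_vs.dim_eq_card[OF _ T(3), of "level B D"] spanT dim_level[OF fin, where ?'f = 'f]
    by (simp add: fun_vs.span_eq_iff[THEN iffD2, OF level_subspace])
  ultimately have 3: "card C + fun_vs.dim J = card (words_of B D)" using S(5) by simp
  have 1: "\<exists>j\<in>J. \<exists>c\<in>level C D. f = j + c" if "f \<in> level B D" for f
    using that unfolding spanT[symmetric] TC fun_vs.span_Un spanC[OF order_refl] S(3) by auto
  have 2: "c = 0" if j: "j \<in> J" and c: "c \<in> level C D" and jc: "j + c = 0" for j c
  proof (rule ccontr)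
    assume "c \<noteq> 0"
    then obtain w where cw: "c w \<noteq> 0" by (auto simp: fun_eq_iff)
    then have w: "w \<in> C" "Suc (length w) = D" using c by (auto simp: level_def)
    define c' where "c' = c - smul (c w) (?u w)"
    have "c' v = (if v = w then 0 else c v)" for v by (simp add: c'_def smul_apply unit_vec_def)
    then have c': "c' \<in> level (C - {w}) D" using c by (auto simp: level_def)
    have "- j = c" using jc by (rule minus_unique)
    then have "- j - c' = smul (c w) (?u w)" by (simp add: c'_def)
    then have uw: "?u w = smul (inverse (c w)) (- j - c')" using cw by (simp add: smul_smul)
    have sub: "S \<union> ?u ` (C - {w}) \<subseteq> T - {?u w}"
      using disj w(1) TC inj_unit_vec[where ?'f = 'f] by (auto dest: injD)
    have "j \<in> fun_vs.span (S \<union> ?u ` (C - {w}))" "c' \<in> fun_vs.span (S \<union> ?u ` (C - {w}))"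
      using j c' spanC[of "C - {w}"] S(3) fun_vs.span_mono[of S "S \<union> ?u ` (C - {w})"]
        fun_vs.span_mono[of "?u ` (C - {w})" "S \<union> ?u ` (C - {w})"] by auto
    then have "?u w \<in> fun_vs.span (S \<union> ?u ` (C - {w}))"
      unfolding uw by (intro fun_vs.span_scale fun_vs.span_diff fun_vs.span_neg)
    then have "?u w \<in> fun_vs.span (T - {?u w})" using fun_vs.span_mono[OF sub] by blast
    moreover have "?u w \<in> T" using w(1) TC by blast
    ultimately show False using T(3) fun_vs.dependent_def by blast
  qed
  show ?thesis using C 1 2 3 by blast
qed

text \<open>Rank and nullity for the map from the level to the quotient by \<open>J\<close> induced
  by \<open>f\<close>, whose kernel is \<open>K\<close>. A basis of \<open>J\<close> together with
  the images of a word basis of a complement of \<open>K\<close> is a basis of the sum.\<close>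

lemma dim_extend:
  fixes f :: "('x list \<Rightarrow> 'f::field) \<Rightarrow> 'x list \<Rightarrow> 'f"
  assumes fin: "finite (words_of B D)" "finite (words_of B (Suc D))"
    and add: "\<And>g h. g \<in> level B D \<Longrightarrow> h \<in> level B D \<Longrightarrow> f (g + h) = f g + f h"
    and scl: "\<And>a g. g \<in> level B D \<Longrightarrow> f (smul a g) = smul a (f g)"
    and closed: "\<And>g. g \<in> level B D \<Longrightarrow> f g \<in> level B (Suc D)"
    and J: "fun_vs.subspace J" "J \<subseteq> level B (Suc D)" and K: "fun_vs.subspace K" "K \<subseteq> level B D"
    and JK: "\<And>g. g \<in> level B D \<Longrightarrow> f g \<in> J \<longleftrightarrow> g \<in> K"
  shows "fun_vs.dim {j + f g | j g. j \<in> J \<and> g \<in> level B D} + fun_vs.dim K = fun_vs.dim J + card (words_of B D)"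
proof -
  obtain S where S: "S \<subseteq> J" "fun_vs.independent S" "fun_vs.span S = J" "finite S" "card S = fun_vs.dim J"
    using finite_basis[OF fin(2) J] .
  obtain E where E: "E \<subseteq> words_of B D" and
    E_span': "\<forall>g\<in>level B D. \<exists>k\<in>K. \<exists>c\<in>level E D. g = k + c" and
    E_direct': "\<forall>k\<in>K. \<forall>c\<in>level E D. k + c = 0 \<longrightarrow> c = 0" and
    E_card: "card E + fun_vs.dim K = card (words_of B D)"
    using complement_exists[OF fin(1) K] by (elim exE conjE) (rule that)
  have E_span: "\<exists>k\<in>K. \<exists>c\<in>level E D. g = k + c" if "g \<in> level B D" for g
    using E_span' that by (rule bspec)
  have E_direct: "c = 0" if "k \<in> K" "c \<in> level E D" "k + c = 0" for k c
    using E_direct' that by simp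
  have finE: "finite E" using finite_subset[OF E fin(1)] .
  have EB: "level E' D \<subseteq> (level B D :: ('x list \<Rightarrow> 'f) set)" if "E' \<subseteq> E" for E'
    using that E by (auto simp: level_def words_of_def)
  let ?u = "unit_vec :: 'x list \<Rightarrow> 'x list \<Rightarrow> 'f"
  define W where "W E' = {j + f c | j c. j \<in> J \<and> c \<in> level E' D}" for E'
  have f0: "f 0 = 0" using add[of 0 0] by simp
  have W_subspace: "fun_vs.subspace (W E')" if "level E' D \<subseteq> (level B D :: ('x list \<Rightarrow> 'f) set)" for E'
    unfolding fun_vs.subspace_def
  proof (intro conjI ballI allI)
    show "0 \<in> W E'" unfolding W_def using fun_vs.subspace_0[OF J(1)] f0
      by (intro CollectI exI[of _ 0]) simp
    fix x y assume "x \<in> W E'" "y \<in> W E'"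
    then obtain j c j' c' where *: "j \<in> J" "c \<in> level E' D" "x = j + f c" "j' \<in> J" "c' \<in> level E' D" "y = j' + f c'"
      unfolding W_def by blast
    then have "f (c + c') = f c + f c'" using that by (intro add) auto
    then have "x + y = (j + j') + f (c + c')" using * by (simp add: add_ac)
    then show "x + y \<in> W E'" unfolding W_def
      using * fun_vs.subspace_add[OF J(1)] level_add by blast
  next
    fix a x assume "x \<in> W E'"
    then obtain j c where *: "j \<in> J" "c \<in> level E' D" "x = j + f c" unfolding W_def by blast
    then have "smul a x = smul a j + f (smul a c)" using that scl[of c a] by (auto simp: smul_add)
    then show "smul a x \<in> W E'" unfolding W_def
      using * fun_vs.subspace_scale[OF J(1)] level_smul by blast
  qed
  have JW: "J \<subseteq> W E'" for E'
  proof
    fix j assume "j \<in> J"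
    then show "j \<in> W E'" unfolding W_def by (intro CollectI exI[of _ j] exI[of _ 0]) (simp add: f0)
  qed
  have uW: "f (?u e) \<in> W E'" if "e \<in> E'" "E' \<subseteq> E" for e E'
  proof -
    have "?u e \<in> level E' D" using that E by (auto simp: level_def unit_vec_def words_of_def)
    moreover have "0 \<in> J" by (rule fun_vs.subspace_0[OF J(1)])
    ultimately show ?thesis unfolding W_def by (intro CollectI exI[of _ 0] exI[of _ "?u e"]) simp
  qed
  have span_sub: "fun_vs.span (S \<union> (f \<circ> ?u) ` E') \<subseteq> W E'" if "E' \<subseteq> E" for E'
  proof (rule fun_vs.span_minimal[OF _ W_subspace[OF EB[OF that]]])
    have "(f \<circ> ?u) ` E' \<subseteq> W E'" using uW[OF _ that] by (auto simp: comp_def)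
    then show "S \<union> (f \<circ> ?u) ` E' \<subseteq> W E'" using S(1) JW[of E'] by blast
  qed
  have indep: "fun_vs.independent (S \<union> (f \<circ> ?u) ` E') \<and> card (S \<union> (f \<circ> ?u) ` E') = card S + card E'"
    if "finite E'" "E' \<subseteq> E" for E'
    using that
  proof (induction E' rule: finite_induct)
    case empty
    then show ?case using S by simp
  next
    case (insert e E')
    \<comment> \<open>A dependency would put \<open>?u e - c\<close> into \<open>K\<close>, but it
      is a nonzero vector of the chosen complement of \<open>K\<close>.\<close>
    have notin: "f (?u e) \<notin> fun_vs.span (S \<union> (f \<circ> ?u) ` E')"
    proof
      assume "f (?u e) \<in> fun_vs.span (S \<union> (f \<circ> ?u) ` E')"
      then have "f (?u e) \<in> W E'" using span_sub[of E'] insert.prems by blast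
      then obtain j c where j: "j \<in> J" and c: "c \<in> level E' D" and eq: "f (?u e) = j + f c"
        unfolding W_def by blast
      have cE: "c \<in> level E D" using c insert.prems by (auto simp: level_def)
      have uE: "?u e \<in> level E D" using insert.prems E by (auto simp: level_def unit_vec_def words_of_def)
      have d: "?u e - c \<in> level E D" by (rule level_diff[OF uE cE])
      have "f (?u e) = f (?u e - c) + f c"
        using add[of "?u e - c" c] d cE EB[OF order_refl] by auto
      then have "f (?u e - c) \<in> J" using eq j by simp
      then have "?u e - c \<in> K" using JK d EB[OF order_refl] by blast
      then have "smul (-1) (?u e - c) \<in> K" by (rule fun_vs.subspace_scale[OF K(1)])
      moreover have "smul (-1) (?u e - c) + (?u e - c) = 0" by (simp add: smul_def fun_eq_iff)
      ultimately have "?u e - c = 0" using E_direct d by blast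
      then have "c = ?u e" by simp
      then have "c e = 1" by (simp add: unit_vec_def)
      then have "e \<in> E'" using c by (auto simp: level_def)
      then show False using insert.hyps by blast
    qed
    have nS: "f (?u e) \<notin> S \<union> (f \<circ> ?u) ` E'"
      using notin by (rule contrapos_nn) (rule fun_vs.span_base)
    have ins: "S \<union> (f \<circ> ?u) ` insert e E' = insert (f (?u e)) (S \<union> (f \<circ> ?u) ` E')" by auto
    have "fun_vs.independent (insert (f (?u e)) (S \<union> (f \<circ> ?u) ` E'))"
      using notin insert by (intro fun_vs.independent_insertI) auto
    moreover have "card (insert (f (?u e)) (S \<union> (f \<circ> ?u) ` E')) = Suc (card (S \<union> (f \<circ> ?u) ` E'))"
      by (rule card_insert_disjoint[OF _ nS]) (use insert.hyps S(4) in blast)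
    ultimately show ?case unfolding ins using insert by simp
  qed
  have "fun_vs.span (S \<union> (f \<circ> ?u) ` E) = W B"
  proof
    have "W E \<subseteq> W B" unfolding W_def using EB[OF order_refl] by blast
    then show "fun_vs.span (S \<union> (f \<circ> ?u) ` E) \<subseteq> W B" using span_sub[OF order_refl] by blast
    show "W B \<subseteq> fun_vs.span (S \<union> (f \<circ> ?u) ` E)"
    proof
      let ?P = "fun_vs.span (S \<union> (f \<circ> ?u) ` E)"
      fix x assume "x \<in> W B"
      then obtain j g where j: "j \<in> J" and g: "g \<in> level B D" and x: "x = j + f g" unfolding W_def by blast
      obtain k c where k: "k \<in> K" and c: "c \<in> level E D" and gkc: "g = k + c" using E_span[OF g] by blast
      have kB: "k \<in> level B D" and cB: "c \<in> level B D" using k K(2) c EB[OF order_refl] by auto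
      have "J \<subseteq> ?P" using S(3) fun_vs.span_mono[of S "S \<union> (f \<circ> ?u) ` E"] by auto
      moreover have "f k \<in> J" using JK[OF kB] k by simp
      moreover have "f c \<in> ?P"
      proof -
        have wE: "words_of E D = E" using E by (auto simp: words_of_def)
        have uB: "smul a (?u e) \<in> level B D" if "e \<in> E" for a e
          using that E by (intro level_smul unit_in_level) auto
        have "f (\<Sum>e\<in>E'. smul (c e) (?u e)) = (\<Sum>e\<in>E'. smul (c e) (f (?u e)))" if "finite E'" "E' \<subseteq> E" for E'
          using that
        proof (induction E' rule: finite_induct)
          case (insert e E')
          have "(\<Sum>e\<in>E'. smul (c e) (?u e)) \<in> level B D"
            using insert.prems by (intro level_sum uB) auto
          moreover have "?u e \<in> level B D" using insert.prems E by (intro unit_in_level) auto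
          moreover have "e \<in> E" "E' \<subseteq> E" using insert.prems by auto
          ultimately show ?case unfolding sum.insert[OF insert.hyps(1,2)]
            by (simp only: add[OF uB] scl insert.IH)
        qed (simp add: f0)
        then have fsum: "f (\<Sum>e\<in>E. smul (c e) (?u e)) = (\<Sum>e\<in>E. smul (c e) (f (?u e)))" using finE by blast
        have "c = (\<Sum>e\<in>E. smul (c e) (?u e))" using level_sum_unit[of E D c] wE finE c by simp
        then have "f c = f (\<Sum>e\<in>E. smul (c e) (?u e))" by (rule arg_cong)
        also have "\<dots> = (\<Sum>e\<in>E. smul (c e) (f (?u e)))" by (rule fsum)
        also have "\<dots> \<in> ?P"
          by (intro fun_vs.span_sum fun_vs.span_scale fun_vs.span_base) auto
        finally show ?thesis .
      qed
      ultimately show "x \<in> ?P"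
        unfolding x gkc add[OF kB cB] using j by (intro fun_vs.span_add) auto
    qed
  qed
  then have "fun_vs.dim (W B) = card (S \<union> (f \<circ> ?u) ` E)"
    using indep[OF finE order_refl] fun_vs.dim_eq_card[of "S \<union> (f \<circ> ?u) ` E" "W B"]
      fun_vs.span_eq_iff[THEN iffD2, OF W_subspace[OF order_refl]] by simp
  then have "fun_vs.dim (W B) = fun_vs.dim J + card E"
    using indep[OF finE order_refl] S(5) by simp
  then show ?thesis using E_card unfolding W_def by simp
qed

section \<open>Hilbert series of the quotients by edge operators\<close>

definition gf :: "'x list set \<Rightarrow> rat fps" where
  "gf P = Abs_fps (\<lambda>i. of_nat (card {w \<in> P. length w = i}))"

lemma words_of_Suc: "words_of B (Suc D) = {w \<in> B. length w = D}"
  by (auto simp: words_of_def)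

context Q_model
begin

lemma finite_words_of: "finite (words_of B D)"
  by (rule finite_subset[OF _ finite_words[of n D]]) (use B_words in \<open>auto simp: words_of_def\<close>)

text \<open>With the trivial filtration a model is itself a filtered family of operators.\<close>

definition unfiltered :: "nat \<Rightarrow> nat \<Rightarrow> 'f word_fun set" where
  "unfiltered D p = (if p = 0 then level B D else {0})"

lemma filtered_unfiltered: "filtered_edges unfiltered (edge V) {A. A \<subseteq> {1..n}}"
proof
  fix A k D p m
  assume A: "A \<in> {A. A \<subseteq> {1..n}}" and k: "k \<in> A" and m: "\<And>j. m j \<in> unfiltered (Suc D) p"
    and s: "edge_sum (edge V) A (Suc k) m \<in> unfiltered (Suc (Suc D)) (Suc p)"
  have Ak: "A - {k} \<subseteq> {1..n}" using A by auto
  show "\<exists>u. (\<forall>j. u j \<in> unfiltered D p) \<and> m k - edge_sum (edge V) (A - {k}) k u \<in> unfiltered (Suc D) (Suc p)"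
  proof (cases "p = 0")
    case True
    then obtain u where "\<forall>j. u j \<in> level B D" "m k = edge_sum (edge V) (A - {k}) k u"
      using V_regular[of A k m D] A k m s by (auto simp: unfiltered_def)
    then show ?thesis using True by (intro exI[of _ u]) (simp add: unfiltered_def)
  next
    case False
    then have "m k = 0" using m[of k] by (simp add: unfiltered_def)
    then show ?thesis using False edge_zero[OF Ak]
      by (intro exI[of _ "\<lambda>_. 0"]) (simp add: unfiltered_def edge_sum_def)
  qed
next
  show "unfiltered D D \<subseteq> {0}" for D using level_0 by (auto simp: unfiltered_def)
  show "0 \<in> unfiltered D p" "unfiltered D (Suc p) \<subseteq> unfiltered D p" for D p by (auto simp: unfiltered_def)
  show "f \<in> unfiltered D p \<Longrightarrow> g \<in> unfiltered D p \<Longrightarrow> f - g \<in> unfiltered D p" for f g D p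
    by (auto simp: unfiltered_def level_diff split: if_splits)
  show "A \<in> {A. A \<subseteq> {1..n}} \<Longrightarrow> f \<in> unfiltered D 0 \<Longrightarrow> g \<in> unfiltered D 0 \<Longrightarrow> edge V A j (f - g) = edge V A j f - edge V A j g" for A j f g D
    using edge_diff[of A f D g] by (simp add: unfiltered_def)
  show "A \<in> {A. A \<subseteq> {1..n}} \<Longrightarrow> f \<in> unfiltered D p \<Longrightarrow> edge V A j f \<in> unfiltered (Suc D) p" for A j f D p
    using edge_closed[of A f D j] edge_zero[of A j] by (auto simp: unfiltered_def split: if_splits)
  show "A \<in> {A. A \<subseteq> {1..n}} \<Longrightarrow> i \<in> A \<Longrightarrow> j \<in> A \<Longrightarrow> i \<noteq> j \<Longrightarrow> f \<in> unfiltered D 0 \<Longrightarrow>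
        edge V A i (edge V (A - {i}) j f) = edge V A j (edge V (A - {j}) i f)" for A i j f D
    using V_comm[of A i j f D] by (simp add: unfiltered_def)
qed auto

interpretation V: filtered_edges unfiltered "edge V" "{A. A \<subseteq> {1..n}}" by (rule filtered_unfiltered)

definition edge_space :: "nat set \<Rightarrow> nat \<Rightarrow> nat \<Rightarrow> 'f word_fun set" where
  "edge_space A k D = {edge_sum (edge V) A k m | m. \<forall>j. m j \<in> level B D}"

lemma unfiltered_0: "unfiltered D 0 = level B D"
  by (simp add: unfiltered_def)

lemma edge_space_level: "A \<subseteq> {1..n} \<Longrightarrow> edge_space A k D \<subseteq> level B (Suc D)"
  using V.edge_sum_closed[of A _ D 0 k] by (auto simp: edge_space_def unfiltered_0)

lemma edge_space_subspace:
  assumes A: "A \<subseteq> {1..n}"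
  shows "fun_vs.subspace (edge_space A k D)"
  unfolding fun_vs.subspace_def
proof (intro conjI ballI allI)
  show "0 \<in> edge_space A k D"
    unfolding edge_space_def using V.edge_sum_zero[of A k] A by (intro CollectI exI[of _ "\<lambda>_. 0"]) simp
  fix x y assume "x \<in> edge_space A k D" "y \<in> edge_space A k D"
  then obtain m m' where m: "\<And>j. m j \<in> level B D" "x = edge_sum (edge V) A k m"
    and m': "\<And>j. m' j \<in> level B D" "y = edge_sum (edge V) A k m'"
    unfolding edge_space_def by blast
  have "x + y = edge_sum (edge V) A k (\<lambda>j. m j + m' j)"
    unfolding m(2) m'(2) using A m m' by (intro V.edge_sum_add[symmetric]) (auto simp: unfiltered_0)
  then show "x + y \<in> edge_space A k D"
    unfolding edge_space_def using level_add[OF m(1) m'(1)] by (intro CollectI exI[of _ "\<lambda>j. m j + m' j"]) simp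
next
  fix a x assume "x \<in> edge_space A k D"
  then obtain m where m: "\<And>j. m j \<in> level B D" "x = edge_sum (edge V) A k m"
    unfolding edge_space_def by blast
  have "smul a x = edge_sum (edge V) A k (\<lambda>j. smul a (m j))"
    unfolding m(2) edge_sum_def fun_vs.scale_sum_right using edge_smul[OF A m(1)] by simp
  then show "smul a x \<in> edge_space A k D"
    unfolding edge_space_def using level_smul[OF m(1)] by (intro CollectI exI[of _ "\<lambda>j. smul a (m j)"]) simp
qed

text \<open>One direction is \<open>colon\<close> for the trivial filtration, the other is the
  Koszul swap.\<close>

lemma edge_space_colon:
  assumes A: "A \<subseteq> {1..n}" and k: "k \<in> A" and g: "g \<in> level B (Suc D)"
  shows "edge V A k g \<in> edge_space A k (Suc D) \<longleftrightarrow> g \<in> edge_space (A - {k}) k D"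
proof
  assume "edge V A k g \<in> edge_space A k (Suc D)"
  then obtain m where "\<And>j. m j \<in> level B (Suc D)" "edge V A k g = edge_sum (edge V) A k m"
    unfolding edge_space_def by blast
  then show "g \<in> edge_space (A - {k}) k D"
    using V.colon[of A k g D 0 m] A k g by (auto simp: unfiltered_0 edge_space_def)
next
  assume "g \<in> edge_space (A - {k}) k D"
  then obtain u where u: "\<And>j. u j \<in> level B D" "g = edge_sum (edge V) (A - {k}) k u"
    unfolding edge_space_def by blast
  have "\<exists>u'. (\<forall>j. u' j \<in> unfiltered (Suc D) 0) \<and> (\<forall>j\<in>A. j < k \<longrightarrow> u' j = edge V (A - {j}) k (u j)) \<and>
      edge V A k (edge_sum (edge V) (A - {k}) k u) = edge_sum (edge V) A k u'"
    by (rule V.edge_sum_swap') (use A k u in \<open>auto simp: unfiltered_0\<close>)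
  then obtain u' where "\<forall>j. u' j \<in> level B (Suc D)"
    "edge V A k (edge_sum (edge V) (A - {k}) k u) = edge_sum (edge V) A k u'"
    by (auto simp: unfiltered_0)
  then show "edge V A k g \<in> edge_space A k (Suc D)"
    unfolding edge_space_def u(2) by blast
qed

text \<open>Adding operator \<open>k\<close> enlarges the space by the image of
  \<open>edge V A k\<close>. By \<open>edge_space_colon\<close> the kernel modulo the earlier images
  is \<open>edge_space (A - {k}) k D\<close>, one degree lower.\<close>

lemma dim_edge_space_Suc:
  assumes A: "A \<subseteq> {1..n}" and k: "k \<in> A"
  shows "fun_vs.dim (edge_space A (Suc k) (Suc D)) + fun_vs.dim (edge_space (A - {k}) k D)
    = fun_vs.dim (edge_space A k (Suc D)) + card (words_of B (Suc D))"
proof -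
  have Ak: "A - {k} \<subseteq> {1..n}" using A by auto
  have "edge_space A (Suc k) (Suc D) = {j + edge V A k g | j g. j \<in> edge_space A k (Suc D) \<and> g \<in> level B (Suc D)}"
  proof (intro equalityI subsetI)
    fix x assume "x \<in> edge_space A (Suc k) (Suc D)"
    then obtain m where "\<forall>j. m j \<in> level B (Suc D)" "x = edge_sum (edge V) A k m + edge V A k (m k)"
      using k by (auto simp: edge_space_def edge_sum_Suc add.commute)
    then show "x \<in> {j + edge V A k g | j g. j \<in> edge_space A k (Suc D) \<and> g \<in> level B (Suc D)}"
      unfolding edge_space_def by blast
  next
    fix x assume "x \<in> {j + edge V A k g | j g. j \<in> edge_space A k (Suc D) \<and> g \<in> level B (Suc D)}"
    then obtain m g where m: "\<forall>j. m j \<in> level B (Suc D)" and g: "g \<in> level B (Suc D)"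
      and x: "x = edge_sum (edge V) A k m + edge V A k g"
      unfolding edge_space_def by blast
    have "edge_sum (edge V) A k (m(k := g)) = edge_sum (edge V) A k m" by (rule edge_sum_cong) simp
    then have "x = edge_sum (edge V) A (Suc k) (m(k := g))"
      using k by (simp add: x edge_sum_Suc add.commute fun_upd_def)
    then show "x \<in> edge_space A (Suc k) (Suc D)"
      unfolding edge_space_def using m g by (intro CollectI exI[of _ "m(k := g)"]) simp
  qed
  moreover have "fun_vs.dim {j + edge V A k g | j g. j \<in> edge_space A k (Suc D) \<and> g \<in> level B (Suc D)}
      + fun_vs.dim (edge_space (A - {k}) k D) = fun_vs.dim (edge_space A k (Suc D)) + card (words_of B (Suc D))"
  proof (rule dim_extend[OF finite_words_of finite_words_of])
    show "edge V A k (g + h) = edge V A k g + edge V A k h" if "g \<in> level B (Suc D)" "h \<in> level B (Suc D)" for g h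
      using V.Y_add[of A k g "Suc D" h] A k that by (simp add: unfiltered_0)
  qed (use A Ak k edge_smul edge_closed edge_space_subspace edge_space_level edge_space_colon in auto)
  ultimately show ?thesis by simp
qed

lemma edge_space_0: "edge_space A k 0 \<subseteq> {0}" if "A \<subseteq> {1..n}"
proof -
  have "edge_sum (edge V) A k m = 0" if "\<forall>j. m j \<in> level B 0" for m
  proof -
    have "m j = 0" for j using that level_0 by blast
    then show ?thesis unfolding edge_sum_def using edge_zero[OF \<open>A \<subseteq> {1..n}\<close>] by (intro sum.neutral) auto
  qed
  then show ?thesis by (auto simp: edge_space_def)
qed

text \<open>The Hilbert series of the quotient by the images of the \<open>x A j\<close> with
  \<open>j < k\<close>. Coefficient \<open>D\<close> concerns words of length \<open>D\<close>,
  which form level \<open>Suc D\<close> and receive images from level \<open>D\<close>.\<close>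

definition codim_gf :: "nat set \<Rightarrow> nat \<Rightarrow> rat fps" where
  "codim_gf A k = Abs_fps (\<lambda>D. of_nat (card (words_of B (Suc D))) - of_nat (fun_vs.dim (edge_space A k D)))"

lemma dim_edge_space_0: assumes "A \<subseteq> {1..n}" shows "fun_vs.dim (edge_space A k 0) = 0"
proof -
  have "edge_space A k 0 = {0}"
    using edge_space_0[OF assms] fun_vs.subspace_0[OF edge_space_subspace[OF assms, of k 0]] by blast
  moreover have "fun_vs.dim ({0} :: 'f word_fun set) = 0"
    by (rule dim_zero_space)
  ultimately show ?thesis by simp
qed

text \<open>Regularity gives the recurrence
  \<open>codim A (k+1) = codim A k - t * codim (A - {k}) k\<close>. The two series on the right
  coincide by induction, since \<open>A\<close> and \<open>A - {k}\<close> agree below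
  \<open>k\<close>; each operator thus contributes a factor \<open>1 - t\<close>.\<close>

lemma codim_gf_eq: "A \<subseteq> {1..n} \<Longrightarrow> codim_gf A k = (1 - fps_X) ^ card (A \<inter> {..<k}) * gf B"
proof (induction k arbitrary: A)
  case 0
  have "edge_space A 0 D = {0}" for D
    unfolding edge_space_def by (auto intro: exI[of _ "\<lambda>_. 0"])
  moreover have "fun_vs.dim ({0} :: 'f word_fun set) = 0"
    by (rule dim_zero_space)
  ultimately show ?case by (simp add: codim_gf_def gf_def words_of_Suc)
next
  case (Suc k)
  show ?case
  proof (cases "k \<in> A")
    case False
    then have "A \<inter> {..<Suc k} = A \<inter> {..<k}" by (auto simp: less_Suc_eq)
    moreover have "edge_space A (Suc k) D = edge_space A k D" for D
      using False by (simp add: edge_space_def edge_sum_Suc)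
    ultimately show ?thesis using Suc by (simp add: codim_gf_def)
  next
    case k: True
    have Ak: "A - {k} \<subseteq> {1..n}" using Suc.prems by auto
    have "codim_gf A (Suc k) = codim_gf A k - fps_X * codim_gf (A - {k}) k"
    proof (rule fps_ext)
      fix D
      show "fps_nth (codim_gf A (Suc k)) D = fps_nth (codim_gf A k - fps_X * codim_gf (A - {k}) k) D"
      proof (cases D)
        case 0
        then show ?thesis using dim_edge_space_0[OF Suc.prems] by (simp add: codim_gf_def)
      next
        case (Suc D')
        have "(of_nat (fun_vs.dim (edge_space A (Suc k) (Suc D'))) :: rat) + of_nat (fun_vs.dim (edge_space (A - {k}) k D'))
          = of_nat (fun_vs.dim (edge_space A k (Suc D'))) + of_nat (card (words_of B (Suc D')))"
          using dim_edge_space_Suc[OF Suc.prems k, of D'] by (metis of_nat_add)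
        then show ?thesis using Suc by (simp add: codim_gf_def algebra_simps)
      qed
    qed
    also have "\<dots> = (1 - fps_X) * ((1 - fps_X) ^ card (A \<inter> {..<k}) * gf B)"
    proof -
      have "(A - {k}) \<inter> {..<k} = A \<inter> {..<k}" by auto
      then show ?thesis using Suc.IH[OF Suc.prems] Suc.IH[OF Ak] by (simp add: algebra_simps)
    qed
    also have "card (A \<inter> {..<Suc k}) = Suc (card (A \<inter> {..<k}))"
    proof -
      have "A \<inter> {..<Suc k} = insert k (A \<inter> {..<k})" using k by (auto simp: less_Suc_eq)
      then show ?thesis by simp
    qed
    then have "(1 - fps_X) * ((1 - fps_X) ^ card (A \<inter> {..<k}) * gf B) = (1 - fps_X) ^ card (A \<inter> {..<Suc k}) * gf B"
      by (simp add: mult.assoc)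
    finally show ?thesis .
  qed
qed

text \<open>Complements are chosen in each degree separately and united. Word length tells the
  degrees apart, so each chosen set can be read off from the union; the cut-off \<open>Suc n\<close>
  lies above every element of \<open>A\<close>.\<close>

lemma complements_exist:
  "\<exists>C. Q_extension n B V C \<and> (\<forall>A \<subseteq> {1..n}. gf (C A) = (1 - fps_X) ^ card A * gf B)"
proof -
  define P where "P A D E \<longleftrightarrow> E \<subseteq> words_of B (Suc D) \<and>
    (\<forall>f\<in>level B (Suc D). \<exists>j\<in>edge_space A (Suc n) D. \<exists>c\<in>level E (Suc D). f = j + c) \<and>
    (\<forall>j\<in>edge_space A (Suc n) D. \<forall>c\<in>level E (Suc D). j + c = 0 \<longrightarrow> c = 0) \<and>
    card E + fun_vs.dim (edge_space A (Suc n) D) = card (words_of B (Suc D))" for A D E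
  define E where "E A D = (SOME E. P A D E)" for A D
  have P: "P A D (E A D)" if "A \<subseteq> {1..n}" for A D
    unfolding E_def
    by (rule someI_ex)
      (use complement_exists[OF finite_words_of edge_space_subspace[OF that, of "Suc n" D] edge_space_level[OF that]]
        in \<open>simp only: P_def\<close>)
  have E: "E A D \<subseteq> words_of B (Suc D)" if "A \<subseteq> {1..n}" for A D
    using P[OF that, of D] by (simp add: P_def)
  have E_span: "\<exists>j\<in>edge_space A (Suc n) D. \<exists>c\<in>level (E A D) (Suc D). f = j + c"
    if "A \<subseteq> {1..n}" "f \<in> level B (Suc D)" for A D f
    using P[OF that(1), of D] that(2) by (simp add: P_def)
  have E_direct: "c = 0"
    if "A \<subseteq> {1..n}" "j \<in> edge_space A (Suc n) D" "c \<in> level (E A D) (Suc D)" "j + c = 0" for A D j c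
    using P[OF that(1), of D] that(2-4) by (simp add: P_def)
  have E_card: "card (E A D) + fun_vs.dim (edge_space A (Suc n) D) = card (words_of B (Suc D))"
    if "A \<subseteq> {1..n}" for A D
    using P[OF that, of D] by (simp add: P_def)
  define C where "C A = (if A \<subseteq> {1..n} then \<Union>D. E A D else {})" for A
  have C_words: "words_of (C A) (Suc D) = E A D" if "A \<subseteq> {1..n}" for A D
    using that E[OF that] by (fastforce simp: C_def words_of_def)
  have C_level: "level (C A) (Suc D) = level (E A D) (Suc D)" if "A \<subseteq> {1..n}" for A D
    unfolding level_eq C_words[OF that] using E[OF that, of D] by (auto simp: words_of_def)
  have "Q_extension n B V C"
  proof
    show "C A \<subseteq> B" for A
    proof
      fix w assume "w \<in> C A"
      then obtain D where "A \<subseteq> {1..n}" "w \<in> E A D" by (auto simp: C_def split: if_splits)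
      then have "w \<in> words_of B (Suc D)" using E by blast
      then show "w \<in> B" by (simp add: words_of_def)
    qed
  next
    fix A D and f :: "'f word_fun" assume A: "A \<subseteq> {1..n}" and f: "f \<in> level B (Suc D)"
    show "\<exists>m c. (\<forall>j. m j \<in> level B D) \<and> c \<in> level (C A) (Suc D) \<and> f = edge_sum (edge V) A (Suc n) m + c"
      using E_span[OF A f] unfolding C_level[OF A] edge_space_def by blast
  next
    fix A D m c assume A: "A \<subseteq> {1..n}" and "\<And>j. m j \<in> level B D" "c \<in> level (C A) (Suc D)"
      "edge_sum (edge V) A (Suc n) m + c = 0"
    then show "c = 0" using E_direct[OF A, of "edge_sum (edge V) A (Suc n) m" D c]
      unfolding C_level[OF A] edge_space_def by blast
  qed
  moreover have "gf (C A) = (1 - fps_X) ^ card A * gf B" if A: "A \<subseteq> {1..n}" for A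
  proof -
    have "(of_nat (card (E A D)) :: rat) + of_nat (fun_vs.dim (edge_space A (Suc n) D)) = of_nat (card (words_of B (Suc D)))" for D
      using E_card[OF A, of D] by (metis of_nat_add)
    then have "gf (C A) = codim_gf A (Suc n)"
      unfolding gf_def codim_gf_def words_of_Suc[symmetric] C_words[OF A] by (intro fps_ext) (simp add: algebra_simps)
    moreover have "A \<inter> {..<Suc n} = A" using A by auto
    ultimately show ?thesis using codim_gf_eq[OF A, of "Suc n"] by simp
  qed
  ultimately show ?thesis by blast
qed

end

section \<open>Generating functions of the new basis\<close>

lemma gf_append:
  assumes P: "\<And>D. finite {w \<in> P. length w = D}" and Q: "\<And>D. finite {w \<in> Q. length w = D}"
    and inj: "inj_on (\<lambda>(p, q). p @ q) (P \<times> Q)"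
  shows "gf {p @ q | p q. p \<in> P \<and> q \<in> Q} = gf P * gf Q"
proof (rule fps_ext)
  fix D
  let ?p = "\<lambda>i. {w \<in> P. length w = i}" and ?q = "\<lambda>i. {w \<in> Q. length w = i}"
  have eq: "{w \<in> {p @ q | p q. p \<in> P \<and> q \<in> Q}. length w = D}
      = (\<lambda>(p, q). p @ q) ` (\<Union>i\<in>{0..D}. ?p i \<times> ?q (D - i))"
    by (auto simp: image_iff)
  have "card {w \<in> {p @ q | p q. p \<in> P \<and> q \<in> Q}. length w = D} = card (\<Union>i\<in>{0..D}. ?p i \<times> ?q (D - i))"
    unfolding eq by (rule card_image, rule inj_on_subset[OF inj]) auto
  also have "\<dots> = (\<Sum>i=0..D. card (?p i \<times> ?q (D - i)))"
    by (rule card_UN_disjoint) (use P Q in auto)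
  finally show "fps_nth (gf {p @ q | p q. p \<in> P \<and> q \<in> Q}) D = fps_nth (gf P * gf Q) D"
    by (simp add: gf_def fps_mult_nth card_cartesian_product)
qed

lemma gf_Nil: "gf {[]} = 1"
proof (rule fps_ext)
  fix D
  have "{w \<in> {[] :: 'x list}. length w = D} = (if D = 0 then {[]} else {})" by auto
  then show "fps_nth (gf {[] :: 'x list}) D = fps_nth 1 D" by (simp add: gf_def)
qed

lemma gf_Cons: "gf ((#) Z ` P) = fps_X * gf P"
proof (rule fps_ext)
  fix D
  have "{w \<in> (#) Z ` P. length w = D} = (if D = 0 then {} else (#) Z ` {w \<in> P. length w = D - 1})"
    by auto
  then show "fps_nth (gf ((#) Z ` P)) D = fps_nth (fps_X * gf P) D"
    by (simp add: gf_def card_image)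
qed

lemma gf_Un:
  assumes "P \<inter> Q = {}" "\<And>D. finite {w \<in> P. length w = D}" "\<And>D. finite {w \<in> Q. length w = D}"
  shows "gf (P \<union> Q) = gf P + gf Q"
proof (rule fps_ext)
  fix D
  have "{w \<in> P \<union> Q. length w = D} = {w \<in> P. length w = D} \<union> {w \<in> Q. length w = D}" by auto
  then have "card {w \<in> P \<union> Q. length w = D} = card {w \<in> P. length w = D} + card {w \<in> Q. length w = D}"
    using assms(1) by (simp only:) (intro card_Un_disjoint assms(2,3), auto)
  then show "fps_nth (gf (P \<union> Q)) D = fps_nth (gf P + gf Q) D" by (simp add: gf_def)
qed

lemma gf_UN:
  assumes "finite S" "\<And>A A'. A \<in> S \<Longrightarrow> A' \<in> S \<Longrightarrow> A \<noteq> A' \<Longrightarrow> P A \<inter> P A' = {}"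
    "\<And>A D. A \<in> S \<Longrightarrow> finite {w \<in> P A. length w = D}"
  shows "gf (\<Union>A\<in>S. P A) = (\<Sum>A\<in>S. gf (P A))"
  using assms
proof (induction S rule: finite_induct)
  case empty
  show ?case by (rule fps_ext) (simp add: gf_def)
next
  case (insert A S)
  have "finite {w \<in> \<Union>A\<in>S. P A. length w = D}" for D
  proof -
    have "{w \<in> \<Union>A\<in>S. P A. length w = D} = (\<Union>A\<in>S. {w \<in> P A. length w = D})" by auto
    then show ?thesis using insert by simp
  qed
  moreover have "P A \<inter> (\<Union>A\<in>S. P A) = {}" using insert by blast
  ultimately have "gf (P A \<union> (\<Union>A\<in>S. P A)) = gf (P A) + gf (\<Union>A\<in>S. P A)"
    using insert.prems by (intro gf_Un) auto
  then show ?case using insert by simp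
qed

lemma sum_Pow_power: "finite S \<Longrightarrow> (\<Sum>A\<in>Pow S. x ^ card A) = (1 + x :: 'a::comm_ring_1) ^ card S"
proof (induction S rule: finite_induct)
  case (insert a S)
  have disj: "Pow S \<inter> insert a ` Pow S = {}" using insert by auto
  have inj: "inj_on (insert a) (Pow S)" using insert by (auto simp: inj_on_def)
  have "(\<Sum>A\<in>Pow (insert a S). x ^ card A) = (\<Sum>A\<in>Pow S. x ^ card A) + (\<Sum>A\<in>insert a ` Pow S. x ^ card A)"
    unfolding Pow_insert using insert disj by (intro sum.union_disjoint) auto
  also have "(\<Sum>A\<in>insert a ` Pow S. x ^ card A) = (\<Sum>A\<in>Pow S. x * x ^ card A)"
  proof -
    have "card (insert a A) = Suc (card A)" if "A \<in> Pow S" for A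
      using that insert finite_subset by (intro card_insert_disjoint) auto
    then show ?thesis unfolding sum.reindex[OF inj] by (intro sum.cong) auto
  qed
  finally show ?case using insert by (simp add: sum_distrib_left[symmetric] algebra_simps)
qed simp

context Q_extension
begin

lemma finite_B_length: "finite {w \<in> B. length w = D}"
  by (rule finite_subset[OF _ finite_words[of n D]]) (use B_words in auto)

lemma finite_tails_length: "finite {w \<in> tails. length w = D}"
  by (rule finite_subset[OF _ finite_words[of N D]]) (use tails_words in auto)

lemma inj_append: "P \<subseteq> B \<Longrightarrow> inj_on (\<lambda>(p, q). p @ q) (P \<times> tails)"
proof (rule inj_onI, clarify)
  fix b t b' t' assume "P \<subseteq> B" "t \<in> tails" "b \<in> P" "t' \<in> tails" "b' \<in> P" "b @ t = b' @ t'"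
  then show "b = b' \<and> t = t'" using pre_append suf_append by (metis subsetD)
qed

lemma gf_B': "gf B' = gf B * gf tails"
  unfolding B'_def by (rule gf_append[OF finite_B_length finite_tails_length inj_append[OF order_refl]])

text \<open>A tail is empty or, in exactly one way, a letter \<open>insert N A\<close>, a word of
  \<open>C A\<close> and a shorter tail.\<close>

lemma gf_tails: "gf tails = 1 + fps_X * (\<Sum>A\<in>Pow {1..n}. gf (C A)) * gf tails"
proof -
  define P where "P A = {c @ t | c t. c \<in> C A \<and> t \<in> tails}" for A
  have tails: "tails = {[]} \<union> (\<Union>A\<in>Pow {1..n}. (#) (insert N A) ` P A)"
  proof (intro equalityI subsetI)
    fix t assume "t \<in> tails"
    then show "t \<in> {[]} \<union> (\<Union>A\<in>Pow {1..n}. (#) (insert N A) ` P A)"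
      by (cases rule: tails.cases) (auto simp: P_def)
  next
    fix t assume "t \<in> {[]} \<union> (\<Union>A\<in>Pow {1..n}. (#) (insert N A) ` P A)"
    then consider "t = []" | A c s where "A \<subseteq> {1..n}" "c \<in> C A" "s \<in> tails" "t = insert N A # c @ s"
      unfolding P_def by blast
    then show "t \<in> tails" by cases (auto simp only: intro: tails.intros)
  qed
  have finP: "finite {w \<in> (#) (insert N A) ` P A. length w = D}" if "A \<in> Pow {1..n}" for A D
    by (rule finite_subset[OF _ finite_tails_length[of D]]) (use that tails in blast)
  have "gf (P A) = gf (C A) * gf tails" if "A \<in> Pow {1..n}" for A
    unfolding P_def
  proof (rule gf_append[OF _ finite_tails_length inj_append[OF C_B]])
    show "finite {w \<in> C A. length w = D}" for D
      by (rule finite_subset[OF _ finite_B_length[of D]]) (use C_B in blast)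
  qed
  moreover have "gf (\<Union>A\<in>Pow {1..n}. (#) (insert N A) ` P A) = (\<Sum>A\<in>Pow {1..n}. gf ((#) (insert N A) ` P A))"
  proof (rule gf_UN[OF _ _ finP])
    fix A A' assume "A \<in> Pow {1..n}" "A' \<in> Pow {1..n}" "A \<noteq> A'"
    then have "insert N A \<noteq> insert N A'"
      by (metis Diff_insert_absorb PowD atLeastAtMost_iff not_less_eq_eq order_refl subsetD)
    then show "(#) (insert N A) ` P A \<inter> (#) (insert N A') ` P A' = {}" by auto
  qed simp
  moreover have "gf ({[]} \<union> (\<Union>A\<in>Pow {1..n}. (#) (insert N A) ` P A)) = gf {[] :: nat set list} + gf (\<Union>A\<in>Pow {1..n}. (#) (insert N A) ` P A)"
  proof (rule gf_Un)
    show "finite {w \<in> \<Union>A\<in>Pow {1..n}. (#) (insert N A) ` P A. length w = D}" for D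
      by (rule finite_subset[OF _ finite_tails_length[of D]]) (use tails in blast)
  qed auto
  moreover have "gf {[] :: nat set list} = 1" by (rule gf_Nil)
  ultimately have "gf ({[]} \<union> (\<Union>A\<in>Pow {1..n}. (#) (insert N A) ` P A))
      = 1 + (\<Sum>A\<in>Pow {1..n}. fps_X * (gf (C A) * gf tails))"
    by (simp add: gf_Cons)
  then show ?thesis
    unfolding tails[symmetric] by (simp add: sum_distrib_left sum_distrib_right mult.assoc)
qed

text \<open>With \<open>q = (2 - t)^n\<close>, the complements contribute \<open>q * gf B\<close> in
  total, because \<open>(1 - t)^|A|\<close> sums to \<open>q\<close> over the subsets. Eliminating
  the series of the tails replaces \<open>q\<close> by \<open>(2 - t) * q\<close>.\<close>

lemma gf_step:
  assumes C: "\<And>A. A \<subseteq> {1..n} \<Longrightarrow> gf (C A) = (1 - fps_X) ^ card A * gf B"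
    and B: "gf B * (1 - fps_X * (2 - fps_X) ^ n) = 1 - fps_X"
  shows "gf B' * (1 - fps_X * (2 - fps_X) ^ N) = 1 - fps_X"
proof -
  define q h g where "q = (2 - fps_X :: rat fps) ^ n" and "h = gf B" and "g = gf tails"
  have "(\<Sum>A\<in>Pow {1..n}. gf (C A)) = (\<Sum>A\<in>Pow {1..n}. (1 - fps_X) ^ card A) * h"
    unfolding sum_distrib_right h_def by (rule sum.cong) (auto simp: C)
  also have "\<dots> = q * h" by (simp add: sum_Pow_power q_def)
  finally have g: "g = 1 + fps_X * (q * h) * g" using gf_tails by (simp add: g_def)
  have hq: "h * (1 - fps_X * q) = 1 - fps_X" using B by (simp add: h_def q_def)
  \<comment> \<open>Writing \<open>2 - t\<close> as \<open>1 + (1 - t)\<close> exposes the factor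
    \<open>h * (1 - t * q)\<close>, which is known.\<close>
  have "h * g * (1 - fps_X * ((2 - fps_X) * q)) = g * (h * (1 - fps_X * q)) - (1 - fps_X) * (fps_X * (q * h) * g)"
    by (simp add: algebra_simps)
  also have "\<dots> = (1 - fps_X) * (g - fps_X * (q * h) * g)" unfolding hq by (simp add: algebra_simps)
  also have "\<dots> = 1 - fps_X" using g by (simp add: diff_eq_eq)
  finally show ?thesis by (simp add: gf_B' q_def h_def g_def)
qed

end

text \<open>The only index set is \<open>{}\<close>, so the conditions on edges are vacuous and the
  module is the ground field, spanned by the empty word.\<close>

lemma Q_model_0: "Q_model 0 {[]} (\<lambda>_ _. 0)"
  by unfold_locales (auto simp: edge_def)

lemma model_exists:
  "\<exists>B (V :: nat set \<Rightarrow> (nat set list \<Rightarrow> 'f::field) \<Rightarrow> 'f word_fun).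
     Q_model n B V \<and> universal n B V \<and> gf B * (1 - fps_X * (2 - fps_X) ^ n) = 1 - fps_X"
proof (induction n)
  case 0
  have "universal 0 {[]} (\<lambda>_ _. 0 :: 'f word_fun)"
    unfolding universal_def
  proof (intro allI impI)
    fix L :: "nat set \<Rightarrow> 'f word_fun \<Rightarrow> 'f word_fun"
      and M I and A :: "nat set" and D and f z :: "'f word_fun"
    assume R: "Q_rep 0 L M I" and "A \<subseteq> {1..0}"
    then have "A = {}" by simp
    then show "ev L 0 z - L A (ev L f z) \<in> I"
      using Q_rep.I_zero[OF R] by (simp only: ev_0 Q_rep.L_empty[OF R] diff_self)
  qed
  moreover have "gf {[] :: nat set list} = 1" by (rule gf_Nil)
  then have "gf {[] :: nat set list} * (1 - fps_X * (2 - fps_X) ^ 0) = 1 - fps_X" by simp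
  ultimately show ?case using Q_model_0 by blast
next
  case (Suc n)
  then obtain B and V :: "nat set \<Rightarrow> 'f word_fun \<Rightarrow> 'f word_fun"
    where M: "Q_model n B V" and U: "universal n B V"
      and G: "gf B * (1 - fps_X * (2 - fps_X) ^ n) = 1 - fps_X"
    by blast
  interpret Q_model n B V by (rule M)
  obtain C where E: "Q_extension n B V C" and C: "\<And>A. A \<subseteq> {1..n} \<Longrightarrow> gf (C A) = (1 - fps_X) ^ card A * gf B"
    using complements_exist by blast
  interpret E: Q_extension n B V C by (rule E)
  obtain d where d: "\<And>A. A \<subseteq> {1..n} \<Longrightarrow> E.raising d A" using E.raising_exists by blast
  interpret R: Q_raising n B V C d by unfold_locales (rule d)
  show ?case
    using R.Q_model_V' R.universal_V'[OF U] E.gf_step[OF C G] by blast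
qed

subsection \<open>The action of the tensor algebra\<close>

definition restr :: "'x list set \<Rightarrow> ('x list \<Rightarrow> 'f::field) \<Rightarrow> nat \<Rightarrow> 'x list \<Rightarrow> 'f" where
  "restr B f D = (\<lambda>w. if w \<in> B \<and> Suc (length w) = D then f w else 0)"

lemma restr_level: "restr B f D \<in> level B D"
  by (auto simp: restr_def level_def)

lemma restr_id: "f \<in> level B D \<Longrightarrow> restr B f D = f"
  by (auto simp: restr_def level_def fun_eq_iff)

lemma restr_other: "f \<in> level B D \<Longrightarrow> E \<noteq> D \<Longrightarrow> restr B f E = 0"
  by (auto simp: restr_def level_def fun_eq_iff)

lemma restr_diff: "restr B (f - g) D = restr B f D - restr B g D"
  by (auto simp: restr_def fun_eq_iff)

lemma restr_smul: "restr B (smul a f) D = smul a (restr B f D)"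
  by (auto simp: restr_def fun_eq_iff smul_apply)

context Q_model
begin

text \<open>
  The operators \<open>V A\<close> are controlled on the individual levels only; \<open>VV A\<close> agrees with them there and
  is linear on all functions, so that products of tensors act by composition.
\<close>

definition VV :: "nat set \<Rightarrow> 'f word_fun \<Rightarrow> 'f word_fun" where
  "VV A f = (\<lambda>w. V A (restr B f (length w)) w)"

lemma VV_diff:
  assumes "A \<subseteq> {1..n}"
  shows "VV A (f - g) = VV A f - VV A g"
  by (rule ext) (simp add: VV_def restr_diff V_diff[OF assms restr_level restr_level])

lemma VV_smul:
  assumes "A \<subseteq> {1..n}"
  shows "VV A (smul a f) = smul a (VV A f)"
  by (rule ext) (simp add: VV_def restr_smul V_smul[OF assms restr_level] smul_apply)

lemma VV_empty: "VV {} f = 0"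
  by (rule ext) (simp add: VV_def V_empty)

lemma restr_VV:
  assumes "A \<subseteq> {1..n}"
  shows "restr B (VV A f) (Suc D) = V A (restr B f D)"
proof
  fix w
  show "restr B (VV A f) (Suc D) w = V A (restr B f D) w"
  proof (cases "w \<in> B \<and> length w = D")
    case True
    then have "restr B (VV A f) (Suc D) w = VV A f w" by (simp add: restr_def[of B "VV A f"])
    then show ?thesis using True by (simp add: VV_def)
  next
    case False
    then have "V A (restr B f D) w = 0"
      using V_closed[OF assms restr_level[of B f D]] unfolding level_def by blast
    then show ?thesis using False by (auto simp: restr_def[of B "VV A f"])
  qed
qed

lemma VV_outside:
  assumes "A \<subseteq> {1..n}" "w \<notin> B"
  shows "VV A f w = 0"
  using V_closed[OF assms(1) restr_level[of B f "length w"]] assms(2) unfolding VV_def level_def by blast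

lemma VV_level:
  assumes "A \<subseteq> {1..n}" "f \<in> level B D"
  shows "VV A f = V A f"
proof
  fix w
  show "VV A f w = V A f w"
  proof (cases "length w = D")
    case True
    then show ?thesis by (simp add: VV_def restr_id[OF assms(2)])
  next
    case False
    then have "restr B f (length w) = 0" by (rule restr_other[OF assms(2)])
    moreover have "V A 0 = 0" using V_diff[OF assms(1), of 0 0 0] by simp
    moreover have "V A f w = 0" using V_closed[OF assms] False by (auto simp: level_def)
    ultimately show ?thesis by (simp add: VV_def)
  qed
qed

lemma restr_edge_VV:
  assumes "A \<subseteq> {1..n}"
  shows "restr B (edge VV A j f) (Suc D) = edge V A j (restr B f D)"
proof -
  have "A - {j} \<subseteq> {1..n}" using assms by auto
  then show ?thesis using assms by (simp add: edge_def restr_diff restr_VV)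
qed

lemma VV_comm:
  assumes A: "A \<subseteq> {1..n}" "i \<in> A" "j \<in> A" "i \<noteq> j"
  shows "edge VV A i (edge VV (A - {i}) j f) = edge VV A j (edge VV (A - {j}) i f)"
proof
  fix w
  have sub: "A - {i} \<subseteq> {1..n}" "A - {j} \<subseteq> {1..n}" using A by auto
  show "edge VV A i (edge VV (A - {i}) j f) w = edge VV A j (edge VV (A - {j}) i f) w"
  proof (cases "w \<in> B")
    case False
    then show ?thesis using VV_outside A(1) sub by (simp add: edge_def)
  next
    case True
    have "restr B (edge VV A i (edge VV (A - {i}) j f)) (Suc (length w))
        = restr B (edge VV A j (edge VV (A - {j}) i f)) (Suc (length w))"
    proof (cases w)
      case Nil
      \<comment> \<open>For the empty word the inner vector is restricted to index 0, where the
        level is zero, so both sides vanish.\<close>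
      have "restr B g 0 = 0" for g :: "'f word_fun" by (auto simp: restr_def fun_eq_iff)
      then show ?thesis using Nil edge_zero A(1) by (simp add: restr_edge_VV)
    next
      case (Cons Z v)
      show ?thesis unfolding Cons list.size add_Suc_right add_0_right
        unfolding restr_edge_VV[OF A(1)] restr_edge_VV[OF sub(1)] restr_edge_VV[OF sub(2)]
        by (rule V_comm[OF A restr_level])
    qed
    from fun_cong[OF this, of w] show ?thesis using True by (simp add: restr_def)
  qed
qed

lemma VV_word: "Z # w \<in> B \<Longrightarrow> edge VV Z (Max Z) (unit_vec w) = unit_vec (Z # w)"
proof -
  assume Zw: "Z # w \<in> B"
  then have w: "w \<in> B" and e: "edge V Z (Max Z) (unit_vec w) = unit_vec (Z # w)" using V_word by auto
  have "(unit_vec w :: 'f word_fun) \<in> level B (Suc (length w))"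
    using w by (auto simp: level_def unit_vec_def)
  moreover have "Z \<subseteq> {1..n}" "Z - {Max Z} \<subseteq> {1..n}" using B_words[OF Zw] by (auto simp: generators_def)
  ultimately show ?thesis using e by (simp add: edge_def VV_level[of _ _ "Suc (length w)"])
qed

definition act :: "'f word_fun \<Rightarrow> 'f word_fun \<Rightarrow> 'f word_fun" where
  "act p f = (\<Sum>u | p u \<noteq> 0. smul (p u) (foldr VV u f))"

lemma act_eq:
  assumes "finite W" "\<And>u. p u \<noteq> 0 \<Longrightarrow> u \<in> W"
  shows "act p f = (\<Sum>u\<in>W. smul (p u) (foldr VV u f))"
  unfolding act_def by (rule sum.mono_neutral_left) (use assms in auto)

lemma act_add:
  assumes "finite {u. p u \<noteq> 0}" "finite {u. q u \<noteq> 0}"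
  shows "act (p + q) f = act p f + act q f"
proof -
  let ?W = "{u. p u \<noteq> 0} \<union> {u. q u \<noteq> 0}"
  have fin: "finite ?W" using assms by simp
  have "act (p + q) f = (\<Sum>u\<in>?W. smul ((p + q) u) (foldr VV u f))"
    by (rule act_eq[OF fin]) auto
  also have "\<dots> = (\<Sum>u\<in>?W. smul (p u) (foldr VV u f)) + (\<Sum>u\<in>?W. smul (q u) (foldr VV u f))"
    by (simp add: smul_add_left sum.distrib)
  also have "\<dots> = act p f + act q f"
    by (intro arg_cong2[of _ _ _ _ "(+)"] act_eq[symmetric] fin) auto
  finally show ?thesis .
qed

lemma act_smul: "act (smul a p) f = smul a (act p f)"
proof (cases "a = 0")
  case True
  then show ?thesis by (simp add: act_def)
next
  case False
  then have "{u. smul a p u \<noteq> 0} = {u. p u \<noteq> 0}" by (simp add: smul_apply)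
  then show ?thesis by (simp add: act_def fun_vs.scale_sum_right smul_smul smul_apply)
qed

lemma act_diff:
  assumes "finite {u. p u \<noteq> 0}" "finite {u. q u \<noteq> 0}"
  shows "act (p - q) f = act p f - act q f"
proof -
  have "p - q = p + smul (-1) q" by (simp add: smul_def fun_eq_iff)
  moreover have "finite {u. smul (-1) q u \<noteq> 0}" using assms(2) by (simp add: smul_apply)
  ultimately have "act (p - q) f = act p f + smul (-1) (act q f)"
    using act_add[OF assms(1), of "smul (-1) q" f] by (simp only: act_smul)
  then show ?thesis by simp
qed

lemma VV_0: "A \<subseteq> {1..n} \<Longrightarrow> VV A 0 = 0"
  using VV_diff[of A 0 0] by simp

lemma VV_add: "A \<subseteq> {1..n} \<Longrightarrow> VV A (f + g) = VV A f + VV A g"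
  using VV_diff[of A f "0 - g"] VV_diff[of A 0 g] VV_0[of A] by simp

lemma foldr_VV_sum:
  assumes "set u \<subseteq> generators n" "finite S"
  shows "foldr VV u (\<Sum>i\<in>S. smul (c i) (f i)) = (\<Sum>i\<in>S. smul (c i) (foldr VV u (f i)))"
  using assms(1)
proof (induction u)
  case (Cons A u)
  then have A: "A \<subseteq> {1..n}" by (auto simp: generators_def)
  have "VV A (\<Sum>i\<in>S. smul (c i) (g i)) = (\<Sum>i\<in>S. smul (c i) (VV A (g i)))" for g
    using assms(2)
  proof (induction S rule: finite_induct)
    case empty
    show ?case by (simp only: sum.empty VV_0[OF A])
  next
    case (insert x F)
    show ?case unfolding sum.insert[OF insert(1,2)] VV_add[OF A] VV_smul[OF A] insert.IH ..
  qed
  moreover have "foldr VV u (\<Sum>i\<in>S. smul (c i) (f i)) = (\<Sum>i\<in>S. smul (c i) (foldr VV u (f i)))"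
    by (rule Cons.IH) (use Cons.prems in auto)
  ultimately show ?case by (simp only: foldr.simps comp_apply)
qed simp

lemma act_mult:
  assumes p: "p \<in> carrier (tensor_algebra (generators n))" and q: "q \<in> carrier (tensor_algebra (generators n))"
  shows "act (p \<otimes>\<^bsub>tensor_algebra (generators n)\<^esub> q) f = act p (act q f)"
proof -
  let ?P = "{u. p u \<noteq> 0}" and ?Q = "{v. q v \<noteq> 0}"
  define W where "W = (\<lambda>(u, v). u @ v) ` (?P \<times> ?Q)"
  have fin: "finite ?P" "finite ?Q" using p q by (auto simp: tensor_algebra_def)
  then have finW: "finite W" by (simp add: W_def)
  define r where "r = p \<otimes>\<^bsub>tensor_algebra (generators n)\<^esub> q"
  have r: "r w = (\<Sum>(u, v) | u @ v = w. p u * q v)" for w by (simp add: r_def tensor_algebra_def)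
  have r': "r w = (\<Sum>x \<in> {x \<in> ?P \<times> ?Q. fst x @ snd x = w}. p (fst x) * q (snd x))" for w
    unfolding r case_prod_unfold
    by (rule sum.mono_neutral_right) (use finite_splits[of w] in \<open>auto simp: case_prod_unfold\<close>)
  have "act r f = (\<Sum>w\<in>W. smul (r w) (foldr VV w f))"
    by (rule act_eq[OF finW]) (auto simp: r W_def elim!: conv_nonzeroE)
  also have "\<dots> = (\<Sum>w\<in>W. \<Sum>x \<in> {x \<in> ?P \<times> ?Q. fst x @ snd x = w}. smul (p (fst x) * q (snd x)) (foldr VV (fst x @ snd x) f))"
    by (intro sum.cong refl) (simp add: r' fun_vs.scale_sum_left)
  also have "\<dots> = (\<Sum>x\<in>?P \<times> ?Q. smul (p (fst x) * q (snd x)) (foldr VV (fst x @ snd x) f))"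
    by (rule sum.group) (use fin finW in \<open>auto simp: W_def\<close>)
  also have "\<dots> = (\<Sum>u\<in>?P. \<Sum>v\<in>?Q. smul (p u * q v) (foldr VV (u @ v) f))"
    by (simp only: sum.cartesian_product case_prod_unfold)
  also have "\<dots> = (\<Sum>u\<in>?P. smul (p u) (foldr VV u (act q f)))"
  proof (rule sum.cong[OF refl])
    fix u assume "u \<in> ?P"
    then have u: "set u \<subseteq> generators n" using p by (auto simp: tensor_algebra_def)
    show "(\<Sum>v\<in>?Q. smul (p u * q v) (foldr VV (u @ v) f)) = smul (p u) (foldr VV u (act q f))"
      unfolding act_def foldr_VV_sum[OF u fin(2)] fun_vs.scale_sum_right
      by (simp add: smul_smul)
  qed
  finally show ?thesis by (simp add: r_def act_def)
qed

lemma act_basis_vec: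
  assumes "A \<subseteq> {1..n}"
  shows "act (basis_vec A) f = VV A f"
proof (cases "A = {}")
  case True
  then show ?thesis by (simp add: act_def basis_vec_def VV_empty)
next
  case False
  then show ?thesis by (subst act_eq[of "{[A]}"]) (auto simp: basis_vec_def split: if_splits)
qed

end

section \<open>The tensor algebra modulo the relations as a module over itself\<close>

lemma free_T_add: "p \<oplus>\<^bsub>free_T F n\<^esub> q = p + q"
  by (simp add: free_T_def tensor_algebra_add plus_fun_def)

lemma free_T_uminus: "p \<in> carrier (free_T F n) \<Longrightarrow> \<ominus>\<^bsub>free_T F n\<^esub> p = - p"
  by (simp add: free_T_def tensor_algebra_uminus fun_eq_iff)

lemma free_T_minus: "q \<in> carrier (free_T F n) \<Longrightarrow> p \<ominus>\<^bsub>free_T F n\<^esub> q = p - q"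
  by (simp add: a_minus_def free_T_add free_T_uminus)

lemma free_T_smul: "scalar c \<otimes>\<^bsub>free_T F n\<^esub> p = smul c p"
  by (simp add: free_T_def scalar_mult smul_def)

lemma free_T_zero: "\<zero>\<^bsub>free_T F n\<^esub> = 0"
  by (simp add: free_T_def tensor_algebra_def zero_fun_def)

lemma free_T_carrier_finite: "p \<in> carrier (free_T F n) \<Longrightarrow> finite {u. p u \<noteq> 0}"
  by (simp add: free_T_def tensor_algebra_def)

text \<open>Left multiplication by \<open>basis_vec A\<close>, written on words so that it is
  independent of \<open>n\<close> and linear on arbitrary functions, as \<open>Q_rep\<close> demands
  of its operators.\<close>

definition left_mult :: "nat set \<Rightarrow> (nat set list \<Rightarrow> 'f::field) \<Rightarrow> 'f word_fun" where
  "left_mult A p = (\<lambda>w. case w of [] \<Rightarrow> 0 | Z # v \<Rightarrow> if A \<noteq> {} \<and> Z = A then p v else 0)"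

lemma left_mult_eq: "left_mult A p = basis_vec A \<otimes>\<^bsub>free_T F n\<^esub> p"
proof
  fix w :: "nat set list"
  show "left_mult A p w = (basis_vec A \<otimes>\<^bsub>free_T F n\<^esub> p) w"
  proof (cases "A \<noteq> {} \<and> w \<noteq> [] \<and> hd w = A")
    case True
    then obtain t where A: "A \<noteq> {}" and w: "w = A # t" by (cases w) auto
    have "(\<Sum>(u, v) | u @ v = A # t. basis_vec A u * p v) = (\<Sum>(u, v)\<in>{([A], t)}. basis_vec A u * p v)"
      by (rule sum.mono_neutral_right) (auto simp: finite_splits basis_vec_def split: if_splits)
    then show ?thesis using A by (simp add: w left_mult_def free_T_def tensor_algebra_def basis_vec_def)
  next
    case False
    then have "(\<Sum>(u, v) | u @ v = w. basis_vec A u * p v) = 0"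
      by (intro sum.neutral) (auto simp: basis_vec_def)
    moreover have "left_mult A p w = 0" using False by (auto simp: left_mult_def split: list.split)
    ultimately show ?thesis by (simp add: free_T_def tensor_algebra_def)
  qed
qed

text \<open>Expanding the two products of edges, the terms \<open>v A * v (A - {i, j})\<close>
  cancel and the relator remains. Acting on a general \<open>f\<close> puts the identity in the form
  of \<open>L_comm\<close>.\<close>

lemma relator_mult:
  fixes F :: "'f::field itself"
  assumes A: "A \<subseteq> {1..n}" and f: "f \<in> carrier (free_T F n)"
  shows "relator F n A i j \<otimes>\<^bsub>free_T F n\<^esub> f
    = edge left_mult A i (edge left_mult (A - {i}) j f) - edge left_mult A j (edge left_mult (A - {j}) i f)"
proof -
  interpret ring "free_T F n" by (rule ring_free_T)
  define a b c e where "a = (basis_vec A :: 'f word_fun)" and "b = (basis_vec (A - {i}) :: 'f word_fun)"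
    and "c = (basis_vec (A - {j}) :: 'f word_fun)" and "e = (basis_vec (A - {i, j}) :: 'f word_fun)"
  have cl: "a \<in> carrier (free_T F n)" "b \<in> carrier (free_T F n)" "c \<in> carrier (free_T F n)" "e \<in> carrier (free_T F n)"
    unfolding a_def b_def c_def e_def using A by (auto intro!: basis_vec_closed)
  have sets: "A - {i} - {j} = A - {i, j}" "A - {j} - {i} = A - {i, j}" by auto
  have "relator F n A i j \<otimes>\<^bsub>free_T F n\<^esub> f
      = a \<otimes>\<^bsub>free_T F n\<^esub> (b \<otimes>\<^bsub>free_T F n\<^esub> f) \<ominus>\<^bsub>free_T F n\<^esub> a \<otimes>\<^bsub>free_T F n\<^esub> (c \<otimes>\<^bsub>free_T F n\<^esub> f)
        \<oplus>\<^bsub>free_T F n\<^esub> (b \<otimes>\<^bsub>free_T F n\<^esub> (e \<otimes>\<^bsub>free_T F n\<^esub> f) \<ominus>\<^bsub>free_T F n\<^esub> c \<otimes>\<^bsub>free_T F n\<^esub> (e \<otimes>\<^bsub>free_T F n\<^esub> f))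
        \<ominus>\<^bsub>free_T F n\<^esub> b \<otimes>\<^bsub>free_T F n\<^esub> (b \<otimes>\<^bsub>free_T F n\<^esub> f) \<oplus>\<^bsub>free_T F n\<^esub> c \<otimes>\<^bsub>free_T F n\<^esub> (c \<otimes>\<^bsub>free_T F n\<^esub> f)"
    unfolding relator_def Let_def a_def[symmetric] b_def[symmetric] c_def[symmetric] e_def[symmetric]
    using cl f
    by (simp add: a_minus_def l_distr r_distr l_minus r_minus m_assoc numeral_2_eq_2)
  moreover have "\<dots> = a \<otimes>\<^bsub>free_T F n\<^esub> (b \<otimes>\<^bsub>free_T F n\<^esub> f) - a \<otimes>\<^bsub>free_T F n\<^esub> (c \<otimes>\<^bsub>free_T F n\<^esub> f)
        + (b \<otimes>\<^bsub>free_T F n\<^esub> (e \<otimes>\<^bsub>free_T F n\<^esub> f) - c \<otimes>\<^bsub>free_T F n\<^esub> (e \<otimes>\<^bsub>free_T F n\<^esub> f))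
        - b \<otimes>\<^bsub>free_T F n\<^esub> (b \<otimes>\<^bsub>free_T F n\<^esub> f) + c \<otimes>\<^bsub>free_T F n\<^esub> (c \<otimes>\<^bsub>free_T F n\<^esub> f)"
    using cl f by (simp add: free_T_add free_T_minus)
  moreover have "edge left_mult A i g = a \<otimes>\<^bsub>free_T F n\<^esub> g - b \<otimes>\<^bsub>free_T F n\<^esub> g"
    "edge left_mult (A - {i}) j g = b \<otimes>\<^bsub>free_T F n\<^esub> g - e \<otimes>\<^bsub>free_T F n\<^esub> g"
    "edge left_mult A j g = a \<otimes>\<^bsub>free_T F n\<^esub> g - c \<otimes>\<^bsub>free_T F n\<^esub> g"
    "edge left_mult (A - {j}) i g = c \<otimes>\<^bsub>free_T F n\<^esub> g - e \<otimes>\<^bsub>free_T F n\<^esub> g" for g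
    unfolding edge_def left_mult_eq[where F = F and n = n] sets a_def b_def c_def e_def by simp_all
  moreover have "x \<otimes>\<^bsub>free_T F n\<^esub> (g - h) = x \<otimes>\<^bsub>free_T F n\<^esub> g - x \<otimes>\<^bsub>free_T F n\<^esub> h"
    if "x \<in> carrier (free_T F n)" "g \<in> carrier (free_T F n)" "h \<in> carrier (free_T F n)" for x g h
  proof -
    have "x \<otimes>\<^bsub>free_T F n\<^esub> (g \<ominus>\<^bsub>free_T F n\<^esub> h)
        = x \<otimes>\<^bsub>free_T F n\<^esub> g \<ominus>\<^bsub>free_T F n\<^esub> x \<otimes>\<^bsub>free_T F n\<^esub> h"
      using that by (simp add: a_minus_def r_distr r_minus)
    then show ?thesis using that by (simp add: free_T_minus)
  qed
  ultimately show ?thesis using cl f by simp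
qed

lemma Q_rep_left_mult:
  fixes F :: "'f::field itself"
  shows "Q_rep n (left_mult :: nat set \<Rightarrow> 'f word_fun \<Rightarrow> 'f word_fun) (carrier (free_T F n)) (relation_ideal F n)"
proof -
  interpret ring "free_T F n" by (rule ring_free_T)
  interpret I: ideal "relation_ideal F n" "free_T F n" by (rule relation_ideal_ideal)
  show ?thesis
  proof
    show "0 \<in> relation_ideal F n" "0 \<in> carrier (free_T F n)"
      using I.zero_closed zero_closed by (simp_all add: free_T_zero)
    show "f \<in> carrier (free_T F n) \<Longrightarrow> g \<in> carrier (free_T F n) \<Longrightarrow> f - g \<in> carrier (free_T F n)" for f g
      using minus_closed[of f g] by (simp add: free_T_minus)
    show "f - g \<in> relation_ideal F n" if "f \<in> relation_ideal F n" "g \<in> relation_ideal F n" for f g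
      using I.a_closed[OF that(1) I.a_inv_closed[OF that(2)]]
      unfolding a_minus_def[symmetric] free_T_minus[OF I.Icarr[OF that(2)]] .
    have sc: "scalar a \<in> carrier (free_T F n)" for a by (simp add: free_T_def scalar_closed)
    show "f \<in> carrier (free_T F n) \<Longrightarrow> smul a f \<in> carrier (free_T F n)" for f a
      using m_closed[OF sc] by (simp add: free_T_smul)
    show "f \<in> relation_ideal F n \<Longrightarrow> smul a f \<in> relation_ideal F n" for f a
      using I.I_l_closed[OF _ sc] by (simp add: free_T_smul)
    show "left_mult A (f - g) = left_mult A f - left_mult A g" for A and f g :: "'f word_fun"
      by (rule ext) (simp add: left_mult_def split: list.split)
    show "left_mult A (smul a f) = smul a (left_mult A f)" for A a and f :: "'f word_fun"
      by (rule ext) (simp add: left_mult_def smul_apply split: list.split)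
    show "left_mult {} f = 0" for f :: "'f word_fun"
      by (rule ext) (simp add: left_mult_def split: list.split)
    show "A \<subseteq> {1..n} \<Longrightarrow> f \<in> carrier (free_T F n) \<Longrightarrow> left_mult A f \<in> carrier (free_T F n)" for A f
      unfolding left_mult_eq[where F = F and n = n] by (intro m_closed basis_vec_closed)
    show "A \<subseteq> {1..n} \<Longrightarrow> f \<in> relation_ideal F n \<Longrightarrow> left_mult A f \<in> relation_ideal F n" for A f
      unfolding left_mult_eq[where F = F and n = n] by (intro I.I_l_closed basis_vec_closed)
    show "edge left_mult A i (edge left_mult (A - {i}) j f) - edge left_mult A j (edge left_mult (A - {j}) i f)
        \<in> relation_ideal F n"
      if A: "A \<subseteq> {1..n}" and ij: "i \<in> A" "j \<in> A" "i \<noteq> j" and f: "f \<in> carrier (free_T F n)" for A i j f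
    proof -
      have "relator F n A i j \<in> relation_ideal F n"
        unfolding relation_ideal_def using genideal_self[OF relators_closed] A ij by (force simp: relators_def)
      then show ?thesis unfolding relator_mult[OF A f, symmetric] using f by (rule I.I_r_closed)
    qed
  qed
qed

lemma finite_supp_sum_unit:
  assumes "finite {u. p u \<noteq> 0}"
  shows "p = (\<Sum>u | p u \<noteq> 0. smul (p u) (unit_vec u))"
proof
  fix v
  have "(\<Sum>u | p u \<noteq> 0. p u * (if v = u then 1 else 0)) = (if p v \<noteq> 0 then p v else 0)"
    using assms by (simp add: if_distrib sum.delta cong: if_cong)
  then show "p v = (\<Sum>u | p u \<noteq> 0. smul (p u) (unit_vec u)) v"
    by (simp add: sum_fun_apply smul_apply unit_vec_def)
qed

lemma ev_sum_smul:
  assumes S: "finite S" and g: "\<And>u. u \<in> S \<Longrightarrow> g u \<in> word_supp n D"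
  shows "ev L (\<Sum>u\<in>S. smul (c u) (g u)) z = (\<Sum>u\<in>S. smul (c u) (ev L (g u) z))"
proof -
  let ?W = "{w. set w \<subseteq> generators n \<and> length w \<le> D}"
  have ev_g: "ev L (g u) z = (\<Sum>w\<in>?W. smul (g u w) (word_act L w z))" if "u \<in> S" for u
    by (rule ev_eq[OF finite_words]) (use g[OF that] in \<open>auto simp: word_supp_def\<close>)
  have app: "(\<Sum>u\<in>S. smul (c u) (g u)) w = (\<Sum>u\<in>S. c u * g u w)" for w
    by (simp add: sum_fun_apply smul_apply)
  have "ev L (\<Sum>u\<in>S. smul (c u) (g u)) z = (\<Sum>w\<in>?W. smul ((\<Sum>u\<in>S. smul (c u) (g u)) w) (word_act L w z))"
  proof (rule ev_eq[OF finite_words])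
    fix w assume "(\<Sum>u\<in>S. smul (c u) (g u)) w \<noteq> 0"
    then obtain u where "u \<in> S" "c u * g u w \<noteq> 0" unfolding app by (rule sum.not_neutral_contains_not_neutral)
    then show "w \<in> ?W" using g[of u] by (auto simp: word_supp_def)
  qed
  also have "\<dots> = (\<Sum>w\<in>?W. \<Sum>u\<in>S. smul (c u) (smul (g u w) (word_act L w z)))"
    unfolding app by (simp add: fun_vs.scale_sum_left smul_smul)
  also have "\<dots> = (\<Sum>u\<in>S. \<Sum>w\<in>?W. smul (c u) (smul (g u w) (word_act L w z)))"
    by (rule sum.swap)
  also have "\<dots> = (\<Sum>u\<in>S. smul (c u) (ev L (g u) z))"
    by (rule sum.cong) (simp_all add: ev_g fun_vs.scale_sum_right)
  finally show ?thesis .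
qed

lemma universalD:
  fixes L :: "nat set \<Rightarrow> (nat set list \<Rightarrow> 'f::field) \<Rightarrow> 'f word_fun"
  assumes "universal n B V" "Q_rep n L M I" "A \<subseteq> {1..n}" "f \<in> level B D" "z \<in> M"
  shows "ev L (V A f) z - L A (ev L f z) \<in> I"
  using assms unfolding universal_def by blast

definition one_T :: "nat set list \<Rightarrow> 'f::field" where "one_T = unit_vec []"

lemma one_T_carrier: "one_T \<in> carrier (free_T F n)"
  by (auto simp: one_T_def unit_vec_def free_T_def tensor_algebra_def)

lemma one_T_eq: "\<one>\<^bsub>free_T F n\<^esub> = one_T"
  by (simp add: one_T_def unit_vec_def free_T_def tensor_algebra_def)

lemma homogeneous_carrier: "p \<in> homogeneous (generators n) i \<Longrightarrow> p \<in> carrier (free_T F n)"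
  by (simp add: homogeneous_def free_T_def)

lemma homogeneous_diff:
  fixes p q :: "nat set list \<Rightarrow> 'f::field"
  assumes "p \<in> homogeneous (generators n) i" "q \<in> homogeneous (generators n) i"
  shows "p - q \<in> homogeneous (generators n) i"
proof -
  have "p - q \<in> carrier (free_T TYPE('f) n)"
    by (rule Q_rep.M_diff[OF Q_rep_left_mult]) (use assms homogeneous_carrier in blast)+
  then show ?thesis using assms by (auto simp: homogeneous_def free_T_def) (metis diff_0_right)
qed

lemma homogeneous_left_mult:
  fixes p :: "nat set list \<Rightarrow> 'f::field"
  assumes "A \<subseteq> {1..n}" "p \<in> homogeneous (generators n) i"
  shows "left_mult A p \<in> homogeneous (generators n) (Suc i)"
proof -
  have "left_mult A p \<in> carrier (free_T TYPE('f) n)"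
    by (rule Q_rep.L_M[OF Q_rep_left_mult assms(1)]) (use assms(2) homogeneous_carrier in blast)
  moreover have "length w = Suc i" if "left_mult A p w \<noteq> 0" for w
    using that assms(2) by (auto simp: left_mult_def homogeneous_def split: list.splits if_splits)
  ultimately show ?thesis by (simp add: homogeneous_def free_T_def)
qed

lemma homogeneous_word:
  "set w \<subseteq> generators n \<Longrightarrow> word_act left_mult w one_T \<in> homogeneous (generators n) (length w)"
proof (induction w)
  case Nil
  then show ?case using one_T_carrier[of "TYPE('a)" n]
    by (auto simp: homogeneous_def free_T_def one_T_def unit_vec_def split: if_splits)
next
  case (Cons Z w)
  then have "Z \<subseteq> {1..n}" "Z - {Max Z} \<subseteq> {1..n}" by (auto simp: generators_def)
  then show ?case unfolding word_act.simps edge_def list.size add_Suc_right add_0_right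
    using Cons by (intro homogeneous_diff homogeneous_left_mult) auto
qed

section \<open>Comparison of the algebra with its module\<close>

context Q_model
begin

lemma act_left_mult:
  assumes "A \<subseteq> {1..n}" "p \<in> carrier (free_T F n)"
  shows "act (left_mult A p) f = VV A (act p f)"
  unfolding left_mult_eq[where F = F and n = n]
  using act_mult[of "basis_vec A" p f] assms basis_vec_closed[OF assms(1), of F]
  by (simp add: free_T_def act_basis_vec)

lemma act_edge_left_mult:
  assumes A: "A \<subseteq> {1..n}" and p: "p \<in> carrier (free_T F n)"
  shows "act (edge left_mult A j p) f = edge VV A j (act p f)"
proof -
  have Aj: "A - {j} \<subseteq> {1..n}" using A by auto
  have "left_mult A p \<in> carrier (free_T F n)" "left_mult (A - {j}) p \<in> carrier (free_T F n)"
    using Q_rep.L_M[OF Q_rep_left_mult] A Aj p by blast+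
  then show ?thesis unfolding edge_def
    by (simp add: act_diff[OF free_T_carrier_finite free_T_carrier_finite] act_left_mult[OF A p] act_left_mult[OF Aj p])
qed

text \<open>Multiplying the relator by the unit turns it into a difference of products of edges, to
  which the commutation of the \<open>VV\<close> operators applies.\<close>

lemma act_relator:
  assumes A: "A \<subseteq> {1..n}" and ij: "i \<in> A" "j \<in> A" "i \<noteq> j"
  shows "act (relator F n A i j) f = 0"
proof -
  interpret ring "free_T F n" by (rule ring_free_T)
  interpret R: Q_rep n left_mult "carrier (free_T F n)" "relation_ideal F n" by (rule Q_rep_left_mult)
  have sub: "A - {i} \<subseteq> {1..n}" "A - {j} \<subseteq> {1..n}" using A by auto
  have rel: "relator F n A i j \<in> carrier (free_T F n)"
    using relators_closed[of F n] A ij by (force simp: relators_def)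
  note o = one_T_carrier[of F n]
  note c = R.edge_L_M[OF sub(1) o] R.edge_L_M[OF sub(2) o]
  have "relator F n A i j = relator F n A i j \<otimes>\<^bsub>free_T F n\<^esub> one_T"
    using r_one[OF rel] by (simp only: one_T_eq)
  also have "\<dots> = edge left_mult A i (edge left_mult (A - {i}) j one_T) - edge left_mult A j (edge left_mult (A - {j}) i one_T)"
    by (rule relator_mult[OF A o])
  finally have "act (relator F n A i j) f
      = act (edge left_mult A i (edge left_mult (A - {i}) j one_T)) f - act (edge left_mult A j (edge left_mult (A - {j}) i one_T)) f"
    using act_diff[OF free_T_carrier_finite[OF R.edge_L_M[OF A c(1)]] free_T_carrier_finite[OF R.edge_L_M[OF A c(2)]]]
    by simp
  also have "\<dots> = 0"
    unfolding act_edge_left_mult[OF A c(1)] act_edge_left_mult[OF A c(2)]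
      act_edge_left_mult[OF sub(1) o] act_edge_left_mult[OF sub(2) o]
    using VV_comm[OF A ij] by simp
  finally show ?thesis .
qed

text \<open>The annihilator contains the relators and is a two-sided ideal. Closure under right
  multiplication requires the annihilation of all functions \<open>f\<close>, not merely of the
  generator \<open>[]\<close>.\<close>

lemma act_ideal:
  fixes F :: "'f itself"
  assumes "p \<in> relation_ideal F n"
  shows "act p f = 0"
proof -
  interpret ring "free_T F n" by (rule ring_free_T)
  define J where "J = {p \<in> carrier (free_T F n). \<forall>f. act p f = 0}"
  have "ideal J (free_T F n)"
  proof (rule idealI[OF ring_axioms])
    show "subgroup J (add_monoid (free_T F n))"
    proof (rule add.subgroupI)
      show "J \<noteq> {}" using zero_closed by (auto simp: J_def free_T_zero act_def intro!: exI[of _ 0])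
    next
      fix p assume "p \<in> J"
      then show "\<ominus>\<^bsub>free_T F n\<^esub> p \<in> J"
        using a_inv_closed[of p] act_smul[of "-1" p] by (simp add: J_def free_T_uminus)
    next
      fix p q assume "p \<in> J" "q \<in> J"
      then show "p \<oplus>\<^bsub>free_T F n\<^esub> q \<in> J"
        using a_closed[of p q] act_add[OF free_T_carrier_finite free_T_carrier_finite, of p F n q F n]
        by (simp add: J_def free_T_add)
    qed (auto simp: J_def)
  next
    fix a x assume a: "a \<in> J" and x: "x \<in> carrier (free_T F n)"
    then have aT: "a \<in> carrier (free_T F n)" by (simp add: J_def)
    have "act x 0 = 0"
    proof -
      have "foldr VV u 0 = 0" if "x u \<noteq> 0" for u
      proof -
        have "set u \<subseteq> generators n" using x that by (simp add: free_T_def tensor_algebra_def)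
        then show ?thesis by (induction u) (auto simp: generators_def VV_0)
      qed
      then show ?thesis unfolding act_def by (intro sum.neutral) simp
    qed
    then show "x \<otimes>\<^bsub>free_T F n\<^esub> a \<in> J" "a \<otimes>\<^bsub>free_T F n\<^esub> x \<in> J"
      using a x aT m_closed act_mult[of x a] act_mult[of a x] by (simp_all add: J_def free_T_def)
  qed
  moreover have "relators F n \<subseteq> J"
    using relators_closed[of F n] act_relator by (fastforce simp: J_def relators_def)
  ultimately have "relation_ideal F n \<subseteq> J"
    unfolding relation_ideal_def by (rule genideal_minimal)
  then show ?thesis using assms by (auto simp: J_def)
qed

text \<open>This separates the basis words: the element of the free algebra attached to
  \<open>w\<close> takes the generator to \<open>w\<close> itself. Linear independence modulo the
  ideal will follow.\<close>

lemma act_word: "w \<in> B \<Longrightarrow> act (word_act left_mult w one_T) (unit_vec []) = unit_vec w"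
proof (induction w)
  case Nil
  have "act one_T (unit_vec []) = unit_vec []"
    by (subst act_eq[of "{[]}"]) (auto simp: one_T_def unit_vec_def split: if_splits)
  then show ?case by simp
next
  case (Cons Z w)
  have w: "w \<in> B" using V_word[OF Cons.prems] by simp
  have Z: "Z \<subseteq> {1..n}" using B_words[OF Cons.prems] by (auto simp: generators_def)
  have "word_act left_mult w one_T \<in> carrier (free_T TYPE('f) n)"
    using homogeneous_word[OF B_words[OF w]] homogeneous_carrier by blast
  then show ?case
    using act_edge_left_mult[OF Z] Cons.IH[OF w] VV_word[OF Cons.prems] by simp
qed

lemma act_level:
  assumes p: "p \<in> homogeneous (generators n) i"
  shows "act p (unit_vec []) \<in> level B (Suc i)"
    and "p u \<noteq> 0 \<Longrightarrow> foldr VV u (unit_vec []) \<in> level B (Suc i)"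
proof -
  have fold: "foldr VV u (unit_vec []) \<in> level B (Suc (length u))" if "set u \<subseteq> generators n" for u
    using that
  proof (induction u)
    case Nil
    show ?case using Nil_B by (auto simp: level_def unit_vec_def)
  next
    case (Cons A u)
    then have "A \<subseteq> {1..n}" "foldr VV u (unit_vec []) \<in> level B (Suc (length u))"
      by (auto simp: generators_def)
    then show ?case using V_closed by (simp add: VV_level)
  qed
  then show *: "foldr VV u (unit_vec []) \<in> level B (Suc i)" if "p u \<noteq> 0" for u
    using p that by (force simp: homogeneous_def tensor_algebra_def)
  show "act p (unit_vec []) \<in> level B (Suc i)"
    unfolding act_def by (intro level_sum level_smul *) simp
qed

text \<open>The universal property, applied to the free algebra modulo the ideal with base point 1,
  shows that \<open>p\<close> can be recovered modulo the relations from its value on the generator.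
  On words this is an induction on the first letter. It yields the spanning half of the dimension
  count.\<close>

lemma ev_act:
  fixes F :: "'f itself"
  assumes univ: "universal n B V" and p: "p \<in> homogeneous (generators n) i"
  shows "p - ev left_mult (act p (unit_vec [])) one_T \<in> relation_ideal F n"
proof -
  interpret R: Q_rep n left_mult "carrier (free_T F n)" "relation_ideal F n" by (rule Q_rep_left_mult)
  have pT: "p \<in> carrier (free_T F n)" using homogeneous_carrier[OF p] .
  have fold: "unit_vec u - ev left_mult (foldr VV u (unit_vec [])) one_T \<in> relation_ideal F n \<and>
      foldr VV u (unit_vec []) \<in> level B (Suc (length u))" if "set u \<subseteq> generators n" for u
    using that
  proof (induction u)
    case Nil
    have "unit_vec [] - ev left_mult (unit_vec [] :: 'f word_fun) one_T = 0"
      unfolding ev_unit_vec word_act.simps one_T_def by (rule diff_self)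
    moreover have "unit_vec [] \<in> level B (Suc (length []))"
      using Nil_B by (auto simp: level_def unit_vec_def)
    ultimately show ?case using R.I_zero by (simp only: foldr.simps id_apply)
  next
    case (Cons A u)
    let ?f = "foldr VV u (unit_vec [])"
    have A: "A \<subseteq> {1..n}" "A \<noteq> {}" and u: "set u \<subseteq> generators n"
      using Cons.prems by (auto simp: generators_def)
    have f: "?f \<in> level B (Suc (length u))" and IH: "R.cong (unit_vec u) (ev left_mult ?f one_T)"
      unfolding R.cong_def using Cons.IH[OF u] by blast+
    have VA: "VV A ?f = V A ?f" by (rule VV_level[OF A(1) f])
    have "unit_vec (A # u) = left_mult A (unit_vec u :: 'f word_fun)"
      using A(2) by (auto simp: left_mult_def unit_vec_def fun_eq_iff split: list.split)
    also have "R.cong \<dots> (left_mult A (ev left_mult ?f one_T))"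
      by (rule R.L_cong[OF A(1) IH])
    also have "R.cong \<dots> (ev left_mult (V A ?f) one_T)"
      by (rule R.cong_sym, unfold R.cong_def)
        (rule universalD[OF univ Q_rep_left_mult A(1) f one_T_carrier])
    finally have "unit_vec (A # u) - ev left_mult (V A ?f) one_T \<in> relation_ideal F n"
      by (simp only: R.cong_def)
    then show ?case using V_closed[OF A(1) f] by (simp only: VA foldr.simps comp_apply list.size add_Suc_right add_0_right)
  qed
  let ?S = "{u. p u \<noteq> 0}"
  have fin: "finite ?S" by (rule free_T_carrier_finite[OF pT])
  have u: "set u \<subseteq> generators n" if "u \<in> ?S" for u
    using that pT by (auto simp: free_T_def tensor_algebra_def)
  have "p = (\<Sum>u\<in>?S. smul (p u) (unit_vec u))" by (rule finite_supp_sum_unit[OF fin])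
  also have "R.cong \<dots> (\<Sum>u\<in>?S. smul (p u) (ev left_mult (foldr VV u (unit_vec [])) one_T))"
    using fold[OF u] by (intro R.cong_sum R.cong_smul) (simp add: R.cong_def)
  also have "\<dots> = ev left_mult (act p (unit_vec [])) one_T"
    unfolding act_def using act_level(2)[OF p]
    by (intro ev_sum_smul[symmetric, OF fin]) (auto intro!: level_word_supp)
  finally show ?thesis by (simp add: R.cong_def)
qed

text \<open>The classes of the elements \<open>s w\<close> with \<open>w\<close> in \<open>B\<close>
  of length \<open>i\<close> form a basis: they span by \<open>ev_act\<close>, and they are
  independent because \<open>?\<Phi>\<close> is well defined modulo the ideal and takes
  \<open>s w\<close> to the unit vector of \<open>w\<close>.\<close>

lemma dim_Q_component:
  fixes F :: "'f itself"
  assumes univ: "universal n B V"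
  shows "ring.dim (Q_alg F n) (Q_scalars F n) (Q_component F n i) = card {w \<in> B. length w = i}"
proof -
  interpret h: ring_hom_ring "free_T F n" "Q_alg F n" "to_Q F n" by (rule ring_hom_to_Q)
  interpret I: ideal "relation_ideal F n" "free_T F n" by (rule relation_ideal_ideal)
  define s :: "nat set list \<Rightarrow> 'f word_fun" where "s w = word_act left_mult w one_T" for w
  let ?\<Phi> = "\<lambda>p. act p (unit_vec [])"
  have s: "s w \<in> homogeneous (generators n) (length w)" "s w \<in> carrier (free_T F n)" if "w \<in> B" for w
    unfolding s_def using homogeneous_word[OF B_words[OF that]] homogeneous_carrier by blast+
  have same: "p - q \<in> relation_ideal F n \<longleftrightarrow> to_Q F n p = to_Q F n q"
    if "p \<in> carrier (free_T F n)" "q \<in> carrier (free_T F n)" for p q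
    unfolding to_Q_def using h.R.quotient_eq_iff_same_a_r_cos[OF relation_ideal_ideal that] that
    by (simp add: free_T_minus)
  have span_in: "(\<Sum>w\<in>set ws. smul (f w) (s w)) \<in> h.R.Span (range scalar) (map s ws)"
    if "distinct ws" for f ws
    using that
  proof (induction ws)
    case (Cons w ws)
    have "smul (f w) (s w) + (\<Sum>w\<in>set ws. smul (f w) (s w))
        = scalar (f w) \<otimes>\<^bsub>free_T F n\<^esub> s w \<oplus>\<^bsub>free_T F n\<^esub> (\<Sum>w\<in>set ws. smul (f w) (s w))"
      by (simp only: free_T_smul free_T_add)
    then have "smul (f w) (s w) + (\<Sum>w\<in>set ws. smul (f w) (s w)) \<in> h.R.Span (range scalar) (map s (w # ws))"
      using Cons by (auto simp: h.R.line_extension_mem_iff)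
    moreover have "w \<notin> set ws" using Cons.prems by simp
    ultimately show ?case unfolding list.set by (simp only: sum.insert[OF finite_set] not_False_eq_True)
  qed (simp add: free_T_zero)
  \<comment> \<open>Homogeneity shows that the span stays inside the component; the support of
    \<open>?\<Phi> p\<close> is what excludes a further word from the span later.\<close>
  have span_out: "p \<in> homogeneous (generators n) i \<and> (\<forall>v. ?\<Phi> p v \<noteq> 0 \<longrightarrow> v \<in> set ws)"
    if "set ws \<subseteq> {w \<in> B. length w = i}" "p \<in> h.R.Span (range scalar) (map s ws)" for p ws
    using that
  proof (induction ws arbitrary: p)
    case Nil
    then have "p = 0" by (simp add: free_T_zero)
    moreover have "(0 :: 'f word_fun) \<in> homogeneous (generators n) i"
      unfolding homogeneous_def using h.R.zero_closed unfolding free_T_zero by (simp add: free_T_def)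
    moreover have "act 0 (unit_vec []) v = 0" for v by (simp add: act_def)
    ultimately show ?case by blast
  next
    case (Cons w ws)
    obtain c q where q: "q \<in> h.R.Span (range scalar) (map s ws)" and pq: "p = smul c (s w) + q"
      using Cons.prems(2) by (auto simp: h.R.line_extension_mem_iff free_T_smul free_T_add)
    have w: "w \<in> B" "length w = i" using Cons.prems by auto
    have IH: "q \<in> homogeneous (generators n) i" "\<And>v. ?\<Phi> q v \<noteq> 0 \<Longrightarrow> v \<in> set ws"
      using Cons.IH[OF _ q] Cons.prems(1) by auto
    have qT: "q \<in> carrier (free_T F n)" by (rule homogeneous_carrier[OF IH(1)])
    interpret R: Q_rep n left_mult "carrier (free_T F n)" "relation_ideal F n" by (rule Q_rep_left_mult)
    have cs: "smul c (s w) \<in> carrier (free_T F n)" using s(2)[OF w(1)] by (rule R.M_smul)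
    have "length v = i" if "p v \<noteq> 0" for v
    proof -
      have "s w v \<noteq> 0 \<or> q v \<noteq> 0" using that by (auto simp: pq smul_apply)
      then show ?thesis using s(1)[OF w(1)] w(2) IH(1) by (auto simp: homogeneous_def)
    qed
    moreover have "p \<in> carrier (free_T F n)" unfolding pq using cs qT by (rule R.M_add)
    moreover have "?\<Phi> p = smul c (unit_vec w) + ?\<Phi> q"
      unfolding pq act_add[OF free_T_carrier_finite[OF cs] free_T_carrier_finite[OF qT]] act_smul
      using act_word[OF w(1)] by (simp add: s_def)
    then have "?\<Phi> p v \<noteq> 0 \<Longrightarrow> v \<in> set (w # ws)" for v
      using IH(2)[of v] by (auto simp: smul_apply unit_vec_def split: if_splits)
    ultimately show ?case by (simp add: homogeneous_def free_T_def)
  qed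
  have span_hom: "h.S.Span (Q_scalars F n) (map (to_Q F n) (map s ws)) = to_Q F n ` h.R.Span (range scalar) (map s ws)"
    if "set ws \<subseteq> B" for ws
    unfolding Q_scalars_def
    by (rule h.Span_hom) (use that s in \<open>auto simp: free_T_def scalar_closed\<close>)
  have indep: "h.S.independent (Q_scalars F n) (map (to_Q F n) (map s ws))"
    if "distinct ws" "set ws \<subseteq> {w \<in> B. length w = i}" for ws
    using that
  proof (induction ws)
    case (Cons w ws)
    have w: "w \<in> B" using Cons.prems by simp
    have "to_Q F n (s w) \<notin> h.S.Span (Q_scalars F n) (map (to_Q F n) (map s ws))"
    proof
      assume "to_Q F n (s w) \<in> h.S.Span (Q_scalars F n) (map (to_Q F n) (map s ws))"
      then obtain p where p: "p \<in> h.R.Span (range scalar) (map s ws)" and eq: "to_Q F n (s w) = to_Q F n p"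
        using span_hom[of ws] Cons.prems by auto
      have ph: "p \<in> homogeneous (generators n) i" and pv: "\<And>v. ?\<Phi> p v \<noteq> 0 \<Longrightarrow> v \<in> set ws"
        using span_out[OF _ p] Cons.prems by auto
      have pT: "p \<in> carrier (free_T F n)" by (rule homogeneous_carrier[OF ph])
      have "?\<Phi> (s w - p) = 0" using same[OF s(2)[OF w] pT] eq by (intro act_ideal) simp
      then have "?\<Phi> p = unit_vec w"
        using act_diff[OF free_T_carrier_finite[OF s(2)[OF w]] free_T_carrier_finite[OF pT]] act_word[OF w]
        by (simp add: s_def)
      then have "w \<in> set ws" using pv[of w] by (simp add: unit_vec_def)
      then show False using Cons.prems by simp
    qed
    then show ?case using Cons s(2)[OF w] by (auto intro!: h.S.independent.li_Cons)
  qed simp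
  have "finite {w \<in> B. length w = i}" using finite_words_of[of "Suc i"] by (simp add: words_of_Suc)
  then obtain ws where ws: "set ws = {w \<in> B. length w = i}" "distinct ws"
    using finite_distinct_list by blast
  have "Q_component F n i = h.S.Span (Q_scalars F n) (map (to_Q F n) (map s ws))"
  proof
    show "h.S.Span (Q_scalars F n) (map (to_Q F n) (map s ws)) \<subseteq> Q_component F n i"
      using span_hom[of ws] span_out[of ws] ws(1) by (auto simp: Q_component_def)
    show "Q_component F n i \<subseteq> h.S.Span (Q_scalars F n) (map (to_Q F n) (map s ws))"
      unfolding Q_component_def
    proof (rule image_subsetI)
      fix p :: "'f word_fun" assume p: "p \<in> homogeneous (generators n) i"
      let ?q = "ev left_mult (?\<Phi> p) one_T"
      have "?q = (\<Sum>w\<in>set ws. smul (?\<Phi> p w) (s w))"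
        unfolding s_def using act_level(1)[OF p] ws(1) by (intro ev_eq[OF finite_set]) (auto simp: level_def)
      then have q: "?q \<in> h.R.Span (range scalar) (map s ws)" using span_in[OF ws(2)] by simp
      then have "?q \<in> carrier (free_T F n)" using span_out[of ws ?q] ws(1) homogeneous_carrier by blast
      then have "to_Q F n p = to_Q F n ?q"
        using same[OF homogeneous_carrier[OF p]] ev_act[OF univ p, of F] by blast
      then show "to_Q F n p \<in> h.S.Span (Q_scalars F n) (map (to_Q F n) (map s ws))"
        using q span_hom[of ws] ws(1) by auto
    qed
  qed
  moreover have "h.S.dimension (length (map (to_Q F n) (map s ws))) (Q_scalars F n)
      (h.S.Span (Q_scalars F n) (map (to_Q F n) (map s ws)))"
    by (rule h.S.dimension_independent[OF indep]) (use ws in auto)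
  ultimately have "h.S.dim (Q_scalars F n) (Q_component F n i) = length ws"
    using h.S.dimI[OF subfield_Q_scalars] by (simp add: over_def)
  then show ?thesis using ws distinct_card by metis
qed

end

section \<open>Closed form of the Hilbert series and the recursion\<close>

lemma hilbert_Q_closed_form:
  "hilbert_Q TYPE('f::field) n * (1 - fps_X * (2 - fps_X) ^ n) = 1 - fps_X"
proof -
  obtain B and V :: "nat set \<Rightarrow> 'f word_fun \<Rightarrow> 'f word_fun"
    where M: "Q_model n B V" and U: "universal n B V"
      and G: "gf B * (1 - fps_X * (2 - fps_X) ^ n) = 1 - fps_X"
    using model_exists by blast
  have "hilbert_Q TYPE('f) n = gf B"
    unfolding hilbert_Q_def gf_def Q_model.dim_Q_component[OF M U] ..
  then show ?thesis using G by simp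
qed

lemma inverse_hilbert_Q:
  "(1 / hilbert_Q TYPE('f::field) n) * (1 - fps_X) = 1 - fps_X * (2 - fps_X) ^ n"
proof -
  let ?H = "hilbert_Q TYPE('f) n" and ?P = "1 - fps_X * (2 - fps_X) ^ n :: rat fps"
  \<comment> \<open>The closed form already forces a nonzero constant term, hence invertibility of
    the Hilbert series.\<close>
  have "fps_nth (?H * ?P) 0 = 1" unfolding hilbert_Q_closed_form by simp
  then have H: "fps_nth ?H 0 \<noteq> 0" by (auto simp: fps_mult_nth)
  have "(1 / ?H) * (1 - fps_X) = inverse ?H * (?H * ?P)"
    unfolding hilbert_Q_closed_form using H by (simp add: fps_divide_unit)
  also have "\<dots> = ?P" using inverse_mult_eq_1[OF H] by (simp add: mult.assoc[symmetric])
  finally show ?thesis .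
qed

theorem corollary4p9:
  fixes n :: nat
  assumes "n \<ge> 1"
  shows "1 / hilbert_Q TYPE('f::field) n
    = (2 - fps_X) * (1 / hilbert_Q TYPE('f) (n - 1)) - 1"
proof -
  have n: "n = Suc (n - 1)" using assms by simp
  let ?q = "(2 - fps_X :: rat fps) ^ (n - 1)"
  let ?h = "1 / hilbert_Q TYPE('f) (n - 1)"
  \<comment> \<open>Both sides are compared after multiplication by the nonzero series
    \<open>1 - t\<close>, where the inverses become polynomials.\<close>
  have "(1 / hilbert_Q TYPE('f) n) * (1 - fps_X) = 1 - fps_X * ((2 - fps_X) * ?q)"
    unfolding inverse_hilbert_Q by (subst n) simp
  also have "\<dots> = (2 - fps_X) * (1 - fps_X * ?q) - (1 - fps_X)" by (simp add: algebra_simps)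
  also have "\<dots> = (2 - fps_X) * (?h * (1 - fps_X)) - (1 - fps_X)" unfolding inverse_hilbert_Q ..
  also have "\<dots> = ((2 - fps_X) * ?h - 1) * (1 - fps_X)" by (simp add: algebra_simps)
  finally show ?thesis using fps_X_neq_one by simp
qed

end
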